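(* Let $G$ be a finite connected graph and $r\in\mathbb N$. Then $\mathcal T(N(G_r))$ is a tree-of-tangles of infinite resolution of the $r$-local covering $G_r$ of $G$.
   Context: Graphs are simple. Walks, closed walks, reduction (iteratively removing subwalks $ueveu$), homotopy (equal reductions) and the combinatorial fundamental group $\pi_1(G,x_0)$ are as usual. A closed walk $W$ at $x_0$ stems from a cycle $O$ if $W=W_0QW_0^-$ with $Q$ a closed walk traversing each edge of $O$ exactly once. The $r$-local subgroup $\pi_1^r(G,x_0)$ is generated by the closed walks at $x_0$ stemming from cycles of length $\le r$. A covering is an epimorphism $p\colon C\to G$ mapping the edges at each vertex $v$ bijectively to the edges at $p(v)$. The $r$-local covering $p_r\colon G_r\to G$ is the (unique up to isomorphism) covering such that $p_r$ induces an isomorphism from $\pi_1(G_r,\hat x_0)$ to $\pi_1^r(G,x_0)$ for a lift $\hat x_0$ of $x_0$. Separations $\{A,B\}$ ($A\cup B=V$, no edges between $A\setminus B$ and $B\setminus A$), order $|A\cap B|$, orientations, $(A,B)\ge(C,D)$ iff $A\subseteq C$, $B\supseteq D$; nested/crossing; tight separations (both sides contain a component $K$ of $G-(A\cap B)$ with $N(K)=A\cap B$). $\top$-stars, relevance with base, $k$-bottlenecks, $N^k(\cdot)$, $N(\cdot)=\bigcup_k N^k(\cdot)$: as follows. A $\top$-star is a set of three distinct oriented separations $(A_i,B_i)$ with separators $X_i$ such that the $A_i\setminus B_i$ partition $V\setminus\bigcup X_i$ (as a near-partition, pairwise disjoint) and each vertex of an $X_i$ lies in another $X_j$; centre $Z=\bigcap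 X_i$, $X_{ij}=(X_i\cap X_j)\setminus Z$; relevant with base $\{A_1,B_1\}$ if $\{A_1,B_1\}$ is tight and for each $x\in X_{23}$ and $i\in\{2,3\}$ there is an $x$–$X_{1i}$ edge or a component $K$ of $G[A_i\setminus B_i]$ and $y\in X_{1i}\cup Z$ with $x,y\in N(K)$. A $k$-bottleneck is a non-empty set $\beta$ of tight $k$-separations such that if $\beta$ contains the base of a relevant $\top$-star whose constituents $\{A_i,B_i\}$ all have order $\le k$, then $\beta$ contains another constituent. With $X^k$ the union of all $k$-bottlenecks and $x^k(s)$ the number of elements of $X^k$ crossing $s$: $N^{<k}=\bigcup_{j<k}N^j$, $N^k(\beta)$ consists of the $s\in\beta$ nested with $N^{<k}$ and minimal in $x^k$ among such, $N^k=\bigcup_\beta N^k(\beta)$. $\mathcal T(N)$ for nested $N$: nodes are splitting stars of $N$ (stars $\sigma$ — $(A,B)\ge(D,C)$ for distinct $(A,B),(C,D)\in\sigma$ — of orientations of elements of $N$, not containing both orientations of any element, such that every element of $N$ has an orientation $\ge$ some element of $\sigma$), edges are the elements of $N$ joining the stars containing its two orientations, parts $G[\bigcap_{(A,B)\in t}B]$. Tangles as in Robertson–Seymour; a separation distinguishes two tangles if they orient it differently, efficiently if with minimum order. A tree-decomposition is a tree-of-tangles of resolution $k$ if every pair of tangles distinguished by some separation of order $\le k$ is efficiently distinguished by a separation induced by an edge of its decomposition tree; infinite resolution means resolution $k$ for every $k\in\mathbb N$. *)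

theory Defs
  imports
    "Graph_Theory.Graph_Theory"
    "HOL-Algebra.Generated_Groups"
    "HOL-Library.Extended_Nat"
begin

text \<open>
  Simple graphs are symmetric loopless pair digraphs: \<^locale>\<open>pair_graph\<close> if finite,
  \<^locale>\<open>pair_bidirected_digraph\<close> if possibly infinite. An edge is a pair of opposite arcs,
  and \<^const>\<open>connected\<close> includes non-emptiness. Walks are vertex walks (\<^const>\<open>vwalk\<close>).
\<close>

definition ecard :: "'a set \<Rightarrow> enat" where
  "ecard A = (if finite A then enat (card A) else \<infinity>)"


section \<open>Walks, homotopy, the fundamental group\<close>

definition walk_edges :: "'a vwalk \<Rightarrow> 'a set list" where
  "walk_edges W = map (\<lambda>(u, v). {u, v}) (vwalk_arcs W)"

definition closed_walk :: "('a, 'e) pre_digraph \<Rightarrow> 'a \<Rightarrow> 'a vwalk \<Rightarrow> bool" where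
  "closed_walk G x W \<longleftrightarrow> vwalk W G \<and> hd W = x \<and> last W = x"

definition reduce_step :: "'a vwalk \<Rightarrow> 'a vwalk \<Rightarrow> bool" where
  "reduce_step W W' \<longleftrightarrow> (\<exists>xs u v ys. W = xs @ [u, v, u] @ ys \<and> W' = xs @ [u] @ ys)"

definition is_reduction :: "'a vwalk \<Rightarrow> 'a vwalk \<Rightarrow> bool" where
  "is_reduction W R \<longleftrightarrow> reduce_step\<^sup>*\<^sup>* W R \<and> (\<nexists>R'. reduce_step R R')"

definition homotopic :: "'a vwalk \<Rightarrow> 'a vwalk \<Rightarrow> bool" where
  "homotopic W W' \<longleftrightarrow> (\<exists>R. is_reduction W R \<and> is_reduction W' R)"

definition homotopy_class :: "('a, 'e) pre_digraph \<Rightarrow> 'a \<Rightarrow> 'a vwalk \<Rightarrow> 'a vwalk set" where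
  "homotopy_class G x W = {W'. closed_walk G x W' \<and> homotopic W W'}"

definition fundamental_group :: "('a, 'e) pre_digraph \<Rightarrow> 'a \<Rightarrow> 'a vwalk set monoid" where
  "fundamental_group G x = \<lparr>
     carrier = {homotopy_class G x W | W. closed_walk G x W},
     mult = (\<lambda>\<alpha> \<beta>. \<Union>W\<in>\<alpha>. \<Union>W'\<in>\<beta>. homotopy_class G x (vwalk_join W W')),
     one = homotopy_class G x [x] \<rparr>"

text \<open>A cycle is represented by its edge set, so its length is the cardinality.
  (\<^const>\<open>pre_digraph.cycle\<close> would admit the two opposite arcs of one edge.)\<close>

definition graph_cycle :: "('a, 'e) pre_digraph \<Rightarrow> 'a set set \<Rightarrow> bool" where
  "graph_cycle G Z \<longleftrightarrow> (\<exists>vs. 3 \<le> length vs \<and> distinct vs \<and> vwalk (vs @ [hd vs]) G \<and>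
     Z = set (walk_edges (vs @ [hd vs])))"

definition stems_from :: "('a, 'e) pre_digraph \<Rightarrow> 'a vwalk \<Rightarrow> 'a set set \<Rightarrow> bool" where
  "stems_from G W Z \<longleftrightarrow> (\<exists>W\<^sub>0 Q. vwalk W\<^sub>0 G \<and> closed_walk G (last W\<^sub>0) Q \<and>
     distinct (walk_edges Q) \<and> set (walk_edges Q) = Z \<and>
     W = vwalk_join (vwalk_join W\<^sub>0 Q) (rev W\<^sub>0))"

definition local_subgroup :: "nat \<Rightarrow> ('a, 'e) pre_digraph \<Rightarrow> 'a \<Rightarrow> 'a vwalk set set" where
  "local_subgroup r G x = generate (fundamental_group G x)
     {homotopy_class G x W | W Z. closed_walk G x W \<and> graph_cycle G Z \<and> card Z \<le> r \<and>
        stems_from G W Z}"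


section \<open>Local coverings\<close>

text \<open>In a simple graph the edges at a vertex correspond to the arcs leaving it.\<close>

definition covering :: "'b pair_pre_digraph \<Rightarrow> 'a pair_pre_digraph \<Rightarrow> ('b \<Rightarrow> 'a) \<Rightarrow> bool" where
  "covering C G p \<longleftrightarrow> pair_bidirected_digraph C \<and>
     p ` pverts C = pverts G \<and> map_prod p p ` parcs C = parcs G \<and>
     (\<forall>v\<in>pverts C. bij_betw (map_prod p p)
        (out_arcs (with_proj C) v) (out_arcs (with_proj G) (p v)))"

definition induced_map ::
    "('a, 'e) pre_digraph \<Rightarrow> 'a \<Rightarrow> ('b \<Rightarrow> 'a) \<Rightarrow> 'b vwalk set \<Rightarrow> 'a vwalk set" where
  "induced_map G x p \<alpha> = (\<Union>W\<in>\<alpha>. homotopy_class G x (map p W))"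

text \<open>Connectedness of the covering graph is the usual convention for coverings; without it the
  \<open>r\<close>-local covering would not be unique up to isomorphism.\<close>

definition local_covering ::
    "nat \<Rightarrow> 'b pair_pre_digraph \<Rightarrow> 'a pair_pre_digraph \<Rightarrow> ('b \<Rightarrow> 'a) \<Rightarrow> 'b \<Rightarrow> 'a \<Rightarrow> bool" where
  "local_covering r C G p y x \<longleftrightarrow>
     covering C G p \<and> connected (with_proj C) \<and>
     x \<in> pverts G \<and> y \<in> pverts C \<and> p y = x \<and>
     induced_map (with_proj G) x p
       \<in> iso (fundamental_group (with_proj C) y)
             ((fundamental_group (with_proj G) x)
                \<lparr>carrier := local_subgroup r (with_proj G) x\<rparr>)"


section \<open>Separations\<close>

text \<open>A separation is the unordered pair \<open>{A, B}\<close>; its separator is \<open>A \<inter> B = \<Inter>{A, B}\<close>.\<close>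

type_synonym 'a sep = "'a set set"
type_synonym 'a osep = "'a set \<times> 'a set"

definition is_separation :: "'a pair_pre_digraph \<Rightarrow> 'a set \<Rightarrow> 'a set \<Rightarrow> bool" where
  "is_separation G A B \<longleftrightarrow> A \<union> B = pverts G \<and>
     (\<forall>u\<in>A - B. \<forall>v\<in>B - A. (u, v) \<notin> parcs G \<and> (v, u) \<notin> parcs G)"

definition separations :: "'a pair_pre_digraph \<Rightarrow> 'a sep set" where
  "separations G = {{A, B} | A B. is_separation G A B}"

definition sep_order :: "'a sep \<Rightarrow> enat" where
  "sep_order s = ecard (\<Inter>s)"

definition unorient :: "'a osep \<Rightarrow> 'a sep" where
  "unorient a = {fst a, snd a}"

definition separator :: "'a osep \<Rightarrow> 'a set" where
  "separator a = fst a \<inter> snd a"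

definition osep_ge :: "'a osep \<Rightarrow> 'a osep \<Rightarrow> bool" where
  "osep_ge a b \<longleftrightarrow> fst a \<subseteq> fst b \<and> snd b \<subseteq> snd a"

definition nested :: "'a sep \<Rightarrow> 'a sep \<Rightarrow> bool" where
  "nested s t \<longleftrightarrow> (\<exists>a b. unorient a = s \<and> unorient b = t \<and> osep_ge a b)"

abbreviation crossing :: "'a sep \<Rightarrow> 'a sep \<Rightarrow> bool" where
  "crossing s t \<equiv> \<not> nested s t"

text \<open>The strong components of a symmetric digraph are the components of the graph.\<close>

definition components_of :: "'a pair_pre_digraph \<Rightarrow> 'a set \<Rightarrow> 'a set set" where
  "components_of G S = pre_digraph.sccs_verts (with_proj G \<restriction> S)"

definition nbhd :: "'a pair_pre_digraph \<Rightarrow> 'a set \<Rightarrow> 'a set" where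
  "nbhd G K = {v \<in> pverts G - K. \<exists>u\<in>K. (u, v) \<in> parcs G}"

definition tight :: "'a pair_pre_digraph \<Rightarrow> 'a sep \<Rightarrow> bool" where
  "tight G s \<longleftrightarrow> (\<exists>A B. s = {A, B} \<and> is_separation G A B \<and>
     (\<exists>K\<in>components_of G (pverts G - A \<inter> B). K \<subseteq> A \<and> nbhd G K = A \<inter> B) \<and>
     (\<exists>K\<in>components_of G (pverts G - A \<inter> B). K \<subseteq> B \<and> nbhd G K = A \<inter> B))"


section \<open>Bottlenecks\<close>

definition top_star :: "'a pair_pre_digraph \<Rightarrow> 'a osep \<Rightarrow> 'a osep \<Rightarrow> 'a osep \<Rightarrow> bool" where
  "top_star G a b c \<longleftrightarrow>
     distinct [a, b, c] \<and>
     (\<forall>s\<in>{a, b, c}. is_separation G (fst s) (snd s)) \<and>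
     (\<forall>s\<in>{a, b, c}. \<forall>t\<in>{a, b, c}. s \<noteq> t \<longrightarrow> (fst s - snd s) \<inter> (fst t - snd t) = {}) \<and>
     (\<Union>s\<in>{a, b, c}. fst s - snd s) = pverts G - (\<Union>s\<in>{a, b, c}. separator s) \<and>
     (\<forall>s\<in>{a, b, c}. \<forall>v\<in>separator s. \<exists>t\<in>{a, b, c} - {s}. v \<in> separator t)"

text \<open>Relevance of the star \<open>{a, b, c}\<close> with base the first entry \<open>a\<close>.\<close>

definition relevant :: "'a pair_pre_digraph \<Rightarrow> 'a osep \<Rightarrow> 'a osep \<Rightarrow> 'a osep \<Rightarrow> bool" where
  "relevant G a b c \<longleftrightarrow>
     (let Z = separator a \<inter> separator b \<inter> separator c in
      tight G (unorient a) \<and>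
      (\<forall>x \<in> (separator b \<inter> separator c) - Z. \<forall>s\<in>{b, c}.
         (\<exists>y \<in> (separator a \<inter> separator s) - Z. (x, y) \<in> parcs G) \<or>
         (\<exists>K \<in> components_of G (fst s - snd s). \<exists>y \<in> ((separator a \<inter> separator s) - Z) \<union> Z.
            x \<in> nbhd G K \<and> y \<in> nbhd G K)))"

text \<open>\<open>Another constituent\<close> means one of the two non-base members of the star. Its underlying
  separation may coincide with the base: for every separation \<open>{A, B}\<close> with separator \<open>X\<close>, the
  star \<open>(A, B), (B, A), (X, V)\<close> is a \<open>\<top>\<close>-star.\<close>

definition bottleneck :: "'a pair_pre_digraph \<Rightarrow> nat \<Rightarrow> 'a sep set \<Rightarrow> bool" where
  "bottleneck G k \<beta> \<longleftrightarrow>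
     \<beta> \<noteq> {} \<and> (\<forall>s\<in>\<beta>. tight G s \<and> sep_order s = enat k) \<and>
     (\<forall>a b c. top_star G a b c \<longrightarrow> relevant G a b c \<longrightarrow>
        (\<forall>s\<in>{a, b, c}. sep_order (unorient s) \<le> enat k) \<longrightarrow>
        unorient a \<in> \<beta> \<longrightarrow> unorient b \<in> \<beta> \<or> unorient c \<in> \<beta>)"

definition bottleneck_seps :: "'a pair_pre_digraph \<Rightarrow> nat \<Rightarrow> 'a sep set" where
  "bottleneck_seps G k = \<Union>{\<beta>. bottleneck G k \<beta>}"

definition crossing_number :: "'a pair_pre_digraph \<Rightarrow> nat \<Rightarrow> 'a sep \<Rightarrow> enat" where
  "crossing_number G k s = ecard {t \<in> bottleneck_seps G k. crossing t s}"

text \<open>\<open>select_nested G k M \<beta>\<close> is \<open>N\<^sup>k(\<beta>)\<close> when \<open>M\<close> is \<open>N\<^sup><\<^sup>k\<close>.\<close>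

definition select_nested :: "'a pair_pre_digraph \<Rightarrow> nat \<Rightarrow> 'a sep set \<Rightarrow> 'a sep set \<Rightarrow> 'a sep set" where
  "select_nested G k M \<beta> =
     (let S = {s \<in> \<beta>. \<forall>t\<in>M. nested s t}
      in {s \<in> S. \<forall>s'\<in>S. crossing_number G k s \<le> crossing_number G k s'})"

fun N_level :: "'a pair_pre_digraph \<Rightarrow> nat \<Rightarrow> 'a sep set" where
  "N_level G k = (\<Union>\<beta>\<in>{\<beta>. bottleneck G k \<beta>}. select_nested G k (\<Union>j\<in>{..<k}. N_level G j) \<beta>)"

declare N_level.simps [simp del]

definition N_set :: "'a pair_pre_digraph \<Rightarrow> 'a sep set" where
  "N_set G = (\<Union>k. N_level G k)"


section \<open>The decomposition tree of a nested set\<close>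

definition orientations :: "'a sep set \<Rightarrow> 'a osep set" where
  "orientations N = {a. unorient a \<in> N}"

definition star :: "'a osep set \<Rightarrow> bool" where
  "star \<sigma> \<longleftrightarrow> (\<forall>a\<in>\<sigma>. \<forall>b\<in>\<sigma>. a \<noteq> b \<longrightarrow> osep_ge a (prod.swap b))"

definition splitting_stars :: "'a sep set \<Rightarrow> 'a osep set set" where
  "splitting_stars N = {\<sigma>. \<sigma> \<subseteq> orientations N \<and> star \<sigma> \<and>
     (\<nexists>A B. (A, B) \<in> \<sigma> \<and> (B, A) \<in> \<sigma>) \<and>
     (\<forall>s\<in>N. \<exists>a. unorient a = s \<and> (\<exists>b\<in>\<sigma>. osep_ge a b))}"

definition star_containing :: "'a sep set \<Rightarrow> 'a osep \<Rightarrow> 'a osep set" where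
  "star_containing N a = (THE \<sigma>. \<sigma> \<in> splitting_stars N \<and> a \<in> \<sigma>)"

text \<open>Each element of \<open>N\<close> is an edge, represented by its two orientations as opposite arcs.\<close>

definition decomp_tree :: "'a sep set \<Rightarrow> ('a osep set, 'a osep) pre_digraph" where
  "decomp_tree N = \<lparr> verts = splitting_stars N, arcs = orientations N,
     tail = star_containing N, head = (\<lambda>a. star_containing N (prod.swap a)) \<rparr>"

definition decomp_tree_well_defined :: "'a sep set \<Rightarrow> bool" where
  "decomp_tree_well_defined N \<longleftrightarrow>
     (\<forall>s\<in>N. \<forall>t\<in>N. nested s t) \<and>
     (\<forall>a\<in>orientations N. \<exists>!\<sigma>. \<sigma> \<in> splitting_stars N \<and> a \<in> \<sigma>)"

text \<open>The vertex set of the part at \<open>\<sigma>\<close>; intersecting with the vertex set matters for \<open>\<sigma> = {}\<close>.\<close>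

definition part :: "'a pair_pre_digraph \<Rightarrow> 'a osep set \<Rightarrow> 'a set" where
  "part G \<sigma> = {v \<in> pverts G. \<forall>a\<in>\<sigma>. v \<in> snd a}"


section \<open>Tree-decompositions\<close>

text \<open>\<^const>\<open>tree\<close> excludes directed cycles only, hence is not the notion for symmetric digraphs.\<close>

definition graph_tree :: "('t, 'e) pre_digraph \<Rightarrow> bool" where
  "graph_tree T \<longleftrightarrow> sym_digraph T \<and> loopfree_digraph T \<and> nomulti_digraph T \<and>
     connected T \<and> (\<nexists>Z. graph_cycle T Z)"

definition tree_decomposition ::
    "'a pair_pre_digraph \<Rightarrow> ('t, 'e) pre_digraph \<Rightarrow> ('t \<Rightarrow> 'a set) \<Rightarrow> bool" where
  "tree_decomposition G T V \<longleftrightarrow> graph_tree T \<and>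
     (\<Union>t\<in>verts T. V t) = pverts G \<and>
     (\<forall>(u, v)\<in>parcs G. \<exists>t\<in>verts T. u \<in> V t \<and> v \<in> V t) \<and>
     (\<forall>P. vpath P T \<longrightarrow> (\<forall>t\<in>set P. V (hd P) \<inter> V (last P) \<subseteq> V t))"

definition delete_edge :: "('t, 'e) pre_digraph \<Rightarrow> 'e \<Rightarrow> ('t, 'e) pre_digraph" where
  "delete_edge T e = T\<lparr>arcs := {f \<in> arcs T. {tail T f, head T f} \<noteq> {tail T e, head T e}}\<rparr>"

definition tree_side :: "('t, 'e) pre_digraph \<Rightarrow> ('t \<Rightarrow> 'a set) \<Rightarrow> 'e \<Rightarrow> 't \<Rightarrow> 'a set" where
  "tree_side T V e t = (\<Union>u\<in>{u. t \<rightarrow>\<^sup>*\<^bsub>delete_edge T e\<^esub> u}. V u)"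

definition induced_separation :: "('t, 'e) pre_digraph \<Rightarrow> ('t \<Rightarrow> 'a set) \<Rightarrow> 'e \<Rightarrow> 'a sep" where
  "induced_separation T V e = {tree_side T V e (tail T e), tree_side T V e (head T e)}"


section \<open>Tangles\<close>

definition tangle :: "'a pair_pre_digraph \<Rightarrow> nat \<Rightarrow> 'a osep set \<Rightarrow> bool" where
  "tangle G k \<tau> \<longleftrightarrow> 1 \<le> k \<and>
     (\<forall>(A, B)\<in>\<tau>. is_separation G A B \<and> sep_order {A, B} < enat k) \<and>
     (\<forall>A B. is_separation G A B \<longrightarrow> sep_order {A, B} < enat k \<longrightarrow> (A, B) \<in> \<tau> \<or> (B, A) \<in> \<tau>) \<and>
     (\<forall>a\<in>\<tau>. \<forall>b\<in>\<tau>. \<forall>c\<in>\<tau>.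
        \<not> (fst a \<union> fst b \<union> fst c = pverts G \<and>
           (\<forall>(u, v)\<in>parcs G. \<exists>s\<in>{a, b, c}. u \<in> fst s \<and> v \<in> fst s)))"

definition distinguishes :: "'a sep \<Rightarrow> 'a osep set \<Rightarrow> 'a osep set \<Rightarrow> bool" where
  "distinguishes s \<tau> \<tau>' \<longleftrightarrow> (\<exists>A B. s = {A, B} \<and> (A, B) \<in> \<tau> \<and> (B, A) \<in> \<tau>')"

definition efficiently_distinguishes ::
    "'a pair_pre_digraph \<Rightarrow> 'a sep \<Rightarrow> 'a osep set \<Rightarrow> 'a osep set \<Rightarrow> bool" where
  "efficiently_distinguishes G s \<tau> \<tau>' \<longleftrightarrow> s \<in> separations G \<and> distinguishes s \<tau> \<tau>' \<and>
     (\<forall>s'\<in>separations G. distinguishes s' \<tau> \<tau>' \<longrightarrow> sep_order s \<le> sep_order s')"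

definition tree_of_tangles ::
    "'a pair_pre_digraph \<Rightarrow> nat \<Rightarrow> ('t, 'e) pre_digraph \<Rightarrow> ('t \<Rightarrow> 'a set) \<Rightarrow> bool" where
  "tree_of_tangles G k T V \<longleftrightarrow> tree_decomposition G T V \<and>
     (\<forall>l l' \<tau> \<tau>'. tangle G l \<tau> \<longrightarrow> tangle G l' \<tau>' \<longrightarrow>
        (\<exists>s\<in>separations G. sep_order s \<le> enat k \<and> distinguishes s \<tau> \<tau>') \<longrightarrow>
        (\<exists>e\<in>arcs T. efficiently_distinguishes G (induced_separation T V e) \<tau> \<tau>'))"

definition tree_of_tangles_infinite ::
    "'a pair_pre_digraph \<Rightarrow> ('t, 'e) pre_digraph \<Rightarrow> ('t \<Rightarrow> 'a set) \<Rightarrow> bool" where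
  "tree_of_tangles_infinite G T V \<longleftrightarrow> (\<forall>k. tree_of_tangles G k T V)"

end

theory Submission
  imports Defs
begin

text \<open>
  By submodularity, crossing separations in two \<open>k\<close>-bottlenecks can be replaced by corners with a
  smaller total crossing number, so \<open>N\<close> is nested. The separations of minimum order distinguishing two
  tangles form a bottleneck, hence \<open>N\<close> contains one of them. What remains is that \<open>N\<close> is discrete
  enough to yield a tree. In a connected locally finite graph only finitely many tight separations
  of order at most \<open>K\<close> separate two given vertices, so it suffices that the orders of
  the elements of \<open>N\<close> are bounded.

  The bound is a variant of Dunwoody's accessibility argument. As the closed walks of the local
  covering are generated by lifts of cycles of length at most \<open>r\<close>, the separator of a tight separation
  is connected by steps of length at most \<open>r\<close>. Hence, walking along its separator, every element \<open>a\<close>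
  of \<open>N\<close> is seen to be the outermost one among those inducing the same partition of some ball of radius
  \<open>r + 1\<close> around a vertex of its separator, and is determined by this ball and partition. Since
  the deck transformations act transitively on the fibres and preserve \<open>N\<close>, there are only finitely many
  such balls and partitions up to symmetry, so only finitely many orders.
\<close>

section \<open>Tight separations in locally finite graphs\<close>

text \<open>Tangles of all orders are treated at once, so \<open>N_set C\<close> mixes all levels,
  whereas local finiteness controls tight separations only up to a given order. With a bound,
  intervals are finite, which makes the tree connected, and chains above a vertex or an edge stop,
  which puts it into a part. The bound must be found without already having one: for each
  \<open>k\<close> outermost elements are chosen within the levels up to \<open>k\<close>, and the
  number of available patterns does not depend on \<open>k\<close>. Generation by short closed walks
  is used in two ways. For separators it enters modulo 2, through the parity of the number of times
  a walk uses edges of a fixed set. For deck transformations it enters through normality: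
  conjugating a generator by a closed walk gives a generator again, so lifts of closed walks close
  up at every point of the fibre. Tightness enters as a pair of full components. They make the
  separator minimal between two neighbours of each of its vertices, make each side connected, and
  verify relevance of the stars formed by corners.\<close>

abbreviation conn :: "'a pair_pre_digraph \<Rightarrow> 'a set \<Rightarrow> 'a \<Rightarrow> 'a \<Rightarrow> bool" where
  "conn G S u v \<equiv> (u, v) \<in> rtrancl_on S (parcs G)"

lemma conn_mono: "conn G S u v \<Longrightarrow> S \<subseteq> T \<Longrightarrow> conn G T u v"
  by (rule rtrancl_on_mono[where s = "parcs G" and F = S]) auto

text \<open>A separator between the two ends must meet this finite set; this is how finiteness
  enters later.\<close>

lemma conn_finite:
  assumes "conn G S u v"
  obtains F where "finite F" "F \<subseteq> S" "conn G F u v"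
proof -
  have "\<exists>F. finite F \<and> F \<subseteq> S \<and> conn G F u v"
    using assms
  proof (induct rule: rtrancl_on_induct)
    case base
    then show ?case by (intro exI[of _ "{u}"]) auto
  next
    case (step y z)
    then obtain F where F: "finite F" "F \<subseteq> S" "conn G F u y" by blast
    have "conn G (insert z F) u y"
      by (rule conn_mono[OF F(3)]) auto
    then have "conn G (insert z F) u z"
      using step(2) by (rule rtrancl_on_into_rtrancl_on) simp
    then show ?case
      using F step by (intro exI[of _ "insert z F"]) auto
  qed
  then show ?thesis using that by blast
qed

lemma conn_stays:
  assumes "conn G S u v" "u \<in> P"
    and "\<And>a b. a \<in> S \<Longrightarrow> b \<in> S \<Longrightarrow> a \<in> P \<Longrightarrow> (a, b) \<in> parcs G \<Longrightarrow> b \<in> P"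
  shows "conn G (S \<inter> P) u v"
  using assms(1)
proof (induct rule: rtrancl_on_induct)
  case base
  then show ?case using assms(2) by auto
next
  case (step y z)
  then have "y \<in> P" using in_rtrancl_on_in_F by fastforce
  then have "z \<in> P" using step assms(3) by blast
  then show ?case using step by (auto intro: rtrancl_on_into_rtrancl_on)
qed

text \<open>Cuts a walk at its first arc out of \<open>P\<close>, so that the initial piece remains
  usable inside \<open>P\<close>.\<close>

lemma conn_exit:
  assumes "conn G S u v" "u \<in> P" "v \<notin> P"
  obtains a b where "a \<in> P" "b \<notin> P" "b \<in> S" "(a, b) \<in> parcs G" "conn G (S \<inter> P) u a"
proof -
  have "v \<in> P \<and> conn G (S \<inter> P) u v \<or>
      (\<exists>a b. a \<in> P \<and> b \<notin> P \<and> b \<in> S \<and> (a, b) \<in> parcs G \<and> conn G (S \<inter> P) u a)"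
    using assms(1)
  proof (induct rule: rtrancl_on_induct)
    case base
    then show ?case using assms(2) by auto
  next
    case (step y z)
    then show ?case
      by (cases "z \<in> P") (auto intro: rtrancl_on_into_rtrancl_on)
  qed
  then show ?thesis using assms(3) that by blast
qed

lemma conn_sym:
  assumes "\<And>a b. (a, b) \<in> parcs G \<Longrightarrow> (b, a) \<in> parcs G" "conn G S u v"
  shows "conn G S v u"
  using rtrancl_on_sym[of "parcs G" S] assms unfolding sym_def by blast

lemma reachable_induce_iff:
  "(u \<rightarrow>\<^sup>*\<^bsub>with_proj G \<restriction> S\<^esub> v) \<longleftrightarrow> conn G S u v"
proof -
  have "rtrancl_on S {(a, b) \<in> parcs G. a \<in> S \<and> b \<in> S} = rtrancl_on S (parcs G)" (is "?L = ?R")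
  proof -
    have "(a, b) \<in> ?R" if "(a, b) \<in> ?L" for a b
      using that by (rule rtrancl_on_mono[rotated 2]) auto
    moreover have "(a, b) \<in> ?L" if "(a, b) \<in> ?R" for a b
      using that by (induct rule: rtrancl_on_induct) (auto intro: rtrancl_on_into_rtrancl_on)
    ultimately show ?thesis by auto
  qed
  moreover have "arcs_ends (with_proj G \<restriction> S) = {(a, b) \<in> parcs G. a \<in> S \<and> b \<in> S}"
    by (auto simp: arcs_ends_conv induce_subgraph_def)
  ultimately show ?thesis
    by (simp add: reachable_def)
qed

text \<open>A component of \<open>G\<close> minus \<open>X\<close> whose neighbourhood is exactly
  \<open>X\<close>, as in the definition of tightness but without strong components;
  \<open>full_component_iff\<close> is the translation.\<close>

definition full_component :: "'a pair_pre_digraph \<Rightarrow> 'a set \<Rightarrow> 'a set \<Rightarrow> bool" where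
  "full_component G X K \<longleftrightarrow> K \<noteq> {} \<and> K \<subseteq> pverts G - X \<and> (\<forall>u\<in>K. \<forall>v\<in>K. conn G K u v) \<and>
     (\<forall>x\<in>X. \<exists>k\<in>K. (k, x) \<in> parcs G) \<and> (\<forall>k\<in>K. \<forall>v. (k, v) \<in> parcs G \<longrightarrow> v \<in> K \<union> X)"

lemma full_componentD:
  assumes "full_component G X K"
  shows "K \<noteq> {}" "K \<subseteq> pverts G" "K \<inter> X = {}"
    and "\<And>u v. u \<in> K \<Longrightarrow> v \<in> K \<Longrightarrow> conn G K u v"
    and "\<And>x. x \<in> X \<Longrightarrow> \<exists>k\<in>K. (k, x) \<in> parcs G"
    and "\<And>k v. k \<in> K \<Longrightarrow> (k, v) \<in> parcs G \<Longrightarrow> v \<in> K \<union> X"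
  using assms unfolding full_component_def by blast+

lemma nested_iff:
  "nested {A, B} {E, F} \<longleftrightarrow> A \<subseteq> E \<and> F \<subseteq> B \<or> A \<subseteq> F \<and> E \<subseteq> B \<or> B \<subseteq> E \<and> F \<subseteq> A \<or> B \<subseteq> F \<and> E \<subseteq> A"
proof
  assume "nested {A, B} {E, F}"
  then show "A \<subseteq> E \<and> F \<subseteq> B \<or> A \<subseteq> F \<and> E \<subseteq> B \<or> B \<subseteq> E \<and> F \<subseteq> A \<or> B \<subseteq> F \<and> E \<subseteq> A"
    by (auto simp: nested_def unorient_def osep_ge_def doubleton_eq_iff)
next
  have u: "unorient (A, B) = {A, B}" "unorient (B, A) = {A, B}" for A B :: "'c set"
    by (auto simp: unorient_def)
  assume "A \<subseteq> E \<and> F \<subseteq> B \<or> A \<subseteq> F \<and> E \<subseteq> B \<or> B \<subseteq> E \<and> F \<subseteq> A \<or> B \<subseteq> F \<and> E \<subseteq> A"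
  then consider "osep_ge (A, B) (E, F)" | "osep_ge (A, B) (F, E)" | "osep_ge (B, A) (E, F)"
    | "osep_ge (B, A) (F, E)"
    by (auto simp: osep_ge_def)
  then show "nested {A, B} {E, F}"
    by cases (unfold nested_def; metis u)+
qed

section \<open>Tight separations in locally finite connected graphs: finiteness of families of
  bounded order\<close>

locale locally_finite_connected =
  fixes C :: "'b pair_pre_digraph"
  assumes arc_verts: "(u, v) \<in> parcs C \<Longrightarrow> u \<in> pverts C \<and> v \<in> pverts C"
    and arc_sym: "(u, v) \<in> parcs C \<Longrightarrow> (v, u) \<in> parcs C"
    and connected: "u \<in> pverts C \<Longrightarrow> v \<in> pverts C \<Longrightarrow> conn C (pverts C) u v"
    and finite_neighbours: "finite {v. (u, v) \<in> parcs C}"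
begin

lemma conn_symD: "conn C S u v \<Longrightarrow> conn C S v u"
  by (rule conn_sym[OF arc_sym])

lemma components_of_iff:
  "K \<in> components_of C S \<longleftrightarrow> (\<exists>u\<in>S. K = {v. conn C S u v})"
proof -
  have "K \<in> components_of C S \<longleftrightarrow> K \<noteq> {} \<and> (\<forall>u\<in>K. \<forall>v\<in>K. conn C S u v) \<and>
      (\<forall>u\<in>K. \<forall>v. v \<notin> K \<longrightarrow> \<not> conn C S u v)"
    unfolding components_of_def pre_digraph.sccs_verts_def reachable_induce_iff
    using conn_symD by (simp del: not_all)
  also have "\<dots> \<longleftrightarrow> (\<exists>u\<in>S. K = {v. conn C S u v})"
    (is "?P \<longleftrightarrow> ?Q")
  proof
    assume ?P
    then obtain u where "u \<in> K" by blast
    then have "v \<in> K \<longleftrightarrow> conn C S u v" for v using \<open>?P\<close> by blast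
    moreover have "conn C S u u" using \<open>?P\<close> \<open>u \<in> K\<close> by meson
    then have "u \<in> S" by (rule in_rtrancl_on_in_F)
    ultimately show ?Q by blast
  next
    assume ?Q
    then obtain u where "u \<in> S" "K = {v. conn C S u v}" by blast
    then show ?P
      using conn_symD rtrancl_on_trans[of _ _ S "parcs C"] by blast
  qed
  finally show ?thesis .
qed

lemma full_component_iff:
  "K \<in> components_of C (pverts C - X) \<and> nbhd C K = X \<longleftrightarrow> X \<subseteq> pverts C \<and> full_component C X K"
proof
  assume asm: "K \<in> components_of C (pverts C - X) \<and> nbhd C K = X"
  then obtain u where u: "u \<in> pverts C - X" and K: "K = {v. conn C (pverts C - X) u v}"
    by (auto simp: components_of_iff)
  have KX: "K \<subseteq> pverts C - X"
    using K in_rtrancl_on_in_F by fast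
  have step: "v \<in> K" if "k \<in> K" "(k, v) \<in> parcs C" "v \<in> pverts C - X" for k v
    using that K by (auto intro: rtrancl_on_into_rtrancl_on)
  have "conn C K u v" if "v \<in> K" for v
  proof -
    have "conn C ((pverts C - X) \<inter> K) u v"
      by (rule conn_stays) (use that K u step in auto)
    then show ?thesis
      by (rule conn_mono) auto
  qed
  then have c: "conn C K a b" if "a \<in> K" "b \<in> K" for a b
    using that conn_symD rtrancl_on_trans by meson
  have "X \<subseteq> pverts C" using asm by (auto simp: nbhd_def)
  moreover have "full_component C X K"
    unfolding full_component_def
  proof (intro conjI ballI allI impI)
    show "K \<noteq> {}" using u K by auto
    show "K \<subseteq> pverts C - X" by (rule KX)
    show "conn C K a b" if "a \<in> K" "b \<in> K" for a b using that by (rule c)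
    show "\<exists>k\<in>K. (k, x) \<in> parcs C" if "x \<in> X" for x
      using asm that unfolding nbhd_def by blast
    show "v \<in> K \<union> X" if "k \<in> K" "(k, v) \<in> parcs C" for k v
      using step[OF that] arc_verts[OF that(2)] by blast
  qed
  ultimately show "X \<subseteq> pverts C \<and> full_component C X K" ..
next
  assume asm: "X \<subseteq> pverts C \<and> full_component C X K"
  then obtain u where u: "u \<in> K" by (auto simp: full_component_def)
  have KX: "K \<subseteq> pverts C - X" using asm by (auto simp: full_component_def)
  have "conn C (pverts C - X) u v \<longleftrightarrow> v \<in> K" for v
  proof
    assume "v \<in> K"
    then have "conn C K u v" using u asm by (auto simp: full_component_def)
    then show "conn C (pverts C - X) u v" using KX by (rule conn_mono)
  next
    assume "conn C (pverts C - X) u v"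
    then have "conn C ((pverts C - X) \<inter> K) u v"
      by (rule conn_stays) (use asm u in \<open>auto simp: full_component_def\<close>)
    then show "v \<in> K" using in_rtrancl_on_in_F by fastforce
  qed
  then have "K = {v. conn C (pverts C - X) u v}" by auto
  then have "K \<in> components_of C (pverts C - X)"
    using u KX by (auto simp: components_of_iff)
  moreover have "nbhd C K = X"
    using asm arc_sym full_componentD[of C X K] unfolding nbhd_def by blast
  ultimately show "K \<in> components_of C (pverts C - X) \<and> nbhd C K = X" ..
qed

lemma is_separation_sym: "is_separation C A B \<longleftrightarrow> is_separation C B A"
  by (auto simp: is_separation_def)

text \<open>The definition picks some naming of the two sides. The condition is symmetric, so any
  naming will do, and a full component avoids the separator, so inside a side it lies strictly
  inside.\<close>

lemma tight_iff:
  "tight C {A, B} \<longleftrightarrow> is_separation C A B \<and>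
     (\<exists>K. full_component C (A \<inter> B) K \<and> K \<subseteq> A - B) \<and>
     (\<exists>K. full_component C (A \<inter> B) K \<and> K \<subseteq> B - A)" (is "_ \<longleftrightarrow> ?T A B")
proof -
  have full: "K \<in> components_of C (pverts C - A \<inter> B) \<and> nbhd C K = A \<inter> B \<longleftrightarrow> full_component C (A \<inter> B) K"
    if "is_separation C A B" for A B K
    unfolding full_component_iff using that by (auto simp: is_separation_def)
  have iff: "is_separation C A B \<and>
     (\<exists>K\<in>components_of C (pverts C - A \<inter> B). K \<subseteq> A \<and> nbhd C K = A \<inter> B) \<and>
     (\<exists>K\<in>components_of C (pverts C - A \<inter> B). K \<subseteq> B \<and> nbhd C K = A \<inter> B) \<longleftrightarrow> ?T A B" for A B
  proof -
    have d: "K \<subseteq> A \<longleftrightarrow> K \<subseteq> A - B" "K \<subseteq> B \<longleftrightarrow> K \<subseteq> B - A" if "full_component C (A \<inter> B) K" for K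
      using full_componentD(3)[OF that] by auto
    show ?thesis
    proof (cases "is_separation C A B")
      case True
      show ?thesis unfolding Bex_def
        using full[OF True] d by (metis (no_types, lifting))
    qed simp
  qed
  have swap: "?T A B \<longleftrightarrow> ?T B A"
    by (auto simp: is_separation_sym[of A B] Int_commute[of A B])
  show ?thesis
    unfolding tight_def iff using swap by (metis doubleton_eq_iff)
qed

text \<open>Fix a finite walk from \<open>u\<close> to \<open>v\<close> avoiding \<open>S\<close>.
  Every \<open>X\<close> must contain a vertex \<open>x\<close> of it, and \<open>X - {x}\<close> is
  a minimal separator once \<open>x\<close> has been added to the deleted set \<open>S\<close>. So
  there are finitely many branches, each with smaller \<open>n\<close>.\<close>

lemma finite_minimal_separators:
  assumes "finite S"
  shows "finite {X. finite X \<and> card X = n \<and> X \<inter> S = {} \<and> \<not> conn C (pverts C - (S \<union> X)) u v \<and>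
    (\<forall>x\<in>X. conn C (pverts C - (S \<union> (X - {x}))) u v)}" (is "finite (?F n S)")
  using assms
proof (induct n arbitrary: S)
  case 0
  have "?F 0 S \<subseteq> {{}}" by auto
  then show ?case by (rule finite_subset) simp
next
  case (Suc n)
  show ?case
  proof (cases "conn C (pverts C - S) u v")
    case False
    \<comment> \<open>If \<open>S\<close> alone separates, restoring a vertex of \<open>X\<close>
      cannot reconnect \<open>u\<close> and \<open>v\<close>, so no non-empty \<open>X\<close> is
      minimal.\<close>
    have "\<not> conn C (pverts C - (S \<union> (X - {x}))) u v" for X x
      using conn_mono[of u v _ C "pverts C - S"] False by blast
    moreover have "X \<noteq> {}" if "card X = Suc n" for X :: "'b set" using that by auto
    ultimately have "?F (Suc n) S = {}" by blast
    then show ?thesis by (simp only: finite.emptyI)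
  next
    case True
    then obtain P where P: "finite P" "P \<subseteq> pverts C - S" "conn C P u v"
      by (rule conn_finite)
    have "?F (Suc n) S \<subseteq> (\<Union>x\<in>P. insert x ` ?F n (insert x S))"
    proof
      fix X assume X: "X \<in> ?F (Suc n) S"
      have "P \<inter> X \<noteq> {}"
      proof
        assume "P \<inter> X = {}"
        then have "conn C (pverts C - (S \<union> X)) u v"
          using P by (intro conn_mono[OF P(3)]) auto
        then show False using X by simp
      qed
      then obtain x where x: "x \<in> P" "x \<in> X" by blast
      have "S \<union> X = insert x S \<union> (X - {x})" using x by auto
      moreover have "conn C (pverts C - (insert x S \<union> (X - {x} - {y}))) u v" if "y \<in> X - {x}" for y
      proof -
        have "S \<union> (X - {y}) = insert x S \<union> (X - {x} - {y})" using x that by auto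
        moreover have "conn C (pverts C - (S \<union> (X - {y}))) u v" using X that by auto
        ultimately show ?thesis by simp
      qed
      moreover have "finite (X - {x})" "card (X - {x}) = n" "(X - {x}) \<inter> insert x S = {}"
        using X x by auto
      moreover have "\<not> conn C (pverts C - (S \<union> X)) u v" using X by simp
      ultimately have "X - {x} \<in> ?F n (insert x S)"
        by (simp only: mem_Collect_eq simp_thms) blast
      moreover have "X = insert x (X - {x})" using x by auto
      ultimately show "X \<in> (\<Union>x\<in>P. insert x ` ?F n (insert x S))"
        using x by blast
    qed
    moreover have "finite (\<Union>x\<in>P. insert x ` ?F n (insert x S))"
      by (intro finite_UN_I finite_imageI Suc.hyps) (use P Suc.prems in auto)
    ultimately show ?thesis by (rule finite_subset)
  qed
qed

text \<open>Both ends reach \<open>K\<close> in at most one step and \<open>K\<close> is connected.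
  Of \<open>X\<close>, only the ends themselves are used, so the rest of the separator may be
  missing from \<open>S\<close>.\<close>

lemma conn_full_component:
  assumes "full_component C X K" "u \<in> K \<union> X" "v \<in> K \<union> X" "{u, v} \<subseteq> S" "K \<subseteq> S"
  shows "conn C S u v"
proof -
  have *: "\<exists>k\<in>K. conn C S w k" if "w \<in> K \<union> X" "w \<in> S" for w
  proof (cases "w \<in> K")
    case False
    then obtain k where k: "k \<in> K" "(k, w) \<in> parcs C"
      using \<open>w \<in> K \<union> X\<close> full_componentD(5)[OF assms(1), of w] by blast
    have "conn C S k w"
      by (rule rtrancl_on_into_rtrancl_on[of k k]) (use k that assms(5) in auto)
    then show ?thesis using k(1) conn_symD by blast
  qed (use that in auto)
  obtain k l where kl: "k \<in> K" "l \<in> K" "conn C S u k" "conn C S v l"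
    using *[of u] *[of v] assms by auto
  have "conn C K k l" using assms(1) kl by (auto simp: full_component_def)
  then have "conn C S k l" using assms(5) by (rule conn_mono)
  then show ?thesis using kl conn_symD rtrancl_on_trans by meson
qed

lemma separation_blocks:
  assumes "is_separation C A B" "conn C S u v" "u \<in> A - B" "v \<in> B - A"
  shows "S \<inter> (A \<inter> B) \<noteq> {}"
proof
  assume e: "S \<inter> (A \<inter> B) = {}"
  obtain a b where ab: "a \<in> A - B" "b \<notin> A - B" "b \<in> S" "(a, b) \<in> parcs C"
    by (rule conn_exit[OF assms(2,3)]) (use assms(4) in auto)
  then show False
    using assms(1) e arc_verts[OF ab(4)] by (auto simp: is_separation_def)
qed

text \<open>A walk from \<open>v\<close> to the separator exists since \<open>C\<close> is
  connected; \<open>j\<close> is its last vertex before it first leaves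
  \<open>A - B\<close>.\<close>

lemma component_adjacent:
  assumes "is_separation C A B" "v \<in> A - B" "A \<inter> B \<noteq> {}"
  obtains j x where "x \<in> A \<inter> B" "(x, j) \<in> parcs C" "j \<in> A - B" "conn C (A - B) v j"
proof -
  obtain x0 where x0: "x0 \<in> A \<inter> B" using assms(3) by blast
  have "conn C (pverts C) v x0"
    using assms x0 by (intro connected) (auto simp: is_separation_def)
  then obtain a b where ab: "a \<in> A - B" "b \<notin> A - B" "b \<in> pverts C" "(a, b) \<in> parcs C"
      "conn C (pverts C \<inter> (A - B)) v a"
    by (rule conn_exit[of v x0 "pverts C" C "A - B"]) (use assms(2) x0 in auto)
  moreover have "b \<in> A \<inter> B"
    using ab assms(1) by (auto simp: is_separation_def)
  moreover have "conn C (A - B) v a"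
    using ab(5) by (rule conn_mono) auto
  ultimately show ?thesis using that arc_sym by blast
qed

lemma tight_separator_nonempty:
  assumes "tight C {A, B}"
  shows "A \<inter> B \<noteq> {}"
proof
  assume e: "A \<inter> B = {}"
  obtain u v where uv: "u \<in> A - B" "v \<in> B - A"
    using assms full_componentD(1) unfolding tight_iff by blast
  have "is_separation C A B" using assms by (simp add: tight_iff)
  moreover from this have "conn C (pverts C) u v"
    using uv by (intro connected) (auto simp: is_separation_def)
  ultimately show False
    using separation_blocks uv e by blast
qed

lemma sep_order_le_iff: "sep_order s \<le> enat k \<longleftrightarrow> finite (\<Inter>s) \<and> card (\<Inter>s) \<le> k"
  by (auto simp: sep_order_def ecard_def)

lemma tight_sepE:
  assumes "tight C s"
  obtains A B where "s = {A, B}" "tight C {A, B}"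
  using assms unfolding tight_def by (metis assms)

text \<open>Every component outside \<open>X\<close> contains a neighbour of \<open>X\<close>, by
  connectedness, and lies on one side. So \<open>A\<close> is determined by its trace on the finite
  neighbourhood of \<open>X\<close>.\<close>

lemma finite_separations_with_separator:
  assumes "finite X" "X \<noteq> {}"
  shows "finite {(A, B). is_separation C A B \<and> A \<inter> B = X}" (is "finite ?T")
proof -
  define N where "N = (\<Union>x\<in>X. {v. (x, v) \<in> parcs C})"
  have sub: "A - B \<subseteq> A'" if "is_separation C A B" "is_separation C A' B'" "A \<inter> B = X" "A' \<inter> B' = X"
    "A \<inter> N = A' \<inter> N" for A B A' B'
  proof
    note sepA = that(1)
    fix v assume v: "v \<in> A - B"
    obtain x j where j: "x \<in> A \<inter> B" "(x, j) \<in> parcs C" "j \<in> A - B" "conn C (A - B) v j"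
      by (rule component_adjacent[OF sepA v]) (use \<open>A \<inter> B = X\<close> assms(2) in auto)
    then have "j \<in> N" using \<open>A \<inter> B = X\<close> by (auto simp: N_def)
    then have jA: "j \<in> A'" using j \<open>A \<inter> N = A' \<inter> N\<close> by blast
    show "v \<in> A'"
    proof (rule ccontr)
      assume "v \<notin> A'"
      then have "v \<in> B' - A'" using v that by (auto simp: is_separation_def)
      moreover have "j \<in> A' - B'" using jA j(3) that by blast
      moreover have "conn C (A - B) j v" using j(4) by (rule conn_symD)
      ultimately have "(A - B) \<inter> (A' \<inter> B') \<noteq> {}"
        using separation_blocks[OF that(2)] by blast
      then show False using that by blast
    qed
  qed
  have "inj_on (\<lambda>(A, B). A \<inter> N) ?T"
  proof (rule inj_onI, clarify)
    fix A B A' B'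
    assume 1: "is_separation C A B" "is_separation C A' B'" "A \<inter> N = A' \<inter> N"
      "X = A \<inter> B" "A' \<inter> B' = A \<inter> B"
    have "A = A'" using sub[of A B A' B'] sub[of A' B' A B] 1 by blast
    moreover have "B = (pverts C - A) \<union> X" "B' = (pverts C - A') \<union> X"
      using 1 by (auto simp: is_separation_def)
    ultimately show "A = A' \<and> B = B'" by blast
  qed
  moreover have "(\<lambda>(A, B). A \<inter> N) ` ?T \<subseteq> Pow N" by auto
  moreover have "finite (Pow N)"
    using assms finite_neighbours by (auto simp: N_def)
  ultimately show ?thesis
    by (rule inj_on_finite)
qed

text \<open>Take \<open>u\<close> and \<open>v\<close> in full components on the two sides. They are
  neighbours of the given \<open>x\<close>, so only finitely many pairs arise for separators through
  \<open>x\<close>.\<close>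

lemma tight_minimal_separator:
  assumes "tight C {A, B}" "x \<in> A \<inter> B"
  obtains u v where "(x, u) \<in> parcs C" "(x, v) \<in> parcs C"
    "\<not> conn C (pverts C - A \<inter> B) u v" "\<And>y. y \<in> A \<inter> B \<Longrightarrow> conn C (pverts C - (A \<inter> B - {y})) u v"
proof -
  obtain K L where K: "full_component C (A \<inter> B) K" "K \<subseteq> A - B"
    and L: "full_component C (A \<inter> B) L" "L \<subseteq> B - A" and sep: "is_separation C A B"
    using assms(1) by (auto simp: tight_iff)
  obtain u v where uv: "u \<in> K" "v \<in> L" "(u, x) \<in> parcs C" "(v, x) \<in> parcs C"
    using full_componentD(5)[OF K(1) assms(2)] full_componentD(5)[OF L(1) assms(2)] by blast
  have "\<not> conn C (pverts C - A \<inter> B) u v"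
    using separation_blocks[OF sep] uv K L by blast
  moreover have "conn C (pverts C - (A \<inter> B - {y})) u v" if "y \<in> A \<inter> B" for y
  proof -
    have y: "y \<in> pverts C" using sep that by (auto simp: is_separation_def)
    have KL: "K \<subseteq> pverts C - (A \<inter> B - {y})" "L \<subseteq> pverts C - (A \<inter> B - {y})"
      using full_componentD(2,3)[OF K(1)] full_componentD(2,3)[OF L(1)] by auto
    have "conn C (pverts C - (A \<inter> B - {y})) u y"
      by (rule conn_full_component[OF K(1)]) (use uv that KL y in auto)
    moreover have "conn C (pverts C - (A \<inter> B - {y})) y v"
      by (rule conn_full_component[OF L(1)]) (use uv that KL y in auto)
    ultimately show ?thesis by (rule rtrancl_on_trans)
  qed
  ultimately show ?thesis using that uv arc_sym by blast
qed

lemma finite_tight_at_vertex: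
  "finite {s. tight C s \<and> sep_order s \<le> enat k \<and> x \<in> \<Inter>s}"
proof -
  define N where "N = {v. (x, v) \<in> parcs C}"
  \<comment> \<open>The unions with \<open>{}\<close> keep the shape of
    \<open>finite_minimal_separators\<close> at \<open>S = {}\<close>.\<close>
  define F where "F u v n = {X. finite X \<and> card X = n \<and> X \<inter> {} = {} \<and>
    \<not> conn C (pverts C - ({} \<union> X)) u v \<and>
    (\<forall>x\<in>X. conn C (pverts C - ({} \<union> (X - {x}))) u v)}" for u v n
  define D where "D X = {(A, B). is_separation C A B \<and> A \<inter> B = X}" for X
  define Q where "Q = (\<Union>u\<in>N. \<Union>v\<in>N. \<Union>n\<le>k. {X \<in> F u v n. x \<in> X})"
  have "{s. tight C s \<and> sep_order s \<le> enat k \<and> x \<in> \<Inter>s} \<subseteq> (\<Union>X\<in>Q. unorient ` D X)"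
  proof
    fix s assume s: "s \<in> {s. tight C s \<and> sep_order s \<le> enat k \<and> x \<in> \<Inter>s}"
    then obtain A B where AB: "s = {A, B}" "tight C {A, B}" using tight_sepE by blast
    have x: "x \<in> A \<inter> B" using s AB by auto
    have fin: "finite (A \<inter> B)" "card (A \<inter> B) \<le> k" using s AB by (auto simp: sep_order_le_iff)
    obtain u v where "u \<in> N" "v \<in> N"
      "\<not> conn C (pverts C - A \<inter> B) u v" "\<And>y. y \<in> A \<inter> B \<Longrightarrow> conn C (pverts C - (A \<inter> B - {y})) u v"
      by (rule tight_minimal_separator[OF AB(2) x]) (auto simp: N_def)
    then have "A \<inter> B \<in> Q" using fin x unfolding Q_def F_def by auto
    moreover have "(A, B) \<in> D (A \<inter> B)" using AB(2) by (auto simp: D_def tight_iff)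
    moreover have "s = unorient (A, B)" by (simp add: AB unorient_def)
    ultimately show "s \<in> (\<Union>X\<in>Q. unorient ` D X)" by blast
  qed
  moreover have "finite Q"
    unfolding Q_def N_def F_def
  proof (intro finite_UN_I finite_neighbours finite_atMost)
    fix u v n
    show "finite {X \<in> {X. finite X \<and> card X = n \<and> X \<inter> {} = {} \<and> \<not> conn C (pverts C - ({} \<union> X)) u v \<and>
        (\<forall>x\<in>X. conn C (pverts C - ({} \<union> (X - {x}))) u v)}. x \<in> X}"
      by (rule finite_subset[OF _ finite_minimal_separators[of "{}" n u v]]) auto
  qed
  moreover have "finite (D X)" if "X \<in> Q" for X
    unfolding D_def
    by (rule finite_separations_with_separator) (use that in \<open>auto simp: Q_def F_def\<close>)
  ultimately show ?thesis
    by (meson finite_UN_I finite_imageI finite_subset)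
qed

lemma finite_tight_meeting:
  assumes "finite H"
  shows "finite {s. tight C s \<and> sep_order s \<le> enat k \<and> H \<inter> \<Inter>s \<noteq> {}}"
proof -
  have "{s. tight C s \<and> sep_order s \<le> enat k \<and> H \<inter> \<Inter>s \<noteq> {}} =
    (\<Union>x\<in>H. {s. tight C s \<and> sep_order s \<le> enat k \<and> x \<in> \<Inter>s})" by blast
  then show ?thesis using assms finite_tight_at_vertex by simp
qed

text \<open>All these separators meet one fixed finite walk from \<open>u\<close> to
  \<open>w\<close>. This is the source of the finite chains and intervals used later.\<close>

lemma finite_tight_separating:
  assumes "u \<in> pverts C" "w \<in> pverts C"
  shows "finite {(A, B). tight C {A, B} \<and> sep_order {A, B} \<le> enat k \<and> u \<in> A - B \<and> w \<in> B - A}"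
    (is "finite ?T")
proof -
  obtain H where H: "finite H" "conn C H u w"
    by (rule conn_finite[OF connected[OF assms]])
  define U where "U = {s. tight C s \<and> sep_order s \<le> enat k \<and> H \<inter> \<Inter>s \<noteq> {}}"
  have "?T \<subseteq> {(A, B). {A, B} \<in> U}"
    using separation_blocks[OF _ H(2)] by (auto simp: U_def tight_iff)
  also have "\<dots> \<subseteq> \<Union>U \<times> \<Union>U" by auto
  finally have "?T \<subseteq> \<Union>U \<times> \<Union>U" .
  moreover have "finite U" unfolding U_def using H(1) by (rule finite_tight_meeting)
  moreover have "finite s" if "s \<in> U" for s
    using that tight_sepE unfolding U_def by (metis (no_types, lifting) finite.emptyI finite_insert mem_Collect_eq)
  ultimately show ?thesis
    by (meson finite_SigmaI finite_Union finite_subset)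
qed

text \<open>Each component of \<open>B - A\<close> attaches to the separator, and the full component
  in \<open>B - A\<close> joins all vertices of the separator.\<close>

lemma side_connected:
  assumes "tight C {A, B}" "u \<in> B" "v \<in> B"
  shows "conn C B u v"
proof -
  obtain K where K: "full_component C (A \<inter> B) K" "K \<subseteq> B - A" and sep: "is_separation C B A"
    using assms by (auto simp: tight_iff is_separation_sym)
  have *: "\<exists>x\<in>A \<inter> B. conn C B w x" if w: "w \<in> B" for w
  proof (cases "w \<in> A")
    case False
    obtain j x where j: "x \<in> B \<inter> A" "(x, j) \<in> parcs C" "j \<in> B - A" "conn C (B - A) w j"
      by (rule component_adjacent[OF sep, of w])
        (use False w tight_separator_nonempty[OF assms(1)] in auto)
    have "conn C B w j" using j(4) by (rule conn_mono) auto
    then have "conn C B w x"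
      using j arc_sym by (blast intro: rtrancl_on_into_rtrancl_on)
    then show ?thesis using j by blast
  qed (use w in auto)
  obtain x y where xy: "x \<in> A \<inter> B" "y \<in> A \<inter> B" "conn C B u x" "conn C B v y"
    using * assms(2,3) by meson
  have "conn C B x y"
    using xy K by (intro conn_full_component[OF K(1)]) auto
  then show ?thesis
    using xy conn_symD rtrancl_on_trans by meson
qed

text \<open>Let \<open>H\<close> be a finite union of walks joining the vertices of
  \<open>A \<inter> B\<close>. If the separator of \<open>t\<close> misses \<open>H\<close>, then
  \<open>A \<inter> B\<close> lies strictly on one side of \<open>t\<close>. The other side of
  \<open>t\<close> is connected and misses \<open>A \<inter> B\<close>, hence lies within
  \<open>A - B\<close> or \<open>B - A\<close>, and \<open>t\<close> is nested with
  \<open>s\<close>. So crossing separations meet \<open>H\<close>.\<close>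

lemma finite_crossing:
  assumes "tight C s" "sep_order s \<le> enat k"
  shows "finite {t. tight C t \<and> sep_order t \<le> enat l \<and> crossing t s}"
proof -
  obtain A B where s: "s = {A, B}" "tight C {A, B}" using tight_sepE assms by blast
  have sep: "is_separation C A B" using s by (simp add: tight_iff)
  obtain x0 where x0: "x0 \<in> A \<inter> B" using tight_separator_nonempty[OF s(2)] by blast
  have "\<forall>x\<in>A \<inter> B. \<exists>P. finite P \<and> conn C P x0 x"
  proof
    fix x assume "x \<in> A \<inter> B"
    then have "conn C (pverts C) x0 x" using x0 sep by (intro connected) (auto simp: is_separation_def)
    then show "\<exists>P. finite P \<and> conn C P x0 x" by (rule conn_finite) blast
  qed
  then obtain P where P: "\<And>x. x \<in> A \<inter> B \<Longrightarrow> finite (P x) \<and> conn C (P x) x0 x" by metis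
  define H where "H = (\<Union>x\<in>A \<inter> B. P x)"
  have "finite H" using assms s P by (auto simp: H_def sep_order_le_iff)
  have "nested t s" if t: "tight C t" and disj: "H \<inter> \<Inter>t = {}" for t
  proof -
    obtain E F where EF: "t = {E, F}" "tight C {E, F}" using tight_sepE t by blast
    have nest: "nested {E, F} {A, B}" if EF: "tight C {E, F}" "H \<inter> (E \<inter> F) = {}" and x0E: "x0 \<in> E" for E F
    proof -
      have sepEF: "is_separation C E F" using EF by (simp add: tight_iff)
      \<comment> \<open>The walk \<open>P x\<close> inside \<open>H\<close> cannot pass from the
        side of \<open>x0\<close> to the other one.\<close>
      have X: "A \<inter> B \<subseteq> E - F"
      proof
        fix x assume x: "x \<in> A \<inter> B"
        have h: "x0 \<in> H" "x \<in> H" using P x x0 in_rtrancl_on_in_F unfolding H_def by (metis UN_I)+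
        show "x \<in> E - F"
        proof (rule ccontr)
          assume "x \<notin> E - F"
          then have "x \<in> F - E" using h EF(2) sepEF x sep by (auto simp: is_separation_def)
          then have "P x \<inter> (E \<inter> F) \<noteq> {}"
            using separation_blocks[OF sepEF, of x0 x "P x"] P x h x0E EF(2) by blast
          then show False using EF(2) x by (auto simp: H_def)
        qed
      qed
      obtain y0 where y0: "y0 \<in> F" using tight_separator_nonempty[OF EF(1)] by blast
      have verts: "E \<union> F = pverts C" "A \<union> B = pverts C"
        using sep sepEF by (auto simp: is_separation_def)
      have "F \<subseteq> A - B \<or> F \<subseteq> B - A"
      proof (rule ccontr)
        assume "\<not> (F \<subseteq> A - B \<or> F \<subseteq> B - A)"
        then obtain f g where "f \<in> F" "g \<in> F" "f \<in> A - B" "g \<in> B - A"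
          using X verts by blast
        then have "F \<inter> (A \<inter> B) \<noteq> {}"
          using side_connected[OF EF(1)] separation_blocks[OF sep] by blast
        then show False using X by blast
      qed
      then show ?thesis using verts by (auto simp: nested_iff)
    qed
    have "x0 \<in> E \<or> x0 \<in> F" using EF x0 sep by (auto simp: tight_iff is_separation_def)
    then show ?thesis
      using nest[of E F] nest[of F E] EF disj s by (auto simp: insert_commute Int_commute)
  qed
  then have "{t. tight C t \<and> sep_order t \<le> enat l \<and> crossing t s} \<subseteq>
      {t. tight C t \<and> sep_order t \<le> enat l \<and> H \<inter> \<Inter>t \<noteq> {}}" by blast
  then show ?thesis
    using finite_tight_meeting[OF \<open>finite H\<close>] finite_subset by blast
qed

end

section \<open>Uncrossing\<close>

lemma osep_ge_refl: "osep_ge a a"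
  by (simp add: osep_ge_def)

lemma osep_ge_trans: "osep_ge a b \<Longrightarrow> osep_ge b c \<Longrightarrow> osep_ge a c"
  by (auto simp: osep_ge_def)

lemma osep_ge_antisym: "osep_ge a b \<Longrightarrow> osep_ge b a \<Longrightarrow> a = b"
  by (auto simp: osep_ge_def prod_eq_iff)

lemma osep_ge_swap: "osep_ge (prod.swap a) (prod.swap b) \<longleftrightarrow> osep_ge b a"
  by (auto simp: osep_ge_def)

lemma osep_ge_swap_left: "osep_ge (prod.swap a) b \<longleftrightarrow> osep_ge (prod.swap b) a"
  by (auto simp: osep_ge_def)

lemma osep_ge_swap_right: "osep_ge a (prod.swap b) \<longleftrightarrow> osep_ge b (prod.swap a)"
  by (auto simp: osep_ge_def)

lemma unorient_swap: "unorient (prod.swap a) = unorient a"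
  by (auto simp: unorient_def)

lemma unorient_eq_iff: "unorient a = unorient b \<longleftrightarrow> a = b \<or> a = prod.swap b"
  by (cases a; cases b) (auto simp: unorient_def doubleton_eq_iff)

lemma orientations_swap: "prod.swap a \<in> orientations N \<longleftrightarrow> a \<in> orientations N"
  by (simp add: orientations_def unorient_swap)

lemma nested_unorient_iff:
  "nested (unorient a) (unorient b) \<longleftrightarrow>
    osep_ge a b \<or> osep_ge b a \<or> osep_ge a (prod.swap b) \<or> osep_ge (prod.swap b) a"
  unfolding unorient_def nested_iff osep_ge_def by auto

lemma nested_sym: "nested s t \<Longrightarrow> nested t s"
proof -
  assume "nested s t"
  then obtain a b where ab: "unorient a = s" "unorient b = t" "osep_ge a b"
    by (auto simp: nested_def)
  then have "unorient (prod.swap a) = s" "unorient (prod.swap b) = t" "osep_ge (prod.swap b) (prod.swap a)"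
    by (auto simp: unorient_def osep_ge_def)
  then show "nested t s" unfolding nested_def by blast
qed

lemma nested_pair:
  assumes "nested u s"
  obtains P Q where "u = {P, Q}"
  using assms by (auto simp: nested_def unorient_def)

text \<open>If a side of \<open>u\<close> is contained in \<open>B\<close> or in \<open>E\<close>,
  with the reverse inclusion for the other side, or one side is contained in both \<open>A\<close>
  and \<open>D\<close>, the corner is nested with \<open>u\<close>. The only remaining configuration
  places \<open>u\<close> between the two separations and makes these nested
  (\<open>trans\<close>).\<close>

lemma nested_corner:
  assumes "nested u {A, B}" "nested u {D, E}" "crossing {A, B} {D, E}"
  shows "nested u {A \<inter> D, B \<union> E}"
proof -
  obtain P Q where u: "u = {P, Q}" using assms(1) by (rule nested_pair)
  let ?c = "A \<inter> D" and ?d = "B \<union> E"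
  have away: "nested u {?c, ?d}" if "R \<subseteq> B \<and> A \<subseteq> S \<or> R \<subseteq> E \<and> D \<subseteq> S" "u = {R, S}" for R S
    using that(1) unfolding that(2) nested_iff by blast
  have both: "nested u {?c, ?d}" if "R \<subseteq> A" "B \<subseteq> S" "R \<subseteq> D" "E \<subseteq> S" "u = {R, S}" for R S
    using that(1-4) unfolding that(5) nested_iff by blast
  have trans: False if "R \<subseteq> A" "B \<subseteq> S" "S \<subseteq> D" "E \<subseteq> R" for R S
    using assms(3) subset_trans[OF that(4,1)] subset_trans[OF that(2,3)] by (simp add: nested_iff)
  have u': "u = {Q, P}" using u by (simp add: insert_commute)
  show ?thesis
    using assms(1,2)[unfolded u nested_iff] away[OF _ u] away[OF _ u'] both[OF _ _ _ _ u]
      both[OF _ _ _ _ u'] trans[of P Q] trans[of Q P]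
    by argo
qed

text \<open>Contrapositively: a separation crossing two opposite corners crosses
  \<open>{A, B}\<close>, and by symmetry also \<open>{D, E}\<close>.\<close>

lemma nested_opposite_corners:
  assumes "nested u {A, B}"
  shows "nested u {A \<inter> D, B \<union> E} \<or> nested u {B \<inter> E, A \<union> D}"
proof -
  obtain P Q where u: "u = {P, Q}" using assms(1) by (rule nested_pair)
  show ?thesis using assms unfolding u nested_iff
    by (elim disjE conjE) (simp_all add: le_supI1 le_supI2 le_infI1 le_infI2)
qed

text \<open>Submodularity, here with equality: the separators of opposite corners have the same
  union and the same intersection as the two original separators.\<close>

lemma card_opposite_corners:
  assumes "finite (A \<inter> B)" "finite (D \<inter> E)" "A \<union> B = D \<union> E"
  shows "card (A \<inter> D \<inter> (B \<union> E)) + card (B \<inter> E \<inter> (A \<union> D)) = card (A \<inter> B) + card (D \<inter> E)"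
proof -
  have "card (A \<inter> D \<inter> (B \<union> E)) + card (B \<inter> E \<inter> (A \<union> D)) =
    card (A \<inter> D \<inter> (B \<union> E) \<union> B \<inter> E \<inter> (A \<union> D)) + card (A \<inter> D \<inter> (B \<union> E) \<inter> (B \<inter> E \<inter> (A \<union> D)))"
    using assms by (intro card_Un_Int) (auto intro: finite_subset[of _ "A \<inter> B \<union> D \<inter> E"])
  also have "A \<inter> D \<inter> (B \<union> E) \<union> B \<inter> E \<inter> (A \<union> D) = A \<inter> B \<union> D \<inter> E"
    using assms(3) by blast
  also have "A \<inter> D \<inter> (B \<union> E) \<inter> (B \<inter> E \<inter> (A \<union> D)) = A \<inter> B \<inter> (D \<inter> E)"
    by blast
  also have "card (A \<inter> B \<union> D \<inter> E) + card (A \<inter> B \<inter> (D \<inter> E)) = card (A \<inter> B) + card (D \<inter> E)"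
    using assms by (simp add: card_Un_Int[symmetric])
  finally show ?thesis .
qed

lemma sep_order_eq_pair: "sep_order {A, B} = enat k \<longleftrightarrow> finite (A \<inter> B) \<and> card (A \<inter> B) = k"
  by (auto simp: sep_order_def ecard_def)

lemma bottleneckD:
  assumes "bottleneck G k \<beta>" "s \<in> \<beta>"
  shows "tight G s" "sep_order s = enat k"
  using assms by (auto simp: bottleneck_def)

lemma N_level_eq:
  "N_level G k = (\<Union>\<beta>\<in>{\<beta>. bottleneck G k \<beta>}. select_nested G k (\<Union>j<k. N_level G j) \<beta>)"
  by (subst N_level.simps) (rule refl)

lemma N_levelE:
  assumes "s \<in> N_level G k"
  obtains \<beta> where "bottleneck G k \<beta>" "s \<in> \<beta>" "s \<in> select_nested G k (\<Union>j<k. N_level G j) \<beta>"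
  using assms by (subst (asm) N_level_eq) (auto simp: select_nested_def)

lemma N_level_tight: "s \<in> N_level G k \<Longrightarrow> tight G s"
  by (erule N_levelE) (simp add: bottleneckD)

lemma N_level_order: "s \<in> N_level G k \<Longrightarrow> sep_order s = enat k"
  by (erule N_levelE) (simp add: bottleneckD)

text \<open>The case distinction for a pair of crossing separations: \<open>o\<^sub>i\<^sub>j\<close> is the order of the corner \<open>c\<^sub>i\<^sub>j\<close>,
  where \<open>c\<^sub>1\<^sub>1\<close> is opposite to \<open>c\<^sub>2\<^sub>2\<close> and \<open>c\<^sub>1\<^sub>2\<close> to \<open>c\<^sub>2\<^sub>1\<close>.\<close>

lemma opposite_corner_cases:
  fixes o11 o12 o21 o22 k :: nat
  assumes "o11 + o22 = 2 * k" "o12 + o21 = 2 * k"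
    and "o11 \<le> k \<Longrightarrow> o12 \<le> k \<Longrightarrow> c11 \<in> \<beta> \<or> c12 \<in> \<beta>"
    and "o21 \<le> k \<Longrightarrow> o22 \<le> k \<Longrightarrow> c21 \<in> \<beta> \<or> c22 \<in> \<beta>"
    and "o11 \<le> k \<Longrightarrow> o21 \<le> k \<Longrightarrow> c11 \<in> \<beta>' \<or> c21 \<in> \<beta>'"
    and "o12 \<le> k \<Longrightarrow> o22 \<le> k \<Longrightarrow> c12 \<in> \<beta>' \<or> c22 \<in> \<beta>'"
    and "c11 \<in> \<beta> \<union> \<beta>' \<Longrightarrow> o11 = k" "c12 \<in> \<beta> \<union> \<beta>' \<Longrightarrow> o12 = k"
      "c21 \<in> \<beta> \<union> \<beta>' \<Longrightarrow> o21 = k" "c22 \<in> \<beta> \<union> \<beta>' \<Longrightarrow> o22 = k"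
    and "\<not> (c11 \<in> \<beta> \<and> c22 \<in> \<beta>')" "\<not> (c12 \<in> \<beta> \<and> c21 \<in> \<beta>')"
      "\<not> (c21 \<in> \<beta> \<and> c12 \<in> \<beta>')" "\<not> (c22 \<in> \<beta> \<and> c11 \<in> \<beta>')"
    and "\<not> (c11 \<in> \<beta> \<and> c22 \<in> \<beta> \<and> c12 \<in> \<beta>' \<and> c21 \<in> \<beta>')"
      "\<not> (c12 \<in> \<beta> \<and> c21 \<in> \<beta> \<and> c11 \<in> \<beta>' \<and> c22 \<in> \<beta>')"
  shows False
proof -
  \<comment> \<open>Two adjacent corners have order at most \<open>k\<close>, say \<open>c11\<close>
    and \<open>c12\<close>, and say \<open>c11 \<in> \<beta>\<close>. Then
    \<open>o11 = o22 = k\<close>, and going round the corners with the exclusions forces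
    \<open>c12 \<in> \<beta>'\<close>, \<open>c22 \<in> \<beta>\<close> and
    \<open>c21 \<in> \<beta>'\<close>, which is one of the last two excluded patterns.\<close>
  have "o11 \<le> k \<or> o22 \<le> k" "o12 \<le> k \<or> o21 \<le> k" using assms(1,2) by linarith+
  moreover have "o11 = k \<longleftrightarrow> o22 = k" "o12 = k \<longleftrightarrow> o21 = k" using assms(1,2) by linarith+
  ultimately show False using assms(3-) by (metis UnI1 UnI2 order_refl)
qed

section \<open>Corners as constituents of stars, and nestedness of \<open>N\<close>\<close>

context locally_finite_connected
begin

lemma corner_separation:
  "is_separation C A B \<Longrightarrow> is_separation C D E \<Longrightarrow> is_separation C (A \<inter> D) (B \<union> E)"
  unfolding is_separation_def by blast

text \<open>Otherwise the connected side \<open>B\<close> misses \<open>D \<inter> E\<close>, lies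
  on one side of \<open>{D, E}\<close>, and the two separations are nested.\<close>

lemma separators_cross:
  assumes "tight C {A, B}" "tight C {D, E}" "crossing {A, B} {D, E}"
  obtains z where "z \<in> D \<inter> E" "z \<notin> A - B"
proof -
  have sep: "is_separation C A B" "is_separation C D E" using assms by (auto simp: tight_iff)
  then have verts: "A \<union> B = pverts C" "D \<union> E = pverts C" by (auto simp: is_separation_def)
  have False if sub: "D \<inter> E \<subseteq> A - B"
  proof -
    have "B \<subseteq> D - E \<or> B \<subseteq> E - D"
    proof (rule ccontr)
      assume "\<not> (B \<subseteq> D - E \<or> B \<subseteq> E - D)"
      then obtain f g where "f \<in> B" "g \<in> B" "f \<in> D - E" "g \<in> E - D"
        using sub verts by blast
      then have "B \<inter> (D \<inter> E) \<noteq> {}"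
        using side_connected[OF assms(1)] separation_blocks[OF sep(2)] by blast
      then show False using sub by blast
    qed
    then show False
      using assms(3) verts unfolding nested_iff by blast
  qed
  then show ?thesis using that by blast
qed

text \<open>This is the relevance condition for a corner. A neighbour \<open>k\<close> of
  \<open>x\<close> in a full component \<open>K\<close> of \<open>D - E\<close> either lies in
  \<open>B\<close>, giving an edge to the base separator, or lies in a component \<open>J\<close> of
  the corner, from which \<open>K\<close> leads on to the base separator.\<close>

lemma corner_link:
  assumes "tight C {A, B}" "tight C {D, E}" "crossing {A, B} {D, E}" "x \<in> (A - B) \<inter> (D \<inter> E)"
  shows "(\<exists>y\<in>A \<inter> B \<inter> D - E. (x, y) \<in> parcs C) \<or>
    (\<exists>K\<in>components_of C ((A - B) \<inter> (D - E)). \<exists>y\<in>A \<inter> B \<inter> D. x \<in> nbhd C K \<and> y \<in> nbhd C K)"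
proof -
  have sep: "is_separation C A B" "is_separation C D E" using assms by (auto simp: tight_iff)
  then have verts: "A \<union> B = pverts C" "D \<union> E = pverts C" by (auto simp: is_separation_def)
  obtain K where K: "full_component C (D \<inter> E) K" "K \<subseteq> D - E"
    using assms(2) by (auto simp: tight_iff)
  obtain k where k: "k \<in> K" "(k, x) \<in> parcs C"
    using full_componentD(5)[OF K(1), of x] assms(4) by blast
  have kA: "k \<in> A" using sep(1) k assms(4) arc_verts[OF k(2)] unfolding is_separation_def by blast
  show ?thesis
  proof (cases "k \<in> B")
    case True
    then show ?thesis using kA k K arc_sym by blast
  next
    case False
    define S where "S = (A - B) \<inter> (D - E)"
    define J where "J = {v. conn C S k v}"
    have kS: "k \<in> S" using kA False k K by (auto simp: S_def)
    then have J: "J \<in> components_of C S" "k \<in> J" by (auto simp: J_def components_of_iff)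
    have JS: "J \<subseteq> S" unfolding J_def using in_rtrancl_on_in_F(2) by fast
    have x: "x \<in> nbhd C J"
      using J(2) k JS assms(4) verts by (auto simp: nbhd_def S_def)
    obtain z where z: "z \<in> D \<inter> E" "z \<notin> A - B"
      using assms(1-3) by (rule separators_cross)
    \<comment> \<open>As \<open>z\<close> is outside \<open>A - B\<close>, this walk must leave
      \<open>A - B\<close>. Up to its exit it stays in \<open>J\<close>, and the exit vertex
      \<open>b\<close> is in \<open>A \<inter> B \<inter> D\<close>.\<close>
    have "conn C (insert z K) k z"
      by (rule conn_full_component[OF K(1)]) (use z k in auto)
    then obtain a b where ab: "a \<in> A - B" "b \<notin> A - B" "b \<in> insert z K" "(a, b) \<in> parcs C"
        "conn C (insert z K \<inter> (A - B)) k a"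
      by (rule conn_exit[where P = "A - B"]) (use z kA False in auto)
    have "conn C S k a"
      using ab(5) by (rule conn_mono) (use K z in \<open>auto simp: S_def\<close>)
    then have "a \<in> J" by (simp add: J_def)
    moreover have "b \<in> A \<inter> B"
      using sep(1) ab arc_verts[OF ab(4)] unfolding is_separation_def by blast
    moreover have "b \<in> D" using ab(3) z K by auto
    ultimately have "b \<in> A \<inter> B \<inter> D" "b \<in> nbhd C J"
      using ab(4) JS verts by (auto simp: nbhd_def S_def)
    then show ?thesis using x J(1) unfolding S_def by blast
  qed
qed

text \<open>The base \<open>{A, B}\<close> is oriented as \<open>(B, A)\<close>, so that its strict
  side \<open>B - A\<close> is complementary to the two corners inside \<open>A\<close>.\<close>

lemma corner_star:
  assumes "tight C {A, B}" "tight C {D, E}" "crossing {A, B} {D, E}"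
  shows "top_star C (B, A) (A \<inter> D, B \<union> E) (A \<inter> E, B \<union> D)"
    and "relevant C (B, A) (A \<inter> D, B \<union> E) (A \<inter> E, B \<union> D)"
proof -
  have sep: "is_separation C A B" "is_separation C D E" using assms by (auto simp: tight_iff)
  then have verts: "A \<union> B = pverts C" "D \<union> E = pverts C" by (auto simp: is_separation_def)
  have "\<not> B \<subseteq> A" "\<not> A \<subseteq> B"
    using assms(1) full_componentD(1) unfolding tight_iff by blast+
  \<comment> \<open>This keeps the two corners distinct: \<open>A \<inter> D = A \<inter> E\<close>
    would put all of \<open>A\<close> into \<open>D \<inter> E\<close>, but a vertex of
    \<open>A - B\<close> in that separator has a neighbour in \<open>D - E\<close>, which again lies
    in \<open>A\<close>.\<close>
  moreover have "\<not> A \<subseteq> D \<inter> E"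
  proof
    assume AY: "A \<subseteq> D \<inter> E"
    obtain x where x: "x \<in> A - B" using \<open>\<not> A \<subseteq> B\<close> by blast
    obtain K where K: "full_component C (D \<inter> E) K" "K \<subseteq> D - E"
      using assms(2) by (auto simp: tight_iff)
    obtain k where k: "k \<in> K" "(k, x) \<in> parcs C"
      using full_componentD(5)[OF K(1), of x] x AY by blast
    have "k \<in> A" using sep(1) k x arc_verts[OF k(2)] unfolding is_separation_def by blast
    then show False using AY K k by blast
  qed
  then have "A \<inter> D \<noteq> A \<inter> E" using sep verts by blast
  ultimately have d: "distinct [(B, A), (A \<inter> D, B \<union> E), (A \<inter> E, B \<union> D)]" by auto
  have s3: "is_separation C B A" "is_separation C (A \<inter> D) (B \<union> E)" "is_separation C (A \<inter> E) (B \<union> D)"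
    using sep corner_separation is_separation_sym by blast+
  show "top_star C (B, A) (A \<inter> D, B \<union> E) (A \<inter> E, B \<union> D)"
    unfolding top_star_def
  proof (intro conjI)
    show "(\<Union>s\<in>{(B, A), (A \<inter> D, B \<union> E), (A \<inter> E, B \<union> D)}. fst s - snd s) =
        pverts C - (\<Union>s\<in>{(B, A), (A \<inter> D, B \<union> E), (A \<inter> E, B \<union> D)}. separator s)"
      unfolding separator_def UN_insert UN_empty fst_conv snd_conv using verts by blast
    show "\<forall>s\<in>{(B, A), (A \<inter> D, B \<union> E), (A \<inter> E, B \<union> D)}. is_separation C (fst s) (snd s)"
      using s3 by simp
    have "separator (B, A) \<subseteq> separator (A \<inter> D, B \<union> E) \<union> separator (A \<inter> E, B \<union> D)"
      "separator (A \<inter> D, B \<union> E) \<subseteq> separator (B, A) \<union> separator (A \<inter> E, B \<union> D)"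
      "separator (A \<inter> E, B \<union> D) \<subseteq> separator (B, A) \<union> separator (A \<inter> D, B \<union> E)"
      unfolding separator_def fst_conv snd_conv using verts by blast+
    moreover have "\<forall>s\<in>{a, b, c}. \<forall>v\<in>separator s. \<exists>t\<in>{a, b, c} - {s}. v \<in> separator t"
      if "distinct [a, b, c]" "separator a \<subseteq> separator b \<union> separator c"
        "separator b \<subseteq> separator a \<union> separator c" "separator c \<subseteq> separator a \<union> separator b"
      for a b c :: "'b osep"
      using that by auto
    ultimately show "\<forall>s\<in>{(B, A), (A \<inter> D, B \<union> E), (A \<inter> E, B \<union> D)}. \<forall>v\<in>separator s.
        \<exists>t\<in>{(B, A), (A \<inter> D, B \<union> E), (A \<inter> E, B \<union> D)} - {s}. v \<in> separator t"
      using d by presburger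
    show "\<forall>s\<in>{(B, A), (A \<inter> D, B \<union> E), (A \<inter> E, B \<union> D)}.
        \<forall>t\<in>{(B, A), (A \<inter> D, B \<union> E), (A \<inter> E, B \<union> D)}.
        s \<noteq> t \<longrightarrow> (fst s - snd s) \<inter> (fst t - snd t) = {}"
      unfolding ball_simps fst_conv snd_conv by blast
  qed (rule d)
  have swap: "crossing {A, B} {E, D}" "tight C {E, D}"
    using assms by (simp_all add: insert_commute)
  have t: "tight C (unorient (B, A))" using assms by (simp add: unorient_def insert_commute)
  have S: "A \<inter> D - (B \<union> E) = (A - B) \<inter> (D - E)" "A \<inter> E - (B \<union> D) = (A - B) \<inter> (E - D)" by auto
  have l1: "(\<exists>y\<in>B \<inter> A \<inter> (A \<inter> D \<inter> (B \<union> E)) - Z. (x, y) \<in> parcs C) \<or>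
     (\<exists>K\<in>components_of C (A \<inter> D - (B \<union> E)).
        \<exists>y\<in>(B \<inter> A \<inter> (A \<inter> D \<inter> (B \<union> E)) - Z) \<union> Z. x \<in> nbhd C K \<and> y \<in> nbhd C K)"
    if "x \<in> (A - B) \<inter> (D \<inter> E)" "Z = A \<inter> B \<inter> D \<inter> E" for x Z
    unfolding S using corner_link[OF assms that(1)] that(2) by blast
  have l2: "(\<exists>y\<in>B \<inter> A \<inter> (A \<inter> E \<inter> (B \<union> D)) - Z. (x, y) \<in> parcs C) \<or>
     (\<exists>K\<in>components_of C (A \<inter> E - (B \<union> D)).
        \<exists>y\<in>(B \<inter> A \<inter> (A \<inter> E \<inter> (B \<union> D)) - Z) \<union> Z. x \<in> nbhd C K \<and> y \<in> nbhd C K)"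
    if "x \<in> (A - B) \<inter> (D \<inter> E)" "Z = A \<inter> B \<inter> D \<inter> E" for x Z
    unfolding S using corner_link[OF assms(1) swap(2,1), of x] that by blast
  have Z: "B \<inter> A \<inter> (A \<inter> D \<inter> (B \<union> E)) \<inter> (A \<inter> E \<inter> (B \<union> D)) = A \<inter> B \<inter> D \<inter> E" by auto
  have X: "A \<inter> D \<inter> (B \<union> E) \<inter> (A \<inter> E \<inter> (B \<union> D)) - A \<inter> B \<inter> D \<inter> E = (A - B) \<inter> (D \<inter> E)" by auto
  show "relevant C (B, A) (A \<inter> D, B \<union> E) (A \<inter> E, B \<union> D)"
    unfolding relevant_def separator_def Let_def fst_conv snd_conv Z X
    using t l1[OF _ refl] l2[OF _ refl] by simp
qed

lemma bottleneck_corner: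
  assumes "bottleneck C k \<beta>" "{A, B} \<in> \<beta>" "tight C {D, E}" "finite (D \<inter> E)" "crossing {A, B} {D, E}"
    and "card (A \<inter> D \<inter> (B \<union> E)) \<le> k" "card (A \<inter> E \<inter> (B \<union> D)) \<le> k"
  shows "{A \<inter> D, B \<union> E} \<in> \<beta> \<or> {A \<inter> E, B \<union> D} \<in> \<beta>"
proof -
  have t: "tight C {A, B}" and o: "finite (A \<inter> B)" "card (A \<inter> B) = k"
    using bottleneckD[OF assms(1,2)] by (auto simp: sep_order_eq_pair)
  have fin: "finite (A \<inter> D \<inter> (B \<union> E))" "finite (A \<inter> E \<inter> (B \<union> D))"
    using o assms(4) by (auto intro: finite_subset[of _ "A \<inter> B \<union> D \<inter> E"])
  have "sep_order (unorient s) \<le> enat k" if "s \<in> {(B, A), (A \<inter> D, B \<union> E), (A \<inter> E, B \<union> D)}" for s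
    using that o fin assms(6,7) by (auto simp: sep_order_le_iff unorient_def Int_commute)
  moreover have "unorient (B, A) \<in> \<beta>" using assms(2) by (simp add: unorient_def insert_commute)
  ultimately have "unorient (A \<inter> D, B \<union> E) \<in> \<beta> \<or> unorient (A \<inter> E, B \<union> D) \<in> \<beta>"
    using assms(1) corner_star[OF t assms(3,5)] unfolding bottleneck_def by blast
  then show ?thesis by (simp add: unorient_def)
qed

text \<open>Crossing numbers of tight separations of finite order are thus finite, so strict
  inequalities between their sums are meaningful.\<close>

lemma finite_bottleneck_crossing:
  assumes "tight C s" "sep_order s = enat j"
  shows "finite {t \<in> bottleneck_seps C k. crossing t s}"
proof -
  have "{t \<in> bottleneck_seps C k. crossing t s} \<subseteq> {t. tight C t \<and> sep_order t \<le> enat k \<and> crossing t s}"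
    by (auto simp: bottleneck_seps_def bottleneckD)
  then show ?thesis
    using finite_crossing[OF assms(1), of j k] assms(2) finite_subset by auto
qed

text \<open>A separation crossing a corner crosses \<open>{A, B}\<close> or \<open>{D, E}\<close>, one crossing two opposite
  corners crosses both, and \<open>{A, B}\<close> itself crosses \<open>{D, E}\<close> but neither corner.\<close>

lemma crossing_number_corners:
  assumes "bottleneck C k \<beta>" "bottleneck C k \<beta>'" "{A, B} \<in> \<beta>" "{D, E} \<in> \<beta>'"
    and "crossing {A, B} {D, E}"
  shows "crossing_number C k {A \<inter> D, B \<union> E} + crossing_number C k {B \<inter> E, A \<union> D}
    < crossing_number C k {A, B} + crossing_number C k {D, E}"
proof -
  define U where "U s = {t \<in> bottleneck_seps C k. crossing t s}" for s
  have AB: "{A, B} \<in> bottleneck_seps C k" using assms by (auto simp: bottleneck_seps_def)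
  have fin: "finite (U {A, B})" "finite (U {D, E})"
    using finite_bottleneck_crossing bottleneckD assms unfolding U_def by meson+
  have cr: "crossing {B, A} {E, D}" using assms(5) by (simp add: insert_commute)
  have sub: "U {A \<inter> D, B \<union> E} \<union> U {B \<inter> E, A \<union> D} \<subseteq> U {A, B} \<union> U {D, E}"
    using nested_corner[OF _ _ assms(5)] nested_corner[OF _ _ cr]
    unfolding U_def by (auto simp: insert_commute)
  have sub2: "U {A \<inter> D, B \<union> E} \<inter> U {B \<inter> E, A \<union> D} \<subseteq> U {A, B} \<inter> U {D, E}"
    using nested_opposite_corners[of _ A B D E] nested_opposite_corners[of _ D E A B]
    unfolding U_def by (auto simp: Int_commute Un_commute)
  have "{A, B} \<in> U {D, E}" using AB assms(5) by (simp add: U_def)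
  moreover have "{A, B} \<notin> U {A \<inter> D, B \<union> E} \<union> U {B \<inter> E, A \<union> D}"
    by (auto simp: U_def nested_iff)
  ultimately have psub: "U {A \<inter> D, B \<union> E} \<union> U {B \<inter> E, A \<union> D} \<subset> U {A, B} \<union> U {D, E}"
    using sub by blast
  have fin': "finite (U {A \<inter> D, B \<union> E})" "finite (U {B \<inter> E, A \<union> D})"
    using sub fin finite_subset by (metis finite_Un)+
  have "card (U {A \<inter> D, B \<union> E}) + card (U {B \<inter> E, A \<union> D}) < card (U {A, B}) + card (U {D, E})"
    unfolding card_Un_Int[OF fin] card_Un_Int[OF fin']
    using psub sub2 fin by (intro add_less_le_mono psubset_card_mono card_mono) auto
  then show ?thesis
    using fin fin' by (simp add: crossing_number_def ecard_def U_def)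
qed

text \<open>Corners inherit nestedness with \<open>M\<close>, so a corner in \<beta> or \<beta>'
  competes with \<open>s\<close> or \<open>t\<close> for the least crossing number. By submodularity
  and the bottleneck property suitable opposite corners are available, and
  \<open>crossing_number_corners\<close> contradicts minimality.\<close>

lemma select_nested_nested:
  assumes b: "bottleneck C k \<beta>" "bottleneck C k \<beta>'"
    and s: "s \<in> select_nested C k M \<beta>" and t: "t \<in> select_nested C k M \<beta>'"
  shows "nested s t"
proof (rule ccontr)
  assume cr: "crossing s t"
  have st: "s \<in> \<beta>" "t \<in> \<beta>'" using s t by (auto simp: select_nested_def)
  obtain A B where AB: "s = {A, B}" "tight C {A, B}" using tight_sepE bottleneckD(1)[OF b(1) st(1)] by blast
  obtain D E where DE: "t = {D, E}" "tight C {D, E}" using tight_sepE bottleneckD(1)[OF b(2) st(2)] by blast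
  have verts: "A \<union> B = D \<union> E" using AB DE by (auto simp: tight_iff is_separation_def)
  have o: "finite (A \<inter> B)" "card (A \<inter> B) = k" "finite (D \<inter> E)" "card (D \<inter> E) = k"
    using bottleneckD(2)[OF b(1) st(1)] bottleneckD(2)[OF b(2) st(2)] AB DE
    by (auto simp: sep_order_eq_pair)
  let ?x = "crossing_number C k"
  \<comment> \<open>\<open>P\<close> and \<open>Q\<close> let the names of the sides vary, so each
    claim is proved once for all four corners.\<close>
  define P where "P X Y \<longleftrightarrow> s = {X, Y} \<and> X \<inter> Y = A \<inter> B \<and> X \<union> Y = A \<union> B" for X Y
  define Q where "Q X Y \<longleftrightarrow> t = {X, Y} \<and> X \<inter> Y = D \<inter> E \<and> X \<union> Y = D \<union> E" for X Y
  have PQ: "P A B" "P B A" "Q D E" "Q E D" using AB DE by (auto simp: P_def Q_def)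
  have sum: "card (X \<inter> U \<inter> (Y \<union> W)) + card (Y \<inter> W \<inter> (X \<union> U)) = 2 * k" if "P X Y" "Q U W" for X Y U W
    using card_opposite_corners[of X Y U W] that o verts unfolding P_def Q_def by auto
  have c1: "{X \<inter> U, Y \<union> W} \<in> \<beta> \<or> {X \<inter> W, Y \<union> U} \<in> \<beta>"
    if "P X Y" "Q U W" "card (X \<inter> U \<inter> (Y \<union> W)) \<le> k" "card (X \<inter> W \<inter> (Y \<union> U)) \<le> k" for X Y U W
    using bottleneck_corner[OF b(1), of X Y U W] that st cr DE o unfolding P_def Q_def by auto
  have c2: "{X \<inter> U, Y \<union> W} \<in> \<beta>' \<or> {Y \<inter> U, X \<union> W} \<in> \<beta>'"
    if "P X Y" "Q U W" "card (X \<inter> U \<inter> (Y \<union> W)) \<le> k" "card (Y \<inter> U \<inter> (X \<union> W)) \<le> k" for X Y U W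
    using bottleneck_corner[OF b(2), of U W X Y] that st cr AB o nested_sym[of t s] unfolding P_def Q_def
    by (auto simp: Int_commute Un_commute)
  have card: "card (X \<inter> U \<inter> (Y \<union> W)) = k" if "{X \<inter> U, Y \<union> W} \<in> \<beta> \<union> \<beta>'" for X Y U W
    using that bottleneckD(2)[OF b(1), of "{X \<inter> U, Y \<union> W}"] bottleneckD(2)[OF b(2), of "{X \<inter> U, Y \<union> W}"]
    unfolding sep_order_eq_pair by blast
  have nM: "\<forall>m\<in>M. nested {X \<inter> U, Y \<union> W} m" if "P X Y" "Q U W" for X Y U W
  proof
    fix m assume "m \<in> M"
    then have "nested s m" "nested t m" using s t unfolding select_nested_def Let_def by auto
    then have "nested m {X, Y}" "nested m {U, W}" "crossing {X, Y} {U, W}"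
      using that cr nested_sym unfolding P_def Q_def by auto
    then show "nested {X \<inter> U, Y \<union> W} m" by (intro nested_sym[OF nested_corner])
  qed
  have x1: "?x s \<le> ?x {X \<inter> U, Y \<union> W}" if "P X Y" "Q U W" "{X \<inter> U, Y \<union> W} \<in> \<beta>" for X Y U W
    using s that(3) nM[OF that(1,2)] unfolding select_nested_def Let_def by blast
  have x2: "?x t \<le> ?x {X \<inter> U, Y \<union> W}" if "P X Y" "Q U W" "{X \<inter> U, Y \<union> W} \<in> \<beta>'" for X Y U W
    using t that(3) nM[OF that(1,2)] unfolding select_nested_def Let_def by blast
  have lt: "?x {X \<inter> U, Y \<union> W} + ?x {Y \<inter> W, X \<union> U} < ?x s + ?x t" if "P X Y" "Q U W" for X Y U W
    using crossing_number_corners[OF b, of X Y U W] st cr that unfolding P_def Q_def by auto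
  \<comment> \<open>Opposite corners, one in each bottleneck: their sum is at least
    \<open>?x s + ?x t\<close>.\<close>
  have opp: False if "P X Y" "Q U W" "{X \<inter> U, Y \<union> W} \<in> \<beta>" "{Y \<inter> W, X \<union> U} \<in> \<beta>'" for X Y U W
  proof -
    have "P Y X" "Q W U" using that by (auto simp: P_def Q_def)
    then have "?x s + ?x t \<le> ?x {X \<inter> U, Y \<union> W} + ?x {Y \<inter> W, X \<union> U}"
      using x1[OF that(1-3)] x2[of Y X W U] that(4) by (intro add_mono) auto
    then show False using lt[OF that(1,2)] by (simp add: not_le[symmetric])
  qed
  \<comment> \<open>One opposite pair in \<beta>, the other in \<beta>': the first gives
    \<open>?x s < ?x t\<close>, the second the reverse.\<close>
  have four: False if "P X Y" "Q U W" "{X \<inter> U, Y \<union> W} \<in> \<beta>" "{Y \<inter> W, X \<union> U} \<in> \<beta>"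
    "{X \<inter> W, Y \<union> U} \<in> \<beta>'" "{Y \<inter> U, X \<union> W} \<in> \<beta>'" for X Y U W
  proof -
    have sw: "P Y X" "Q W U" using that by (auto simp: P_def Q_def)
    have "?x s + ?x s < ?x s + ?x t"
      using add_mono[OF x1[OF that(1-3)] x1[OF sw that(4)]] lt[OF that(1,2)] by (rule le_less_trans)
    moreover have "?x t + ?x t < ?x s + ?x t"
      using add_mono[OF x2[OF that(1) sw(2) that(5)] x2[OF sw(1) that(2) that(6)]] lt[OF that(1) sw(2)] by (rule le_less_trans)
    ultimately show False
      by (meson add_right_mono add_left_mono linorder_not_less order.strict_trans2 nle_le)
  qed
  note S = sum[OF PQ(1,3)] sum[OF PQ(1,4)]
  note c = c1[OF PQ(1,3)] c1[OF PQ(2,3)] c2[OF PQ(1,3)] c2[OF PQ(1,4)]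
  note cd = card[of A D B E] card[of A E B D] card[of B D A E] card[of B E A D]
  note op = opp[OF PQ(1,3)] opp[OF PQ(1,4)] opp[OF PQ(2,3)] opp[OF PQ(2,4)]
  note fo = four[OF PQ(1,3)] four[OF PQ(1,4)]
  show False
    by (rule opposite_corner_cases[OF S c cd]) (use op fo in auto)
qed

lemma N_level_nested:
  assumes "s \<in> N_level C i" "t \<in> N_level C j"
  shows "nested s t"
proof -
  have less: "nested s t" if "s \<in> N_level C i" "t \<in> N_level C j" "j < i" for s t i j
    using that(1)
  proof (rule N_levelE)
    fix \<beta> assume "s \<in> select_nested C i (\<Union>j<i. N_level C j) \<beta>"
    then show "nested s t" using that by (auto simp: select_nested_def Let_def)
  qed
  consider "j < i" | "i < j" | "i = j" by linarith
  then show ?thesis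
  proof cases
    case 3
    obtain \<beta> where "bottleneck C i \<beta>" "s \<in> select_nested C i (\<Union>j<i. N_level C j) \<beta>"
      using assms(1) by (rule N_levelE)
    moreover obtain \<beta>' where "bottleneck C i \<beta>'" "t \<in> select_nested C i (\<Union>j<i. N_level C j) \<beta>'"
      using assms(2) unfolding 3[symmetric] by (rule N_levelE)
    ultimately show ?thesis using select_nested_nested by blast
  qed (use less assms nested_sym in blast)+
qed

text \<open>Let \<open>s\<close> in \<beta> cross as few elements of lower levels as possible. If it
  crosses \<open>m\<close> of order \<open>j < k\<close>, then on each side of \<open>s\<close> some
  corner has order above \<open>k\<close>, hence its opposite has order below \<open>j\<close>.
  These two small corners lie on a common side of \<open>m\<close>, which the bottleneck containing
  \<open>m\<close> forbids.\<close>

lemma select_nested_nonempty: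
  assumes b: "bottleneck C k \<beta>"
  shows "select_nested C k (\<Union>j<k. N_level C j) \<beta> \<noteq> {}"
proof -
  define M where "M = (\<Union>j<k. N_level C j)"
  have M: "tight C m \<and> sep_order m \<le> enat k" if "m \<in> M" for m
    using that N_level_tight N_level_order by (fastforce simp: M_def)
  define c where "c s = card {m \<in> M. crossing m s}" for s
  have fin: "finite {m \<in> M. crossing m s}" if "s \<in> \<beta>" for s
    using finite_crossing[of s k k] bottleneckD[OF b that] M
    by (auto intro: finite_subset[of _ "{t. tight C t \<and> sep_order t \<le> enat k \<and> crossing t s}"])
  obtain s where s: "s \<in> \<beta>" and min: "\<And>s'. s' \<in> \<beta> \<Longrightarrow> c s \<le> c s'"
    using b ex_has_least_nat[of "\<lambda>s. s \<in> \<beta>" _ c] unfolding bottleneck_def by blast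
  have "nested s m" if m: "m \<in> M" for m
  proof (rule ccontr)
    assume cr: "crossing s m"
    obtain j where j: "j < k" "m \<in> N_level C j" using m by (auto simp: M_def)
    obtain \<gamma> where \<gamma>: "bottleneck C j \<gamma>" "m \<in> \<gamma>" using j(2) by (rule N_levelE)
    obtain A B where AB: "s = {A, B}" "tight C {A, B}" using tight_sepE bottleneckD(1)[OF b s] by blast
    obtain D E where DE: "m = {D, E}" "tight C {D, E}" using tight_sepE bottleneckD(1)[OF \<gamma>] by blast
    have verts: "A \<union> B = D \<union> E" using AB DE by (auto simp: tight_iff is_separation_def)
    have o: "finite (A \<inter> B)" "card (A \<inter> B) = k" "finite (D \<inter> E)" "card (D \<inter> E) = j"
      using bottleneckD(2)[OF b s] bottleneckD(2)[OF \<gamma>] AB DE by (auto simp: sep_order_eq_pair)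
    define P where "P X Y \<longleftrightarrow> s = {X, Y} \<and> X \<inter> Y = A \<inter> B \<and> X \<union> Y = A \<union> B" for X Y
    define Q where "Q X Y \<longleftrightarrow> m = {X, Y} \<and> X \<inter> Y = D \<inter> E \<and> X \<union> Y = D \<union> E" for X Y
    have PQ: "P A B" "P B A" "Q D E" "Q E D" using AB DE by (auto simp: P_def Q_def)
    have sum: "card (X \<inter> U \<inter> (Y \<union> W)) + card (Y \<inter> W \<inter> (X \<union> U)) = k + j" if "P X Y" "Q U W" for X Y U W
      using card_opposite_corners[of X Y U W] that o verts unfolding P_def Q_def by auto
    \<comment> \<open>A corner crosses no element of \<open>M\<close> that \<open>s\<close> does not
      cross, by \<open>nested_corner\<close> and nestedness of lower levels, and it no longer
      crosses \<open>m\<close>.\<close>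
    have nin: "{X \<inter> U, Y \<union> W} \<notin> \<beta>" if "P X Y" "Q U W" for X Y U W
    proof
      assume cor: "{X \<inter> U, Y \<union> W} \<in> \<beta>"
      have crXU: "crossing {X, Y} {U, W}" using cr that by (simp add: P_def Q_def)
      have "nested n {X \<inter> U, Y \<union> W}" if n: "n \<in> M" "nested n s" for n
      proof -
        obtain i where "i < k" "n \<in> N_level C i" using n(1) by (auto simp: M_def)
        then have "nested n m" using N_level_nested j(2) by blast
        then show ?thesis using n(2) \<open>P X Y\<close> \<open>Q U W\<close> crXU unfolding P_def Q_def by (metis nested_corner)
      qed
      then have "{n \<in> M. crossing n {X \<inter> U, Y \<union> W}} \<subseteq> {n \<in> M. crossing n s} - {m}"
        using \<open>Q U W\<close> by (auto simp: Q_def nested_iff)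
      moreover have "m \<in> {n \<in> M. crossing n s}" using m cr nested_sym by blast
      ultimately have "{n \<in> M. crossing n {X \<inter> U, Y \<union> W}} \<subset> {n \<in> M. crossing n s}" by blast
      then have "c {X \<inter> U, Y \<union> W} < c s"
        unfolding c_def using fin[OF s] by (rule psubset_card_mono[rotated])
      then show False using min[OF cor] by simp
    qed
    have c1: "k < card (X \<inter> U \<inter> (Y \<union> W)) \<or> k < card (X \<inter> W \<inter> (Y \<union> U))" if "P X Y" "Q U W" for X Y U W
    proof -
      have "Q W U" using that by (auto simp: Q_def)
      then show ?thesis
        using bottleneck_corner[OF b, of X Y U W] nin[OF that] nin[OF that(1), of W U]
          that s cr DE o unfolding P_def Q_def by force
    qed
    \<comment> \<open>Two corners of order below \<open>j\<close> on one side of \<open>m\<close>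
      would put one of them into \<gamma>, whose elements have order exactly
      \<open>j\<close>.\<close>
    have c2: "j \<le> card (X \<inter> U \<inter> (Y \<union> W)) \<or> j \<le> card (Y \<inter> U \<inter> (X \<union> W))" if "P X Y" "Q U W" for X Y U W
    proof (rule ccontr)
      assume "\<not> ?thesis"
      then have less: "card (U \<inter> X \<inter> (W \<union> Y)) < j" "card (U \<inter> Y \<inter> (W \<union> X)) < j"
        by (simp_all add: Int_commute Un_commute)
      have "crossing m s" using cr nested_sym by blast
      then have "{U \<inter> X, W \<union> Y} \<in> \<gamma> \<or> {U \<inter> Y, W \<union> X} \<in> \<gamma>"
        using bottleneck_corner[OF \<gamma>(1), of U W X Y] less that \<gamma>(2) AB o unfolding P_def Q_def by auto
      then have "card (U \<inter> X \<inter> (W \<union> Y)) = j \<or> card (U \<inter> Y \<inter> (W \<union> X)) = j"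
        using bottleneckD(2)[OF \<gamma>(1)] unfolding sep_order_eq_pair[symmetric] by (metis sep_order_eq_pair)
      then show False using less by linarith
    qed
    show False
      using sum[OF PQ(1,3)] sum[OF PQ(1,4)] c1[OF PQ(1,3)] c1[OF PQ(2,3)] c2[OF PQ(1,3)] c2[OF PQ(1,4)] j(1)
      by linarith
  qed
  then have "{s \<in> \<beta>. \<forall>t\<in>M. nested s t} \<noteq> {}" using s by blast
  then obtain s where "s \<in> {s \<in> \<beta>. \<forall>t\<in>M. nested s t}"
    "\<And>s'. s' \<in> {s \<in> \<beta>. \<forall>t\<in>M. nested s t} \<Longrightarrow> crossing_number C k s \<le> crossing_number C k s'"
    using exists_least_iff[of "\<lambda>n. \<exists>s\<in>{s \<in> \<beta>. \<forall>t\<in>M. nested s t}. crossing_number C k s = n"]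
    by (metis (no_types, lifting) all_not_in_conv linorder_not_le)
  then show ?thesis
    unfolding select_nested_def Let_def M_def[symmetric] by blast
qed

lemma bottleneck_meets_N_set:
  assumes "bottleneck C k \<beta>"
  obtains s where "s \<in> \<beta>" "s \<in> N_set C"
proof -
  obtain s where s: "s \<in> select_nested C k (\<Union>j<k. N_level C j) \<beta>"
    using select_nested_nonempty[OF assms] by blast
  then have "s \<in> N_level C k" using assms by (subst N_level_eq) blast
  moreover have "s \<in> \<beta>" using s by (simp add: select_nested_def)
  ultimately show ?thesis using that by (auto simp: N_set_def)
qed

end

section \<open>Homotopy and the fundamental group\<close>

text \<open>If the walk begins with \<open>y\<close>, \<open>x\<close>, prepending \<open>x\<close>
  creates the spike \<open>x\<close>, \<open>y\<close>, \<open>x\<close>; contracting it amounts to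
  dropping \<open>y\<close>.\<close>

definition cancel_cons :: "'a \<Rightarrow> 'a list \<Rightarrow> 'a list" where
  "cancel_cons x ys = (if 2 \<le> length ys \<and> ys ! 1 = x then tl ys else x # ys)"

text \<open>A normal form computed from the right end. Its invariance under a single reduction step
  replaces a confluence proof and makes reductions unique.\<close>

definition red :: "'a list \<Rightarrow> 'a list" where
  "red xs = foldr cancel_cons xs []"

lemma red_Nil [simp]: "red [] = []"
  and red_Cons: "red (x # xs) = cancel_cons x (red xs)"
  and red_append: "red (xs @ ys) = foldr cancel_cons xs (red ys)"
  by (simp_all add: red_def)

lemma cancel_cons_simps [simp]:
  "cancel_cons x [] = [x]" "cancel_cons x [y] = [x, y]"
  "cancel_cons x (y # z # zs) = (if x = z then z # zs else x # y # z # zs)"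
  by (auto simp: cancel_cons_def)

lemma hd_cancel_cons [simp]: "hd (cancel_cons x ys) = x" "cancel_cons x ys \<noteq> []"
  by (cases ys; cases "tl ys"; auto simp: cancel_cons_def)+

lemma last_cancel_cons: "last (cancel_cons x ys) = (if ys = [] then x else last ys)"
  by (cases ys; cases "tl ys"; auto)

lemma hd_red: "hd (red xs) = hd xs" and red_eq_Nil_iff [simp]: "red xs = [] \<longleftrightarrow> xs = []"
  by (cases xs; simp add: red_Cons)+

lemma last_red: "last (red xs) = last xs"
  by (induct xs) (simp_all add: red_Cons last_cancel_cons)

definition irreducible_walk :: "'a list \<Rightarrow> bool" where
  "irreducible_walk W \<longleftrightarrow> (\<nexists>W'. reduce_step W W')"

lemma irreducible_walk_iff: "irreducible_walk W \<longleftrightarrow> (\<nexists>xs u v ys. W = xs @ u # v # u # ys)"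
  by (auto simp: irreducible_walk_def reduce_step_def)

lemma irreducible_walk_ConsD: "irreducible_walk (x # xs) \<Longrightarrow> irreducible_walk xs"
  unfolding irreducible_walk_iff by (metis append_Cons)

lemma irreducible_cancel_cons: "irreducible_walk ys \<Longrightarrow> irreducible_walk (cancel_cons x ys)"
proof (cases "2 \<le> length ys \<and> ys ! 1 = x")
  case True
  then show "irreducible_walk ys \<Longrightarrow> ?thesis"
    by (cases ys) (auto simp: cancel_cons_def dest: irreducible_walk_ConsD)
next
  case False
  assume irr: "irreducible_walk ys"
  have "x # ys \<noteq> xs @ u # v # u # zs" for xs u v zs
  proof
    assume "x # ys = xs @ u # v # u # zs"
    then show False
      using False irr unfolding irreducible_walk_iff by (cases xs) auto
  qed
  moreover have "cancel_cons x ys = x # ys" using False by (auto simp: cancel_cons_def)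
  ultimately show ?thesis by (simp add: irreducible_walk_iff)
qed

lemma irreducible_red: "irreducible_walk (red xs)"
proof (induct xs)
  case Nil
  then show ?case by (simp add: irreducible_walk_iff)
qed (simp add: red_Cons irreducible_cancel_cons)

text \<open>Inserting a spike at the start of a reduced walk has no effect. If \<open>v\<close> is
  already its second vertex, the first cancellation removes \<open>u\<close>; irreducibility
  prevents the second \<open>u\<close> from cancelling further.\<close>

lemma cancel_cons_twice:
  assumes "irreducible_walk ys" "ys \<noteq> []" "hd ys = u"
  shows "cancel_cons u (cancel_cons v ys) = ys"
proof -
  obtain L where L: "ys = u # L" using assms by (cases ys) auto
  show ?thesis
  proof (cases L)
    case (Cons w L')
    have "hd L' \<noteq> u" if "L' \<noteq> []"
    proof
      assume "hd L' = u"
      then have "ys = [] @ u # w # u # tl L'" using that L Cons by (metis append_Nil list.collapse)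
      then show False using assms(1) unfolding irreducible_walk_iff by blast
    qed
    then show ?thesis
      unfolding L Cons by (cases L') auto
  qed (simp add: L)
qed

lemma red_reduce_step:
  assumes "reduce_step W W'"
  shows "red W = red W'"
proof -
  obtain xs u v ys where W: "W = xs @ [u, v, u] @ ys" "W' = xs @ [u] @ ys"
    using assms by (auto simp: reduce_step_def)
  have "red ([u, v, u] @ ys) = cancel_cons u (cancel_cons v (red (u # ys)))"
    by (simp add: red_Cons)
  also have "\<dots> = red (u # ys)"
    by (rule cancel_cons_twice) (simp_all add: irreducible_red hd_red)
  finally show ?thesis by (simp add: W red_append)
qed

lemma red_reduce_steps: "reduce_step\<^sup>*\<^sup>* W W' \<Longrightarrow> red W = red W'"
  by (induct rule: rtranclp_induct) (auto dest: red_reduce_step)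

lemma reduce_step_append: "reduce_step W W' \<Longrightarrow> reduce_step (xs @ W @ ys) (xs @ W' @ ys)"
  unfolding reduce_step_def by (metis append.assoc)

lemma reduce_steps_append: "reduce_step\<^sup>*\<^sup>* W W' \<Longrightarrow> reduce_step\<^sup>*\<^sup>* (xs @ W @ ys) (xs @ W' @ ys)"
  by (induct rule: rtranclp_induct) (auto intro: reduce_step_append rtranclp.rtrancl_into_rtrancl)

lemma reduce_steps_red: "reduce_step\<^sup>*\<^sup>* W (red W)"
proof (induct W)
  case (Cons x xs)
  have "reduce_step\<^sup>*\<^sup>* (x # xs) (x # red xs)"
    using reduce_steps_append[OF Cons, of "[x]" "[]"] by simp
  moreover have "reduce_step\<^sup>*\<^sup>* (x # red xs) (cancel_cons x (red xs))"
  proof (cases "2 \<le> length (red xs) \<and> red xs ! 1 = x")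
    case True
    then obtain y zs where "red xs = y # x # zs"
      by (cases "red xs"; cases "tl (red xs)") auto
    moreover have "reduce_step (x # y # x # zs) (x # zs)"
      unfolding reduce_step_def by (intro exI[of _ "[]"] exI[of _ x] exI[of _ y] exI[of _ zs]) simp
    ultimately show ?thesis by auto
  next
    case False
    then have "cancel_cons x (red xs) = x # red xs" by (auto simp: cancel_cons_def)
    then show ?thesis by simp
  qed
  ultimately show ?case by (simp add: red_Cons)
qed simp

lemma red_irreducible: "irreducible_walk W \<Longrightarrow> red W = W"
  using reduce_steps_red[of W] unfolding irreducible_walk_def by (metis converse_rtranclpE)

lemma is_reduction_iff: "is_reduction W R \<longleftrightarrow> R = red W"
  unfolding is_reduction_def
  using reduce_steps_red[of W] irreducible_red[of W] red_reduce_steps[of W R] red_irreducible[of R]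
  unfolding irreducible_walk_def by auto

lemma homotopic_iff: "homotopic W W' \<longleftrightarrow> red W = red W'"
  by (simp add: homotopic_def is_reduction_iff)

lemma red_append_cong:
  assumes "red W = red W'"
  shows "red (xs @ W @ ys) = red (xs @ W' @ ys)"
  using red_reduce_steps[OF reduce_steps_append[OF reduce_steps_red]] assms by metis

lemma red_join_cong:
  assumes "red V = red V'" "red W = red W'" "joinable V W" "joinable V' W'"
  shows "red (vwalk_join V W) = red (vwalk_join V' W')"
proof -
  \<comment> \<open>The factors are exchanged one after the other, so the mixed pair must be
    joinable too.\<close>
  have "joinable V' W"
    using assms hd_red last_red unfolding joinable_def by (metis red_eq_Nil_iff)
  have "red (vwalk_join V W) = red (vwalk_join V' W)"
    using red_append_cong[OF assms(1), of "[]" "tl W"] by (simp add: vwalk_join_def)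
  also have "\<dots> = red (vwalk_join V' W')"
    using red_append_cong[OF assms(2), of "butlast V'" "[]"] \<open>joinable V' W\<close> assms(4)
    by (simp add: vwalk_join_def2)
  finally show ?thesis .
qed

lemma red_join_rev:
  assumes "W \<noteq> []"
  shows "red (vwalk_join W (rev W)) = [hd W]"
  using assms
proof (induct W rule: induct_list012)
  case (3 x y zs)
  then have IH: "red (vwalk_join (y # zs) (rev (y # zs))) = [y]" by simp
  have "vwalk_join (x # y # zs) (rev (x # y # zs)) = [x] @ vwalk_join (y # zs) (rev (y # zs)) @ [x]"
    by (cases "rev zs") (simp_all add: vwalk_join_def)
  also have "red \<dots> = red ([x] @ [y] @ [x])"
    by (rule red_append_cong) (simp only: IH, simp add: red_Cons)
  also have "\<dots> = [x]" by (simp add: red_Cons)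
  finally show ?case by simp
qed (simp_all add: vwalk_join_def red_Cons)

section \<open>Walks as vertex lists, and the group of homotopy classes\<close>

lemma vwalk_with_proj_iff:
  "vwalk W (with_proj G) \<longleftrightarrow>
    W \<noteq> [] \<and> set W \<subseteq> pverts G \<and> successively (\<lambda>u v. (u, v) \<in> parcs G) W"
proof -
  have "set (vwalk_arcs W) \<subseteq> A \<longleftrightarrow> successively (\<lambda>u v. (u, v) \<in> A) W" for A
    by (induct W rule: vwalk_arcs.induct) auto
  then show ?thesis by (auto simp: vwalk_def)
qed

abbreviation walk :: "'a pair_pre_digraph \<Rightarrow> 'a list \<Rightarrow> bool" where
  "walk G W \<equiv> vwalk W (with_proj G)"

lemma walk_join:
  assumes "walk G V" "walk G W" "last V = hd W"
  shows "walk G (vwalk_join V W)" "hd (vwalk_join V W) = hd V" "last (vwalk_join V W) = last W"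
  using assms unfolding vwalk_with_proj_iff vwalk_join_def
  by (cases W; force simp: successively_append_iff successively_Cons)+

lemma vwalk_join_assoc: "W \<noteq> [] \<Longrightarrow> vwalk_join (vwalk_join V W) X = vwalk_join V (vwalk_join W X)"
  by (cases W) (simp_all add: vwalk_join_def)

lemma map_join: "map f (vwalk_join V W) = vwalk_join (map f V) (map f W)"
  by (simp add: vwalk_join_def map_tl)

lemma rev_join: "V \<noteq> [] \<Longrightarrow> W \<noteq> [] \<Longrightarrow> last V = hd W \<Longrightarrow> rev (vwalk_join V W) = vwalk_join (rev W) (rev V)"
  by (cases W; cases V rule: rev_cases) (auto simp: vwalk_join_def)

lemma walk_nonempty: "walk G W \<Longrightarrow> W \<noteq> []"
  by (simp add: vwalk_with_proj_iff)

lemma walk_ConsI: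
  assumes "walk G W" "(u, hd W) \<in> parcs G" "u \<in> pverts G"
  shows "walk G (u # W)"
  using assms by (auto simp: vwalk_with_proj_iff successively_Cons)

lemma closed_walk_with_proj: "closed_walk (with_proj G) x W \<longleftrightarrow> walk G W \<and> hd W = x \<and> last W = x"
  by (simp add: closed_walk_def)

locale symmetric_graph =
  fixes G :: "'a pair_pre_digraph"
  assumes sym: "(u, v) \<in> parcs G \<Longrightarrow> (v, u) \<in> parcs G"
begin

lemma walk_rev: "walk G W \<Longrightarrow> walk G (rev W)"
  using sym by (auto simp: vwalk_with_proj_iff intro: successively_mono)

abbreviation cls :: "'a \<Rightarrow> 'a list \<Rightarrow> 'a list set" where
  "cls x W \<equiv> homotopy_class (with_proj G) x W"

lemma homotopy_class_eq: "cls x W = {W'. closed_walk (with_proj G) x W' \<and> red W' = red W}"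
  by (auto simp: homotopy_class_def homotopic_iff)

lemma homotopy_class_cong:
  "closed_walk (with_proj G) x W \<Longrightarrow> cls x W = cls x W' \<longleftrightarrow> red W = red W'"
  unfolding homotopy_class_eq by auto

lemma closed_walk_join:
  "closed_walk (with_proj G) x V \<Longrightarrow> closed_walk (with_proj G) x W \<Longrightarrow>
    closed_walk (with_proj G) x (vwalk_join V W)"
  using walk_join[of V G W] by (simp add: closed_walk_with_proj)

lemma closed_walk_joinable:
  "closed_walk (with_proj G) x V \<Longrightarrow> closed_walk (with_proj G) x W \<Longrightarrow> joinable V W"
  by (auto simp: closed_walk_with_proj joinable_def vwalk_with_proj_iff)

lemma closed_walk_rev:
  "closed_walk (with_proj G) x W \<Longrightarrow> closed_walk (with_proj G) x (rev W)"
  using walk_rev walk_nonempty[of W] by (auto simp: closed_walk_with_proj hd_rev last_rev)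

text \<open>The product is defined as a union over all pairs of representatives; all classes in this
  union coincide.\<close>

lemma mult_homotopy_class:
  assumes "closed_walk (with_proj G) x V" "closed_walk (with_proj G) x W"
  shows "cls x V \<otimes>\<^bsub>fundamental_group (with_proj G) x\<^esub> cls x W = cls x (vwalk_join V W)"
proof -
  have "cls x (vwalk_join V' W') = cls x (vwalk_join V W)"
    if "V' \<in> cls x V" "W' \<in> cls x W" for V' W'
  proof -
    have V': "closed_walk (with_proj G) x V'" "red V' = red V"
      and W': "closed_walk (with_proj G) x W'" "red W' = red W"
      using that by (auto simp: homotopy_class_eq)
    show ?thesis
      unfolding homotopy_class_cong[OF closed_walk_join[OF V'(1) W'(1)]]
      using V' W' assms closed_walk_joinable by (intro red_join_cong) auto
  qed
  moreover have "V \<in> cls x V" "W \<in> cls x W" using assms by (auto simp: homotopy_class_eq)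
  ultimately have "(\<Union>V'\<in>cls x V. \<Union>W'\<in>cls x W. cls x (vwalk_join V' W')) = cls x (vwalk_join V W)"
  proof -
    assume eq: "\<And>V' W'. V' \<in> cls x V \<Longrightarrow> W' \<in> cls x W \<Longrightarrow>
        cls x (vwalk_join V' W') = cls x (vwalk_join V W)"
      and ne: "V \<in> cls x V" "W \<in> cls x W"
    have "(\<Union>V'\<in>cls x V. \<Union>W'\<in>cls x W. cls x (vwalk_join V' W')) =
        (\<Union>V'\<in>cls x V. \<Union>W'\<in>cls x W. cls x (vwalk_join V W))"
      by (intro SUP_cong refl eq)
    then show ?thesis using ne by auto
  qed
  then show ?thesis by (simp add: fundamental_group_def)
qed

lemma mult_rev_homotopy_class:
  assumes "closed_walk (with_proj G) x W"
  shows "cls x (rev W) \<otimes>\<^bsub>fundamental_group (with_proj G) x\<^esub> cls x W = \<one>\<^bsub>fundamental_group (with_proj G) x\<^esub>"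
proof -
  note r = closed_walk_rev[OF assms]
  have "cls x (vwalk_join (rev W) W) = cls x [x]"
    unfolding homotopy_class_cong[OF closed_walk_join[OF r assms]]
    using red_join_rev[of "rev W"] walk_nonempty[of W] assms
    by (auto simp: hd_rev closed_walk_with_proj red_Cons)
  then show ?thesis
    unfolding mult_homotopy_class[OF r assms] by (simp add: fundamental_group_def)
qed

text \<open>\<open>generate\<close> refers to group inverses; identifying these with reversed walks
  needs the group laws.\<close>

lemma group_fundamental_group:
  assumes "x \<in> pverts G"
  shows "group (fundamental_group (with_proj G) x)" (is "group ?F")
proof (rule groupI)
  have carr: "carrier ?F = {cls x W | W. closed_walk (with_proj G) x W}"
    and one: "\<one>\<^bsub>?F\<^esub> = cls x [x]"
    by (auto simp: fundamental_group_def)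
  have cx: "closed_walk (with_proj G) x [x]"
    using assms by (simp add: closed_walk_with_proj vwalk_with_proj_iff)
  show "\<one>\<^bsub>?F\<^esub> \<in> carrier ?F" using cx carr one by auto
  show "\<alpha> \<otimes>\<^bsub>?F\<^esub> \<beta> \<in> carrier ?F" if "\<alpha> \<in> carrier ?F" "\<beta> \<in> carrier ?F" for \<alpha> \<beta>
    using that mult_homotopy_class closed_walk_join unfolding carr by fastforce
  show "\<alpha> \<otimes>\<^bsub>?F\<^esub> \<beta> \<otimes>\<^bsub>?F\<^esub> \<gamma> = \<alpha> \<otimes>\<^bsub>?F\<^esub> (\<beta> \<otimes>\<^bsub>?F\<^esub> \<gamma>)"
    if mem: "\<alpha> \<in> carrier ?F" "\<beta> \<in> carrier ?F" "\<gamma> \<in> carrier ?F" for \<alpha> \<beta> \<gamma>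
  proof -
    obtain U V W where W: "closed_walk (with_proj G) x U" "closed_walk (with_proj G) x V"
      "closed_walk (with_proj G) x W" "\<alpha> = cls x U" "\<beta> = cls x V" "\<gamma> = cls x W"
      using mem unfolding carr by blast
    have "V \<noteq> []" using W(2) by (auto simp: closed_walk_with_proj vwalk_with_proj_iff)
    then show ?thesis
      unfolding W(4-) using W(1-3) by (simp add: mult_homotopy_class closed_walk_join vwalk_join_assoc)
  qed
  show "\<one>\<^bsub>?F\<^esub> \<otimes>\<^bsub>?F\<^esub> \<alpha> = \<alpha>" if mem: "\<alpha> \<in> carrier ?F" for \<alpha>
  proof -
    obtain W where W: "closed_walk (with_proj G) x W" "\<alpha> = cls x W"
      using mem unfolding carr by blast
    have "vwalk_join [x] W = W"
      using W(1) by (cases W) (auto simp: closed_walk_with_proj vwalk_with_proj_iff vwalk_join_def)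
    then show ?thesis unfolding one W(2) by (simp add: mult_homotopy_class[OF cx W(1)])
  qed
  show "\<exists>\<beta>\<in>carrier ?F. \<beta> \<otimes>\<^bsub>?F\<^esub> \<alpha> = \<one>\<^bsub>?F\<^esub>" if mem: "\<alpha> \<in> carrier ?F" for \<alpha>
  proof -
    obtain W where W: "closed_walk (with_proj G) x W" "\<alpha> = cls x W"
      using mem unfolding carr by blast
    have "cls x (rev W) \<in> carrier ?F" using closed_walk_rev[OF W(1)] unfolding carr by blast
    then show ?thesis using mult_rev_homotopy_class[OF W(1)] unfolding W(2) by blast
  qed
qed

lemma inv_homotopy_class:
  assumes "closed_walk (with_proj G) x W" "x \<in> pverts G"
  shows "inv\<^bsub>fundamental_group (with_proj G) x\<^esub> cls x W = cls x (rev W)"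
  using group_fundamental_group[OF assms(2)] mult_rev_homotopy_class closed_walk_rev assms(1)
  by (intro group.inv_equality) (auto simp: fundamental_group_def)

end

section \<open>Lifting along local coverings\<close>

lemma vwalk_edges_length: "length (walk_edges W) = length W - 1"
  by (simp add: walk_edges_def vwalk_length_def[symmetric])

locale graph_covering =
  fixes C :: "'b pair_pre_digraph" and G :: "'a pair_pre_digraph" and p :: "'b \<Rightarrow> 'a"
  assumes covering: "covering C G p" and symG: "(a, b) \<in> parcs G \<Longrightarrow> (b, a) \<in> parcs G"
begin

sublocale G: symmetric_graph G by unfold_locales (rule symG)

lemma bidirected: "pair_bidirected_digraph C"
  using covering by (simp add: covering_def)

lemma arc_sym: "(u, v) \<in> parcs C \<Longrightarrow> (v, u) \<in> parcs C"
proof -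
  interpret pair_bidirected_digraph C by (rule bidirected)
  show "(u, v) \<in> parcs C \<Longrightarrow> (v, u) \<in> parcs C" by (rule arcs_symmetric)
qed

sublocale C: symmetric_graph C by unfold_locales (rule arc_sym)

lemma arc_verts: "(u, v) \<in> parcs C \<Longrightarrow> u \<in> pverts C \<and> v \<in> pverts C"
proof -
  interpret pair_bidirected_digraph C by (rule bidirected)
  show "(u, v) \<in> parcs C \<Longrightarrow> u \<in> pverts C \<and> v \<in> pverts C"
    using in_arcsD1 in_arcsD2 by blast
qed

lemma p_vert: "u \<in> pverts C \<Longrightarrow> p u \<in> pverts G"
  using covering by (auto simp: covering_def)

lemma p_arc: "(u, v) \<in> parcs C \<Longrightarrow> (p u, p v) \<in> parcs G"
  using covering by (auto simp: covering_def)

lemma out_arcs_bij: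
  "u \<in> pverts C \<Longrightarrow> bij_betw (map_prod p p) {e \<in> parcs C. fst e = u} {e \<in> parcs G. fst e = p u}"
  using covering by (simp add: covering_def out_arcs_def)

lemma p_locally_inj:
  assumes "(u, v) \<in> parcs C" "(u, w) \<in> parcs C" "p v = p w"
  shows "v = w"
proof -
  have "inj_on (map_prod p p) {e \<in> parcs C. fst e = u}"
    using out_arcs_bij arc_verts[OF assms(1)] by (blast dest: bij_betw_imp_inj_on)
  then have "(u, v) = (u, w)" by (rule inj_onD) (use assms in auto)
  then show ?thesis by simp
qed

lemma p_locally_surj:
  assumes "u \<in> pverts C" "(p u, w) \<in> parcs G"
  obtains v where "(u, v) \<in> parcs C" "p v = w"
proof -
  have "(p u, w) \<in> map_prod p p ` {e \<in> parcs C. fst e = u}"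
    unfolding bij_betw_imp_surj_on[OF out_arcs_bij[OF assms(1)]] using assms(2) by simp
  then show ?thesis using that by auto
qed

lemma walk_map: "walk C W \<Longrightarrow> walk G (map p W)"
  by (auto simp: vwalk_with_proj_iff successively_map p_vert p_arc intro: successively_mono)

lemma walk_hd_last:
  assumes "walk C W"
  shows "hd W \<in> pverts C" "last W \<in> pverts C" "p (hd W) = hd (map p W)" "p (last W) = last (map p W)"
  using assms by (auto simp: vwalk_with_proj_iff hd_map last_map)

lemma lift_exists:
  assumes "walk G W" "u \<in> pverts C" "p u = hd W"
  obtains L where "walk C L" "hd L = u" "map p L = W"
proof -
  have "\<exists>L. walk C L \<and> hd L = u \<and> map p L = W"
    using assms
  proof (induct W arbitrary: u rule: list.induct)
    case (Cons a W)
    show ?case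
    proof (cases W)
      case Nil
      then show ?thesis using Cons by (intro exI[of _ "[u]"]) (simp add: vwalk_with_proj_iff)
    next
      case W: (Cons b W')
      then have ab: "(a, b) \<in> parcs G" "walk G W"
        using Cons.prems by (auto simp: vwalk_with_proj_iff)
      then obtain v where v: "(u, v) \<in> parcs C" "p v = b"
        using p_locally_surj[OF Cons.prems(2), of b] Cons.prems(3) by auto
      have "p v = hd W" using v(2) W by simp
      then obtain L where L: "walk C L" "hd L = v" "map p L = W"
        using Cons.hyps[OF ab(2)] arc_verts[OF v(1)] by blast
      then have "walk C (u # L)" using v arc_verts by (intro walk_ConsI) auto
      then show ?thesis using L Cons.prems by (intro exI[of _ "u # L"]) simp
    qed
  qed (simp add: vwalk_with_proj_iff)
  then show ?thesis using that by blast
qed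

lemma lift_unique:
  "walk C V \<Longrightarrow> walk C W \<Longrightarrow> hd V = hd W \<Longrightarrow> map p V = map p W \<Longrightarrow> V = W"
proof (induct V arbitrary: W rule: list.induct)
  case (Cons a V)
  then obtain b W' where W: "W = b # W'" by (cases W) auto
  show ?case
  proof (cases V)
    case Nil
    then show ?thesis using Cons.prems W by auto
  next
    case V: (Cons c V')
    then obtain d W'' where W': "W' = d # W''" using Cons.prems W by (cases W') auto
    have ab: "a = b" using Cons.prems W by simp
    have arcs: "(a, c) \<in> parcs C" "(b, d) \<in> parcs C" "walk C V" "walk C W'"
      using Cons.prems W V W' by (auto simp: vwalk_with_proj_iff)
    moreover have "p c = p d" using Cons.prems W V W' by simp
    ultimately have "c = d" using p_locally_inj ab by blast
    then show ?thesis using Cons.hyps[OF arcs(3,4)] Cons.prems(4) W V W' ab by simp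
  qed
qed (simp add: vwalk_with_proj_iff)

text \<open>Local injectivity at the middle vertex: a spike in the projection comes from a spike in
  the covering graph, so both cancel at the same places.\<close>

lemma walk_red: "walk C W \<Longrightarrow> walk C (red W) \<and> map p (red W) = red (map p W)"
proof (induct W rule: list.induct)
  case (Cons x W)
  show ?case
  proof (cases "W = []")
    case False
    then have W: "walk C W" "(x, hd W) \<in> parcs C" "x \<in> pverts C"
      using Cons.prems by (auto simp: vwalk_with_proj_iff successively_Cons)
    then have IH: "walk C (red W)" "map p (red W) = red (map p W)" using Cons.hyps by auto
    obtain y zs where r: "red W = y # zs" using False red_eq_Nil_iff by (cases "red W") auto
    have y: "y = hd W" using hd_red[of W] r by simp
    show ?thesis
    proof (cases zs)
      case Nil
      then show ?thesis using W IH y r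
        by (auto simp: red_Cons vwalk_with_proj_iff simp flip: IH(2))
    next
      case zs: (Cons z zs')
      have yz: "(y, z) \<in> parcs C" using IH(1) unfolding r zs by (auto simp: vwalk_with_proj_iff)
      have "p x = p z \<longleftrightarrow> x = z" using p_locally_inj[OF _ yz] W(2) y arc_sym by blast
      then show ?thesis using W IH y r zs
        by (auto simp: red_Cons vwalk_with_proj_iff simp flip: IH(2))
    qed
  qed (use Cons.prems in \<open>simp add: red_Cons\<close>)
qed (simp add: vwalk_with_proj_iff)

text \<open>Homotopy lifting: the reduced walks are lifts of one walk from one vertex.\<close>

lemma lift_red_cong:
  assumes "walk C V" "walk C W" "hd V = hd W" "red (map p V) = red (map p W)"
  shows "red V = red W" "last V = last W"
proof -
  show "red V = red W"
    using assms walk_red by (intro lift_unique) (auto simp: hd_red)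
  then show "last V = last W" using last_red by metis
qed

end

section \<open>Lifts of closed walks, and deck transformations\<close>

locale local_cover = graph_covering C G p
  for C :: "'b pair_pre_digraph" and G :: "'a pair_pre_digraph" and p +
  fixes r :: nat and x :: 'a and y :: 'b
  assumes y: "y \<in> pverts C" and py: "p y = x"
    and C_connected: "u \<in> pverts C \<Longrightarrow> v \<in> pverts C \<Longrightarrow> \<exists>W. walk C W \<and> hd W = u \<and> last W = v"
    and iso: "induced_map (with_proj G) x p \<in> iso (fundamental_group (with_proj C) y)
        ((fundamental_group (with_proj G) x)\<lparr>carrier := local_subgroup r (with_proj G) x\<rparr>)"
begin

abbreviation closed :: "'b list \<Rightarrow> bool" where
  "closed W \<equiv> closed_walk (with_proj C) y W"

definition generators :: "'a list set" where
  "generators = {W. closed_walk (with_proj G) x W \<and>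
    (\<exists>Z. graph_cycle (with_proj G) Z \<and> card Z \<le> r \<and> stems_from (with_proj G) W Z)}"

lemma local_subgroup_eq:
  "local_subgroup r (with_proj G) x = generate (fundamental_group (with_proj G) x) (G.cls x ` generators)"
  unfolding local_subgroup_def generators_def by (rule arg_cong[where f = "generate _"]) blast

lemma x: "x \<in> pverts G" using p_vert y py by blast

lemma closed_map: "closed W \<Longrightarrow> closed_walk (with_proj G) x (map p W)"
  using walk_map[of W] py by (auto simp: closed_walk_with_proj vwalk_with_proj_iff hd_map last_map)

lemma induced_map_class:
  assumes "closed W"
  shows "induced_map (with_proj G) x p (C.cls y W) = G.cls x (map p W)"
proof -
  have "G.cls x (map p W') = G.cls x (map p W)" if "W' \<in> C.cls y W" for W'
  proof -
    have W': "closed W'" "red W' = red W" using that by (auto simp: C.homotopy_class_eq)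
    then have "red (map p W') = red (map p W)"
      using walk_red assms by (metis closed_walk_with_proj)
    then show ?thesis using G.homotopy_class_cong[OF closed_map[OF W'(1)]] by simp
  qed
  then have "induced_map (with_proj G) x p (C.cls y W) = (\<Union>W'\<in>C.cls y W. G.cls x (map p W))"
    unfolding induced_map_def by (intro SUP_cong refl)
  moreover have "W \<in> C.cls y W" using assms by (simp add: C.homotopy_class_eq)
  ultimately show ?thesis by auto
qed

text \<open>This is surjectivity of the given isomorphism onto the local subgroup.\<close>

lemma local_subgroup_iff:
  "\<alpha> \<in> local_subgroup r (with_proj G) x \<longleftrightarrow> (\<exists>W. closed W \<and> \<alpha> = G.cls x (map p W))"
proof -
  have "bij_betw (induced_map (with_proj G) x p) (carrier (fundamental_group (with_proj C) y))
      (local_subgroup r (with_proj G) x)"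
    using iso by (simp add: iso_def)
  then have "local_subgroup r (with_proj G) x =
      induced_map (with_proj G) x p ` {C.cls y W | W. closed W}"
    by (simp add: bij_betw_imp_surj_on[symmetric] fundamental_group_def)
  also have "\<dots> = {G.cls x (map p W) | W. closed W}"
    using induced_map_class by (auto simp: image_iff)
  finally show ?thesis by blast
qed

text \<open>The walk is homotopic to the projection of a closed walk at \<open>y\<close>, and
  homotopic walks have lifts with the same end.\<close>

lemma local_subgroup_lift_closed:
  assumes "closed_walk (with_proj G) x W" "G.cls x W \<in> local_subgroup r (with_proj G) x"
    and "walk C L" "hd L = y" "map p L = W"
  shows "last L = y"
proof -
  obtain V where V: "closed V" "G.cls x W = G.cls x (map p V)"
    using assms(2) local_subgroup_iff by blast
  then have "red (map p L) = red (map p V)"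
    using G.homotopy_class_cong[OF assms(1)] assms(5) by simp
  then have "last L = last V"
    using lift_red_cong(2)[of L V] assms V by (simp add: closed_walk_with_proj)
  then show ?thesis using V by (simp add: closed_walk_with_proj)
qed

lemma generators_lift_closed_base:
  assumes "W \<in> generators" "walk C L" "hd L = y" "map p L = W"
  shows "last L = y"
proof (rule local_subgroup_lift_closed)
  show "G.cls x W \<in> local_subgroup r (with_proj G) x"
    unfolding local_subgroup_eq using assms(1) by (auto intro: generate.incl)
qed (use assms in \<open>auto simp: generators_def\<close>)

text \<open>The factors are lifted one after the other; by uniqueness of lifts their join is
  \<open>L\<close>.\<close>

lemma lift_join:
  assumes "walk C L" "map p L = vwalk_join V W" "V \<noteq> []" "W \<noteq> []"
    "walk G V" "walk G W" "last V = hd W"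
  obtains L1 L2 where "L = vwalk_join L1 L2" "walk C L1" "walk C L2" "last L1 = hd L2"
    "map p L1 = V" "map p L2 = W" "hd L = hd L1"
proof -
  have "hd L \<in> pverts C" "p (hd L) = hd V"
    using walk_hd_last[OF assms(1)] assms(2,3) by (simp_all add: vwalk_join_def)
  then obtain L1 where L1: "walk C L1" "hd L1 = hd L" "map p L1 = V"
    using lift_exists[OF assms(5)] by metis
  have ne: "L1 \<noteq> []" using L1 walk_nonempty by blast
  have "last L1 \<in> pverts C" "p (last L1) = hd W"
    using walk_hd_last[OF L1(1)] L1(3) assms(7) by simp_all
  then obtain L2 where L2: "walk C L2" "hd L2 = last L1" "map p L2 = W"
    using lift_exists[OF assms(6)] by metis
  have "vwalk_join L1 L2 = L"
    using walk_join[OF L1(1) L2(1)] L1 L2 assms(1,2) by (intro lift_unique) (auto simp: map_join)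
  then show ?thesis using that L1 L2 by metis
qed

text \<open>Conjugating by a path from \<open>y\<close> to another point of the fibre turns generators into
  generators.\<close>

lemma generators_lift_closed:
  assumes "W \<in> generators" "walk C L" "p (hd L) = x" "map p L = W"
  shows "last L = hd L"
proof -
  have "hd L \<in> pverts C" using assms(2) by (auto simp: vwalk_with_proj_iff)
  then obtain P where P: "walk C P" "hd P = y" "last P = hd L"
    using C_connected y by blast
  have neP: "P \<noteq> []" using P walk_nonempty by blast
  define P' where "P' = map p P"
  have P': "closed_walk (with_proj G) x P'" "walk G P'" "hd P' = x" "last P' = x" "P' \<noteq> []"
    using P walk_map[OF P(1)] neP assms(3) py by (auto simp: P'_def closed_walk_with_proj hd_map last_map)
  obtain Z W\<^sub>0 Q where W: "closed_walk (with_proj G) x W" "graph_cycle (with_proj G) Z" "card Z \<le> r"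
    and W0: "walk G W\<^sub>0" and Q: "closed_walk (with_proj G) (last W\<^sub>0) Q"
    "distinct (walk_edges Q)" "set (walk_edges Q) = Z"
    and WQ: "W = vwalk_join (vwalk_join W\<^sub>0 Q) (rev W\<^sub>0)"
    using assms(1) by (auto simp: generators_def stems_from_def)
  have ne: "W\<^sub>0 \<noteq> []" "Q \<noteq> []" "W \<noteq> []"
    using W0 Q W walk_nonempty by (auto simp: closed_walk_with_proj)
  have wW: "walk G W" "hd W = x" "last W = x" using W(1) by (auto simp: closed_walk_with_proj)
  have hdW0: "hd W\<^sub>0 = x"
    using wW(2) ne unfolding WQ by (simp add: vwalk_join_def)
  \<comment> \<open>\<open>W'\<close> stems from the same cycle \<open>Z\<close>, with access walk
    \<open>P'\<close> followed by \<open>W\<^sub>0\<close>.\<close>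
  define W' where "W' = vwalk_join P' (vwalk_join W (rev P'))"
  have rP: "walk G (rev P')" "hd (rev P') = x" "last (rev P') = x"
    using P' G.walk_rev by (auto simp: hd_rev last_rev)
  have j1: "walk G (vwalk_join W (rev P'))" "hd (vwalk_join W (rev P')) = x" "last (vwalk_join W (rev P')) = x"
    using walk_join[OF wW(1) rP(1)] wW rP by auto
  have cW': "closed_walk (with_proj G) x W'"
    using walk_join[OF P'(2) j1(1)] P' j1 by (simp add: W'_def closed_walk_with_proj)
  have "stems_from (with_proj G) W' Z"
    unfolding stems_from_def
  proof (intro exI conjI)
    show "walk G (vwalk_join P' W\<^sub>0)" using walk_join[OF P'(2) W0] P' hdW0 by simp
    show "closed_walk (with_proj G) (last (vwalk_join P' W\<^sub>0)) Q"
      using walk_join[OF P'(2) W0] P' hdW0 Q by simp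
    show "W' = vwalk_join (vwalk_join (vwalk_join P' W\<^sub>0) Q) (rev (vwalk_join P' W\<^sub>0))"
      unfolding W'_def WQ using ne P' hdW0 by (simp add: rev_join vwalk_join_assoc)
  qed (use Q in auto)
  then have gen: "W' \<in> generators" using cW' W by (auto simp: generators_def)
  have "last L \<in> pverts C" "p (last L) = x"
    using walk_hd_last[OF assms(2)] assms(4) wW by simp_all
  then obtain R where R: "walk C R" "hd R = last L" "map p R = rev P'"
    using lift_exists[OF rP(1)] rP(2) by metis
  have neR: "R \<noteq> []" using R walk_nonempty by blast
  have j2: "walk C (vwalk_join L R)" "hd (vwalk_join L R) = hd L" "last (vwalk_join L R) = last R"
    using walk_join[OF assms(2) R(1)] R by auto
  have "last (vwalk_join P (vwalk_join L R)) = y"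
    using walk_join[OF P(1) j2(1)] P j2 R assms
    by (intro generators_lift_closed_base[OF gen]) (auto simp: W'_def map_join P'_def)
  then have "last R = y" using walk_join[OF P(1) j2(1)] P j2 by simp
  \<comment> \<open>Both are lifts of \<open>P'\<close> starting at \<open>y\<close>.\<close>
  then have "rev R = P"
    using C.walk_rev[OF R(1)] P R(3) neR by (intro lift_unique) (auto simp: hd_rev rev_map[symmetric] P'_def)
  then show ?thesis using P(3) R(2) neR by (metis last_rev)
qed

text \<open>The lift is closed, so its last piece, reversed, starts at \<open>y\<close> and is the
  same lift of the access walk as the first piece. Hence the middle piece is closed already in the
  covering graph.\<close>

lemma generator_lift:
  assumes "W \<in> generators" "walk C L" "hd L = y" "map p L = W"
  obtains L\<^sub>0 Q where "walk C L\<^sub>0" "hd L\<^sub>0 = y" "closed_walk (with_proj C) (last L\<^sub>0) Q" "length Q \<le> Suc r"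
    "L = vwalk_join (vwalk_join L\<^sub>0 Q) (rev L\<^sub>0)"
proof -
  obtain Z W\<^sub>0 Q where W: "closed_walk (with_proj G) x W" "card Z \<le> r"
    and W0: "walk G W\<^sub>0" and Q: "closed_walk (with_proj G) (last W\<^sub>0) Q"
    "distinct (walk_edges Q)" "set (walk_edges Q) = Z"
    and WQ: "W = vwalk_join (vwalk_join W\<^sub>0 Q) (rev W\<^sub>0)"
    using assms(1) by (auto simp: generators_def stems_from_def)
  have ne: "W\<^sub>0 \<noteq> []" "Q \<noteq> []"
    using W0 Q walk_nonempty by (auto simp: closed_walk_with_proj)
  have wQ: "walk G Q" "hd Q = last W\<^sub>0" "last Q = last W\<^sub>0" using Q by (auto simp: closed_walk_with_proj)
  note j = walk_join[OF W0 wQ(1) wQ(2)[symmetric]]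
  have ne': "vwalk_join W\<^sub>0 Q \<noteq> []" using ne by (simp add: vwalk_join_def)
  obtain L1 L2 where L12: "L = vwalk_join L1 L2" "walk C L1" "walk C L2" "last L1 = hd L2"
    "map p L1 = vwalk_join W\<^sub>0 Q" "map p L2 = rev W\<^sub>0" "hd L = hd L1"
    by (rule lift_join[OF assms(2) assms(4)[unfolded WQ] ne' _ j(1) G.walk_rev[OF W0]])
      (use ne j wQ in \<open>auto simp: hd_rev\<close>)
  obtain L\<^sub>0 Q' where L0: "L1 = vwalk_join L\<^sub>0 Q'" "walk C L\<^sub>0" "walk C Q'" "last L\<^sub>0 = hd Q'"
    "map p L\<^sub>0 = W\<^sub>0" "map p Q' = Q" "hd L1 = hd L\<^sub>0"
    by (rule lift_join[OF L12(2) L12(5) ne W0 wQ(1) wQ(2)[symmetric]]) auto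
  have neL2: "L2 \<noteq> []" using L12(3) walk_nonempty by blast
  have "last L = y" by (rule generators_lift_closed_base[OF assms])
  then have "last L2 = y" using walk_join(3)[OF L12(2-4)] L12(1) by simp
  then have rev: "rev L2 = L\<^sub>0"
    using C.walk_rev[OF L12(3)] L0 L12 neL2 assms(3)
    by (intro lift_unique) (auto simp: hd_rev rev_map[symmetric])
  then have "hd L2 = last L\<^sub>0" using neL2 by (metis last_rev)
  then have "last Q' = last L\<^sub>0" using walk_join(3)[OF L0(2-4)] L0(1) L12(4) by simp
  then have "closed_walk (with_proj C) (last L\<^sub>0) Q'"
    using L0 by (simp add: closed_walk_with_proj)
  moreover have "length Q' = length Q" using L0(6) by auto
  \<comment> \<open>A closed walk with at most \<open>r\<close> edges has at most
    \<open>r + 1\<close> entries as a vertex list.\<close>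
  then have "length Q' \<le> Suc r"
    using vwalk_edges_length[of Q] distinct_card[OF Q(2)] Q(3) W(2) by auto
  moreover have "L = vwalk_join (vwalk_join L\<^sub>0 Q') (rev L\<^sub>0)"
    using L12(1) L0(1) rev by auto
  ultimately show ?thesis using that L0 L12 assms by metis
qed

text \<open>The class of the projected walk is a product of generators and their inverses. Lifting
  this product gives a closed walk with \<Phi>; it has the same reduction as \<open>W\<close>, so
  \<open>red\<close> transfers \<Phi>.\<close>

lemma closed_walk_induct:
  assumes "closed W"
    and "\<Phi> [y]"
    and join: "\<And>V W. closed V \<Longrightarrow> closed W \<Longrightarrow> \<Phi> V \<Longrightarrow> \<Phi> W \<Longrightarrow> \<Phi> (vwalk_join V W)"
    and rev: "\<And>W. closed W \<Longrightarrow> \<Phi> W \<Longrightarrow> \<Phi> (rev W)"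
    and red: "\<And>V W. closed V \<Longrightarrow> closed W \<Longrightarrow> red V = red W \<Longrightarrow> \<Phi> V \<Longrightarrow> \<Phi> W"
    and gen: "\<And>W. closed W \<Longrightarrow> map p W \<in> generators \<Longrightarrow> \<Phi> W"
  shows "\<Phi> W"
proof -
  let ?F = "fundamental_group (with_proj G) x"
  have gen': "\<exists>W. closed W \<and> map p W = V \<and> \<Phi> W" if "V \<in> generators" for V
  proof -
    have V: "walk G V" "hd V = x" using that by (auto simp: generators_def closed_walk_with_proj)
    obtain L where L: "walk C L" "hd L = y" "map p L = V"
      using lift_exists[OF V(1), of y] V(2) y py by auto
    then have "closed L"
      using generators_lift_closed_base[OF that L] by (simp add: closed_walk_with_proj)
    then show ?thesis using gen L that by blast
  qed
  have "\<exists>W. closed W \<and> \<alpha> = G.cls x (map p W) \<and> \<Phi> W" if "\<alpha> \<in> generate ?F (G.cls x ` generators)" for \<alpha>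
    using that
  proof induct
    case one
    have "closed [y]" using y by (simp add: closed_walk_with_proj vwalk_with_proj_iff)
    then show ?case using assms(2) py by (intro exI[of _ "[y]"]) (simp add: fundamental_group_def)
  next
    case (incl h)
    then obtain V where "V \<in> generators" "h = G.cls x V" by blast
    then show ?case using gen' by blast
  next
    case (inv h)
    then obtain V where V: "V \<in> generators" "h = G.cls x V" by blast
    then obtain W where W: "closed W" "map p W = V" "\<Phi> W" using gen' by blast
    have "closed (rev W)" using W(1) by (rule C.closed_walk_rev)
    moreover have "inv\<^bsub>?F\<^esub> h = G.cls x (map p (rev W))"
      using G.inv_homotopy_class[OF closed_map[OF W(1)] x] W(2) V(2) by (simp flip: rev_map)
    ultimately show ?case using rev[OF W(1,3)] by blast
  next
    case (eng h1 h2)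
    then obtain V W where "closed V" "closed W" "h1 = G.cls x (map p V)" "h2 = G.cls x (map p W)" "\<Phi> V" "\<Phi> W"
      by blast
    then show ?case
      using G.mult_homotopy_class[OF closed_map closed_map, of V W] C.closed_walk_join join
      by (intro exI[of _ "vwalk_join V W"]) (simp add: map_join)
  qed
  moreover have "G.cls x (map p W) \<in> local_subgroup r (with_proj G) x"
    using local_subgroup_iff assms(1) by blast
  ultimately obtain V where V: "closed V" "G.cls x (map p W) = G.cls x (map p V)" "\<Phi> V"
    unfolding local_subgroup_eq by blast
  then have "red (map p W) = red (map p V)"
    using G.homotopy_class_cong[OF closed_map[OF assms(1)]] by simp
  then have "red W = red V"
    using lift_red_cong(1)[of W V] assms(1) V(1) by (simp add: closed_walk_with_proj)
  then show ?thesis using red[OF V(1) assms(1) _ V(3)] by simp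
qed

text \<open>Normality of the local subgroup: closedness is preserved when the projection of a closed
  walk at \<open>y\<close> is lifted from any other point of the fibre.\<close>

lemma lift_closed_walk:
  assumes "closed W" "walk C L" "map p L = map p W"
  shows "last L = hd L"
proof -
  have "\<forall>L. walk C L \<longrightarrow> map p L = map p W \<longrightarrow> last L = hd L"
    using assms(1)
  proof (rule closed_walk_induct[where \<Phi> = "\<lambda>W. \<forall>L. walk C L \<longrightarrow> map p L = map p W \<longrightarrow> last L = hd L"]; intro allI impI)
    fix L assume L: "walk C L" "map p L = map p [y]"
    then have "length L = 1" using map_eq_imp_length_eq by fastforce
    then show "last L = hd L" by (cases L) auto
  next
    fix V W L
    assume V: "closed V" "\<forall>L. walk C L \<longrightarrow> map p L = map p V \<longrightarrow> last L = hd L"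
      and W: "closed W" "\<forall>L. walk C L \<longrightarrow> map p L = map p W \<longrightarrow> last L = hd L"
      and L: "walk C L" "map p L = map p (vwalk_join V W)"
    have w: "walk G (map p V)" "walk G (map p W)" "last (map p V) = hd (map p W)"
      using closed_map[OF V(1)] closed_map[OF W(1)] by (auto simp: closed_walk_with_proj)
    obtain L1 L2 where L12: "L = vwalk_join L1 L2" "walk C L1" "walk C L2" "last L1 = hd L2"
      "map p L1 = map p V" "map p L2 = map p W" "hd L = hd L1"
      by (rule lift_join[OF L(1) L(2)[unfolded map_join] _ _ w]) (use w walk_nonempty in auto)
    then show "last L = hd L" using V(2) W(2) walk_join(3)[OF L12(2-4)] by metis
  next
    fix W L
    assume W: "closed W" "\<forall>L. walk C L \<longrightarrow> map p L = map p W \<longrightarrow> last L = hd L"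
      and L: "walk C L" "map p L = map p (rev W)"
    have "walk C (rev L)" "map p (rev L) = map p W"
      using C.walk_rev[OF L(1)] L(2) by (simp_all flip: rev_map)
    then have "last (rev L) = hd (rev L)" using W(2) by blast
    then show "last L = hd L" using walk_nonempty[OF L(1)] by (simp add: hd_rev last_rev)
  next
    fix V W L
    assume V: "closed V" "\<forall>L. walk C L \<longrightarrow> map p L = map p V \<longrightarrow> last L = hd L"
      and W: "closed W" "red V = red W"
      and L: "walk C L" "map p L = map p W"
    have w: "walk C V" "walk C W" "hd V = y" "hd W = y" using V W by (auto simp: closed_walk_with_proj)
    have h: "hd L \<in> pverts C" "p (hd L) = hd (map p V)"
      using walk_hd_last[OF L(1)] walk_hd_last[OF w(1)] walk_hd_last[OF w(2)] w L(2) by auto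
    obtain K where K: "walk C K" "hd K = hd L" "map p K = map p V"
      by (rule lift_exists[OF walk_map[OF w(1)] h])
    have "last K = hd K" using V(2) K by blast
    moreover have "red (map p K) = red (map p L)"
      using walk_red[OF w(1)] walk_red[OF w(2)] W(2) K(3) L(2) by metis
    then have "last K = last L" using lift_red_cong(2)[OF K(1) L(1) K(2)] by simp
    ultimately show "last L = hd L" using K by simp
  next
    fix W L
    assume W: "closed W" "map p W \<in> generators" and L: "walk C L" "map p L = map p W"
    have "p (hd L) = x"
      using walk_hd_last[OF L(1)] closed_map[OF W(1)] L(2) by (simp add: closed_walk_with_proj)
    then show "last L = hd L" using generators_lift_closed[OF W(2) L(1)] L(2) by simp
  qed
  then show ?thesis using assms by blast
qed

text \<open>The converse direction, from another point of the fibre back to \<open>y\<close>, by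
  conjugating with a walk from \<open>y\<close> to that point.\<close>

lemma lift_closed_walk_fibre:
  assumes "walk C W" "p (hd W) = x" "last W = hd W" "walk C L" "hd L = y" "map p L = map p W"
  shows "last L = y"
proof -
  obtain P where P: "walk C P" "hd P = y" "last P = hd W"
    using C_connected y walk_hd_last[OF assms(1)] by blast
  note neP = walk_nonempty[OF P(1)] and neW = walk_nonempty[OF assms(1)] and neL = walk_nonempty[OF assms(4)]
  have h: "y \<in> pverts C" "p y = hd (map p (rev P))"
    using y py P assms(2) neP by (auto simp: hd_map hd_rev)
  obtain R where R: "walk C R" "hd R = y" "map p R = map p (rev P)"
    by (rule lift_exists[OF walk_map[OF C.walk_rev[OF P(1)]] h])
  note neR = walk_nonempty[OF R(1)]
  have rR: "walk C (rev R)" "hd (rev R) = last R" "last (rev R) = y" "map p (rev R) = map p P"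
    using R neR C.walk_rev by (auto simp: hd_rev last_rev rev_map[symmetric])
  have l: "last L \<in> pverts C" "p (last L) = hd (map p (rev P))"
    using walk_hd_last[OF assms(4)] walk_hd_last[OF assms(1)] assms P neP
    by (auto simp: hd_map hd_rev)
  obtain R' where R': "walk C R'" "hd R' = last L" "map p R' = map p (rev P)"
    by (rule lift_exists[OF walk_map[OF C.walk_rev[OF P(1)]] l])
  note neR' = walk_nonempty[OF R'(1)]
  have rP: "walk C (rev P)" "hd (rev P) = hd W" "last (rev P) = y"
    using P neP C.walk_rev by (auto simp: hd_rev last_rev)
  note j1 = walk_join[OF assms(1) rP(1)]
  have j1': "walk C (vwalk_join W (rev P))" "hd (vwalk_join W (rev P)) = hd W" "last (vwalk_join W (rev P)) = y"
    using j1 assms(3) rP by auto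
  note j2 = walk_join[OF P(1) j1'(1)]
  have closed: "closed (vwalk_join P (vwalk_join W (rev P)))"
    using j2 P j1' by (simp add: closed_walk_with_proj)
  note k1 = walk_join[OF assms(4) R'(1) R'(2)[symmetric]]
  have k2: "walk C (vwalk_join (rev R) (vwalk_join L R'))" "hd (vwalk_join (rev R) (vwalk_join L R')) = last R"
    "last (vwalk_join (rev R) (vwalk_join L R')) = last R'"
    using walk_join[OF rR(1) k1(1)] rR k1 assms(5) by auto
  \<comment> \<open>This walk has the same projection as the closed walk at \<open>y\<close> formed
    by \<open>P\<close>, \<open>W\<close> and the reversed \<open>P\<close>. So \<open>rev R\<close>
    and \<open>rev R'\<close> are lifts of \<open>P\<close> from the same vertex.\<close>
  have "last (vwalk_join (rev R) (vwalk_join L R')) = hd (vwalk_join (rev R) (vwalk_join L R'))"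
    by (rule lift_closed_walk[OF closed k2(1)]) (simp add: map_join rR assms(6) R'(3))
  then have "last R' = last R" using k2 by simp
  then have "rev R' = rev R"
    using C.walk_rev[OF R'(1)] C.walk_rev[OF R(1)] R(3) R'(3) neR neR'
    by (intro lift_unique) (auto simp: hd_rev rev_map[symmetric])
  then show ?thesis using R R' by simp
qed

text \<open>The end of a walk from \<open>y\<close> is sent to the end of the walk from
  \<open>y'\<close> with the same projection. Well-definedness uses \<open>lift_closed_walk\<close>,
  injectivity uses \<open>lift_closed_walk_fibre\<close>.\<close>

lemma deck_transformation_base:
  assumes "y' \<in> pverts C" "p y' = x"
  obtains g where "bij_betw g (pverts C) (pverts C)"
    "\<And>u v. u \<in> pverts C \<Longrightarrow> v \<in> pverts C \<Longrightarrow> (u, v) \<in> parcs C \<longleftrightarrow> (g u, g v) \<in> parcs C"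
    "\<And>V W. walk C V \<Longrightarrow> walk C W \<Longrightarrow> hd V = y \<Longrightarrow> hd W = y' \<Longrightarrow> map p V = map p W \<Longrightarrow> g (last V) = last W"
proof -
  \<comment> \<open>the graph of the deck transformation\<close>
  define Rel where "Rel u v \<longleftrightarrow> (\<exists>V W. walk C V \<and> walk C W \<and> hd V = y \<and> hd W = y' \<and>
    map p V = map p W \<and> last V = u \<and> last W = v)" for u v
  have total: "\<exists>v. Rel u v" if u: "u \<in> pverts C" for u
  proof -
    obtain V where V: "walk C V" "hd V = y" "last V = u" using C_connected[OF y u] by blast
    have "p y' = hd (map p V)" using walk_hd_last(3)[OF V(1)] V py assms by simp
    then obtain W where "walk C W" "hd W = y'" "map p W = map p V"
      using lift_exists[OF walk_map[OF V(1)] assms(1)] by blast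
    then show ?thesis using V unfolding Rel_def by metis
  qed
  have surj: "\<exists>u. Rel u v" if v: "v \<in> pverts C" for v
  proof -
    obtain W where W: "walk C W" "hd W = y'" "last W = v" using C_connected[OF assms(1) v] by blast
    have "p y = hd (map p W)" using walk_hd_last(3)[OF W(1)] W py assms by simp
    then obtain V where "walk C V" "hd V = y" "map p V = map p W"
      using lift_exists[OF walk_map[OF W(1)] y] by blast
    then show ?thesis using W unfolding Rel_def by metis
  qed
  \<comment> \<open>\<open>V1\<close> followed by the reversed \<open>V2\<close> is closed, so its
    lift along \<open>W1\<close> closes at \<open>z'\<close>. The second part of that lift,
    reversed, is then \<open>W2\<close>.\<close>
  have transport: "last W1 = last W2"
    if V: "walk C V1" "walk C V2" "hd V1 = z" "hd V2 = z" "last V1 = last V2"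
      and W: "walk C W1" "walk C W2" "hd W1 = z'" "hd W2 = z'"
      and p: "map p V1 = map p W1" "map p V2 = map p W2"
      and closed: "\<And>W L. walk C W \<Longrightarrow> hd W = z \<Longrightarrow> last W = z \<Longrightarrow> walk C L \<Longrightarrow> hd L = z' \<Longrightarrow>
        map p L = map p W \<Longrightarrow> last L = z'"
    for V1 V2 W1 W2 z z'
  proof -
    note ne = walk_nonempty[OF V(1)] walk_nonempty[OF V(2)] walk_nonempty[OF W(1)] walk_nonempty[OF W(2)]
    have rV: "walk C (rev V2)" "hd (rev V2) = last V1" "last (rev V2) = z"
      using V ne C.walk_rev by (auto simp: hd_rev last_rev)
    note jV = walk_join[OF V(1) rV(1) rV(2)[symmetric]]
    have "last W1 \<in> pverts C" "p (last W1) = hd (map p (rev V2))"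
      using walk_hd_last[OF W(1)] walk_hd_last[OF V(1)] p(1) rV(2) walk_hd_last(3)[OF rV(1)] by auto
    then obtain T where T: "walk C T" "hd T = last W1" "map p T = map p (rev V2)"
      using lift_exists[OF walk_map[OF rV(1)]] by blast
    note jW = walk_join[OF W(1) T(1) T(2)[symmetric]]
    have "last T = z'"
      using closed[OF jV(1) _ _ jW(1)] jV jW V W rV p T by (simp add: map_join)
    then have "rev T = W2"
      using C.walk_rev[OF T(1)] W T(3) p(2) walk_nonempty[OF T(1)]
      by (intro lift_unique) (auto simp: hd_rev rev_map[symmetric])
    then show ?thesis using T(2) walk_nonempty[OF T(1)] by (metis last_rev)
  qed
  have func: "v = v'" if Rel: "Rel u v" "Rel u v'" for u v v'
  proof -
    obtain V W V' W' where *: "walk C V" "walk C W" "hd V = y" "hd W = y'" "map p V = map p W" "last V = u" "last W = v"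
      "walk C V'" "walk C W'" "hd V' = y" "hd W' = y'" "map p V' = map p W'" "last V' = u" "last W' = v'"
      using Rel unfolding Rel_def by blast
    show ?thesis
    proof (rule transport[of V V' y W W' y', THEN trans[OF *(7)[symmetric], THEN trans, OF _ *(14)]])
      show "last L = y'" if "walk C W" "hd W = y" "last W = y" "walk C L" "hd L = y'" "map p L = map p W" for W L
        using lift_closed_walk[of W L] that by (simp add: closed_walk_with_proj)
    qed (use * in auto)
  qed
  have inj: "u = u'" if Rel: "Rel u v" "Rel u' v" for u u' v
  proof -
    obtain V W V' W' where *: "walk C V" "walk C W" "hd V = y" "hd W = y'" "map p V = map p W" "last V = u" "last W = v"
      "walk C V'" "walk C W'" "hd V' = y" "hd W' = y'" "map p V' = map p W'" "last V' = u'" "last W' = v"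
      using Rel unfolding Rel_def by blast
    show ?thesis
    proof (rule transport[of W W' y' V V' y, THEN trans[OF *(6)[symmetric], THEN trans, OF _ *(13)]])
      show "last L = y" if "walk C W" "hd W = y'" "last W = y'" "walk C L" "hd L = y" "map p L = map p W" for W L
        using lift_closed_walk_fibre[of W L] that assms by simp
    qed (use * in auto)
  qed
  have dom: "u \<in> pverts C \<and> v \<in> pverts C \<and> p u = p v" if Rel: "Rel u v" for u v
  proof -
    obtain V W where VW: "walk C V" "walk C W" "map p V = map p W" "last V = u" "last W = v"
      using Rel unfolding Rel_def by blast
    then show ?thesis using walk_hd_last[OF VW(1)] walk_hd_last[OF VW(2)] by metis
  qed
  have step: "\<exists>v'. (u', v') \<in> parcs C \<and> Rel v v'" if Rel: "Rel u u'" and uv: "(u, v) \<in> parcs C" for u u' v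
  proof -
    obtain V W where VW: "walk C V" "walk C W" "hd V = y" "hd W = y'" "map p V = map p W" "last V = u" "last W = u'"
      using Rel unfolding Rel_def by blast
    obtain v' where v': "(u', v') \<in> parcs C" "p v' = p v"
      using p_locally_surj[of u' "p v"] dom[OF Rel] p_arc[OF uv] by metis
    have "walk C [u, v]" "walk C [u', v']" using uv v' arc_verts by (auto simp: vwalk_with_proj_iff)
    then have "walk C (vwalk_join V [u, v])" "walk C (vwalk_join W [u', v'])"
      using walk_join(1) VW by (metis list.sel(1))+
    moreover have "hd (vwalk_join V [u, v]) = y" "hd (vwalk_join W [u', v']) = y'"
      "last (vwalk_join V [u, v]) = v" "last (vwalk_join W [u', v']) = v'"
      using walk_nonempty[OF VW(1)] walk_nonempty[OF VW(2)] VW by (auto simp: vwalk_join_def)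
    moreover have "map p (vwalk_join V [u, v]) = map p (vwalk_join W [u', v'])"
      using VW v' by (simp add: vwalk_join_def)
    ultimately have "Rel v v'" unfolding Rel_def by blast
    then show ?thesis using v' by blast
  qed
  have step': "\<exists>v. (u, v) \<in> parcs C \<and> Rel v v'" if Rel: "Rel u u'" and uv: "(u', v') \<in> parcs C" for u u' v'
  proof -
    obtain v where v: "(u, v) \<in> parcs C" "p v = p v'"
      using p_locally_surj[of u "p v'"] dom[OF Rel] p_arc[OF uv] by metis
    obtain v'' where v'': "(u', v'') \<in> parcs C" "Rel v v''" using step[OF Rel v(1)] by blast
    then have "v'' = v'" using p_locally_inj[OF v''(1) uv] dom v(2) by metis
    then show ?thesis using v v'' by blast
  qed
  define g where "g u = (THE v. Rel u v)" for u
  have g: "Rel u (g u)" if u: "u \<in> pverts C" for u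
    unfolding g_def using total[OF u] func by (metis theI)
  have gI: "g u = v" if "Rel u v" for u v
    using func[OF that] g dom[OF that] by blast
  show ?thesis
  proof (rule that)
    show "bij_betw g (pverts C) (pverts C)"
    proof (rule bij_betwI')
      show "g u = g v \<longleftrightarrow> u = v" if "u \<in> pverts C" "v \<in> pverts C" for u v
        using g[OF that(1)] g[OF that(2)] inj by metis
      show "g u \<in> pverts C" if "u \<in> pverts C" for u using dom[OF g[OF that]] by blast
      show "\<exists>u\<in>pverts C. v = g u" if "v \<in> pverts C" for v
        using surj[OF that] gI dom by metis
    qed
    show "(u, v) \<in> parcs C \<longleftrightarrow> (g u, g v) \<in> parcs C" if u: "u \<in> pverts C" "v \<in> pverts C" for u v
    proof
      assume "(u, v) \<in> parcs C"
      then show "(g u, g v) \<in> parcs C" using step[OF g[OF u(1)]] gI by blast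
    next
      assume "(g u, g v) \<in> parcs C"
      then obtain v' where "(u, v') \<in> parcs C" "Rel v' (g v)" using step'[OF g[OF u(1)]] by blast
      then show "(u, v) \<in> parcs C" using inj[OF _ g[OF u(2)]] by blast
    qed
    show "g (last V) = last W" if "walk C V" "walk C W" "hd V = y" "hd W = y'" "map p V = map p W" for V W
      by (rule gI) (use that in \<open>auto simp: Rel_def\<close>)
  qed
qed

text \<open>A walk from \<open>y\<close> to \<open>u\<close> has a lift with the same projection
  ending at \<open>v\<close>; the map carrying \<open>y\<close> to the start of that lift carries
  \<open>u\<close> to \<open>v\<close>.\<close>

lemma deck_transformation:
  assumes "u \<in> pverts C" "v \<in> pverts C" "p u = p v"
  obtains g where "bij g" "g ` pverts C = pverts C" "\<And>a b. (g a, g b) \<in> parcs C \<longleftrightarrow> (a, b) \<in> parcs C"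
    "g u = v"
proof -
  obtain P where P: "walk C P" "hd P = y" "last P = u" using C_connected[OF y assms(1)] by blast
  note neP = walk_nonempty[OF P(1)]
  have "p v = hd (map p (rev P))" using P neP assms(3) by (simp add: hd_map hd_rev)
  then obtain R where R: "walk C R" "hd R = v" "map p R = map p (rev P)"
    using lift_exists[OF walk_map[OF C.walk_rev[OF P(1)]] assms(2)] by blast
  note neR = walk_nonempty[OF R(1)]
  have rR: "walk C (rev R)" "hd (rev R) = last R" "last (rev R) = v" "map p (rev R) = map p P"
    using R neR C.walk_rev by (auto simp: hd_rev last_rev rev_map[symmetric])
  have "last R \<in> pverts C" "p (last R) = x"
    using walk_hd_last[OF R(1)] walk_hd_last(3)[OF P(1)] walk_hd_last(3)[OF rR(1)] rR P py by auto
  then obtain g where g: "bij_betw g (pverts C) (pverts C)"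
    "\<And>u v. u \<in> pverts C \<Longrightarrow> v \<in> pverts C \<Longrightarrow> (u, v) \<in> parcs C \<longleftrightarrow> (g u, g v) \<in> parcs C"
    "\<And>V W. walk C V \<Longrightarrow> walk C W \<Longrightarrow> hd V = y \<Longrightarrow> hd W = last R \<Longrightarrow> map p V = map p W \<Longrightarrow> g (last V) = last W"
    using deck_transformation_base by blast
  have gu: "g u = v" using g(3)[OF P(1) rR(1)] P rR by simp
  \<comment> \<open>The identity outside the vertex set makes the map a bijection of the whole
    type.\<close>
  define h where "h a = (if a \<in> pverts C then g a else a)" for a
  have img: "h ` pverts C = pverts C" using g(1) by (auto simp: h_def bij_betw_def)
  have "bij_betw h (pverts C) (pverts C)" using g(1) by (auto simp: h_def cong: bij_betw_cong)
  moreover have "bij_betw h (- pverts C) (- pverts C)" by (auto simp: h_def cong: bij_betw_cong intro: bij_betwI')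
  ultimately have "bij h" using bij_betw_combine[of h "pverts C" "pverts C" "- pverts C" "- pverts C"] by simp
  moreover have "(h a, h b) \<in> parcs C \<longleftrightarrow> (a, b) \<in> parcs C" for a b
  proof (cases "a \<in> pverts C \<and> b \<in> pverts C")
    case False
    then have "\<not> (h a \<in> pverts C \<and> h b \<in> pverts C)"
      using img \<open>bij h\<close> by (metis bij_is_inj inj_image_mem_iff)
    then show ?thesis using False arc_verts by blast
  qed (simp add: h_def g(2)[symmetric])
  moreover have "h u = v" using gu assms by (simp add: h_def)
  ultimately show ?thesis using that img by blast
qed

end

section \<open>Invariance under automorphisms\<close>

text \<open>Bijectivity on the whole type lets images commute with intersections and differences
  without side conditions.\<close>

locale graph_automorphism =
  fixes C :: "'b pair_pre_digraph" and g :: "'b \<Rightarrow> 'b"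
  assumes bij: "bij g" and verts: "g ` pverts C = pverts C"
    and arcs: "(g a, g b) \<in> parcs C \<longleftrightarrow> (a, b) \<in> parcs C"
begin

lemma inj: "inj g" using bij by (rule bij_is_inj)

text \<open>Turns invariance in one direction into an equivalence throughout.\<close>

lemma inverse: "graph_automorphism C (inv_into UNIV g)"
proof
  have s: "g (inv_into UNIV g a) = a" for a using bij by (simp add: bij_is_surj surj_f_inv_f)
  show "bij (inv_into UNIV g)" using bij by (rule bij_imp_bij_inv)
  show "inv_into UNIV g ` pverts C = pverts C"
    using verts inj by (metis image_inv_f_f)
  show "(inv_into UNIV g a, inv_into UNIV g b) \<in> parcs C \<longleftrightarrow> (a, b) \<in> parcs C" for a b
    using arcs[of "inv_into UNIV g a" "inv_into UNIV g b"] by (simp add: s)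
qed

lemma image_inverse: "g ` inv_into UNIV g ` A = A" "inv_into UNIV g ` g ` A = A"
  using bij by (simp_all add: bij_is_surj image_f_inv_f inj)

lemma mem_image: "g v \<in> g ` A \<longleftrightarrow> v \<in> A"
  using inj by (rule inj_image_mem_iff)

lemma mem_verts: "g v \<in> pverts C \<longleftrightarrow> v \<in> pverts C"
  using mem_image verts by metis

lemma image_eq_iff: "g ` A = g ` B \<longleftrightarrow> A = B" and image_subset_iff: "g ` A \<subseteq> g ` B \<longleftrightarrow> A \<subseteq> B"
  and image_Int: "g ` (A \<inter> B) = g ` A \<inter> g ` B" and image_Diff: "g ` (A - B) = g ` A - g ` B"
  using inj by (simp_all add: inj_image_eq_iff inj_image_subset_iff image_Int image_set_diff)

abbreviation act :: "'b sep \<Rightarrow> 'b sep" where "act \<equiv> image (image g)"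

abbreviation oact :: "'b osep \<Rightarrow> 'b osep" where "oact \<equiv> map_prod (image g) (image g)"

lemma act_inverse: "act (image (image (inv_into UNIV g)) s) = s" "image (image (inv_into UNIV g)) (act s) = s"
proof -
  have "image (image f) (image (image h) s) = s" if "\<And>A. f ` h ` A = A" for f h :: "'b \<Rightarrow> 'b"
    using that by (simp add: image_comp comp_def image_image[of "image f"] del: image_image)
  then show "act (image (image (inv_into UNIV g)) s) = s" "image (image (inv_into UNIV g)) (act s) = s"
    using image_inverse by blast+
qed

lemma inj_act: "inj act"
  by (metis act_inverse(2) injI)

lemma inj_oact: "oact a = oact b \<longleftrightarrow> a = b"
  by (cases a; cases b) (simp add: image_eq_iff)

lemma unorient_oact: "unorient (oact a) = act (unorient a)"
  by (simp add: unorient_def)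

lemma separator_oact: "separator (oact a) = g ` separator a"
  by (simp add: separator_def image_Int)

lemma sep_order_act: "sep_order (act s) = sep_order s"
proof -
  have "\<Inter>(act s) = g ` \<Inter>s"
    using bij by (simp add: bij_image_INT[where A = s and B = id, simplified])
  then show ?thesis
    using inj_on_subset[OF inj] by (simp add: sep_order_def ecard_def card_image finite_image_iff)
qed

lemma nested_act: "nested (act s) (act t) \<longleftrightarrow> nested s t"
proof
  show "nested s t \<Longrightarrow> nested (act s) (act t)"
    unfolding nested_def osep_ge_def
    by (metis fst_map_prod snd_map_prod unorient_oact image_mono)
next
  interpret i: graph_automorphism C "inv_into UNIV g" by (rule inverse)
  have "nested s t" if "nested (act s) (act t)" for s t
  proof -
    obtain a b where ab: "unorient a = act s" "unorient b = act t" "osep_ge a b"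
      using \<open>nested (act s) (act t)\<close> by (auto simp: nested_def)
    then have "unorient (i.oact a) = s" "unorient (i.oact b) = t" "osep_ge (i.oact a) (i.oact b)"
      by (auto simp: i.unorient_oact act_inverse osep_ge_def)
    then show ?thesis unfolding nested_def by blast
  qed
  then show "nested (act s) (act t) \<Longrightarrow> nested s t" .
qed

lemma is_separation_image: "is_separation C (g ` A) (g ` B) \<longleftrightarrow> is_separation C A B"
  unfolding is_separation_def image_Un[symmetric] image_Diff[symmetric]
  by (simp add: ball_simps arcs) (metis image_eq_iff verts)

lemma conn_image: "conn C S u v \<Longrightarrow> conn C (g ` S) (g u) (g v)"
proof (induct rule: rtrancl_on_induct)
  case (step v w)
  then show ?case by (meson arcs imageI rtrancl_on_into_rtrancl_on)
qed auto

lemma components_of_image_subset: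
  assumes "K \<in> components_of C S"
  shows "g ` K \<in> components_of C (g ` S)"
proof -
  interpret i: graph_automorphism C "inv_into UNIV g" by (rule inverse)
  have iff: "conn C (g ` S) (g u) (g v) \<longleftrightarrow> conn C S u v" for u v
    using conn_image[of u v S] i.conn_image[of "g u" "g v" "g ` S"] inj
    by (auto simp: image_inverse)
  have "v \<in> g ` pverts C" if "v \<in> pverts C" for v using verts that by simp
  have K: "K \<noteq> {}" "\<And>u v. u \<in> K \<Longrightarrow> v \<in> K \<Longrightarrow> conn C S u v"
    "\<And>u v. u \<in> K \<Longrightarrow> v \<notin> K \<Longrightarrow> \<not> conn C S u v \<or> \<not> conn C S v u"
    using assms unfolding components_of_def pre_digraph.sccs_verts_def reachable_induce_iff by blast+
  show ?thesis
    unfolding components_of_def pre_digraph.sccs_verts_def reachable_induce_iff mem_Collect_eq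
  proof (intro conjI ballI allI impI)
    show "g ` K \<noteq> {}" using K(1) by simp
    show "conn C (g ` S) u v" if "u \<in> g ` K" "v \<in> g ` K" for u v using that K(2) iff by auto
    show "\<not> conn C (g ` S) u v \<or> \<not> conn C (g ` S) v u" if "u \<in> g ` K" "v \<notin> g ` K" for u v
    proof -
      obtain v' where "v = g v'" using bij by (metis bij_pointE)
      then have "v' \<notin> K" using that(2) mem_image by blast
      then show ?thesis using \<open>v = g v'\<close> that(1) K(3) iff by auto
    qed
  qed
qed

lemma nbhd_image: "nbhd C (g ` K) = g ` nbhd C K"
proof (rule Set.set_eqI)
  fix v
  obtain v' where v: "v = g v'" using bij by (metis bij_pointE)
  show "v \<in> nbhd C (g ` K) \<longleftrightarrow> v \<in> g ` nbhd C K"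
    unfolding v mem_image by (auto simp: nbhd_def mem_image mem_verts arcs)
qed

lemma tight_act: "tight C s \<Longrightarrow> tight C (act s)"
proof -
  assume "tight C s"
  then obtain A B K L where *: "s = {A, B}" "is_separation C A B"
    "K \<in> components_of C (pverts C - A \<inter> B)" "K \<subseteq> A" "nbhd C K = A \<inter> B"
    "L \<in> components_of C (pverts C - A \<inter> B)" "L \<subseteq> B" "nbhd C L = A \<inter> B"
    unfolding tight_def by blast
  have "g ` (pverts C - A \<inter> B) = pverts C - g ` A \<inter> g ` B"
    by (simp add: image_Diff image_Int verts)
  then have "g ` K \<in> components_of C (pverts C - g ` A \<inter> g ` B)" "g ` K \<subseteq> g ` A" "nbhd C (g ` K) = g ` A \<inter> g ` B"
    "g ` L \<in> components_of C (pverts C - g ` A \<inter> g ` B)" "g ` L \<subseteq> g ` B" "nbhd C (g ` L) = g ` A \<inter> g ` B"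
    using components_of_image_subset[OF *(3)] components_of_image_subset[OF *(6)] *
    by (auto simp: nbhd_image image_Int)
  moreover have "act s = {g ` A, g ` B}" "is_separation C (g ` A) (g ` B)"
    using * by (simp_all add: is_separation_image)
  ultimately show ?thesis unfolding tight_def by blast
qed

lemma top_star_oact: "top_star C a b c \<Longrightarrow> top_star C (oact a) (oact b) (oact c)"
proof -
  assume t: "top_star C a b c"
  let ?T = "{a, b, c}"
  have img: "{oact a, oact b, oact c} = oact ` ?T" by simp
  show "top_star C (oact a) (oact b) (oact c)"
    unfolding top_star_def img
  proof (intro conjI ballI impI)
    show "distinct [oact a, oact b, oact c]"
      using t by (simp add: top_star_def inj_oact)
    show "is_separation C (fst s) (snd s)" if s: "s \<in> oact ` ?T" for s
    proof -
      obtain u where u: "s = oact u" "u \<in> ?T" using s by (rule imageE)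
      have "\<forall>s\<in>?T. is_separation C (fst s) (snd s)" using t unfolding top_star_def by (elim conjE)
      then have "is_separation C (fst u) (snd u)" using u(2) by (rule bspec)
      then show ?thesis unfolding u(1) fst_map_prod snd_map_prod is_separation_image .
    qed
    show "(fst s - snd s) \<inter> (fst s' - snd s') = {}"
      if s: "s \<in> oact ` ?T" "s' \<in> oact ` ?T" and "s \<noteq> s'" for s s'
    proof -
      obtain u u' where u: "s = oact u" "u \<in> ?T" "s' = oact u'" "u' \<in> ?T" using s by (elim imageE)
      have "\<forall>s\<in>?T. \<forall>t\<in>?T. s \<noteq> t \<longrightarrow> (fst s - snd s) \<inter> (fst t - snd t) = {}"
        using t unfolding top_star_def by (elim conjE)
      moreover have "u \<noteq> u'" using \<open>s \<noteq> s'\<close> u by auto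
      ultimately have "(fst u - snd u) \<inter> (fst u' - snd u') = {}" using u by metis
      then show ?thesis unfolding u by (simp flip: image_Diff image_Int)
    qed
    have "(\<Union>s\<in>?T. fst s - snd s) = pverts C - (\<Union>s\<in>?T. separator s)"
      using t unfolding top_star_def by (elim conjE)
    then have "g ` (\<Union>s\<in>?T. fst s - snd s) = g ` (pverts C - (\<Union>s\<in>?T. separator s))" by simp
    then show "(\<Union>s\<in>oact ` ?T. fst s - snd s) = pverts C - (\<Union>s\<in>oact ` ?T. separator s)"
      unfolding image_Diff verts image_UN by (simp add: separator_oact image_Diff)
    show "\<exists>s'\<in>oact ` ?T - {s}. v \<in> separator s'" if s: "s \<in> oact ` ?T" and v: "v \<in> separator s" for s v
    proof -
      obtain u where u: "s = oact u" "u \<in> ?T" using s by (rule imageE)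
      obtain w where w: "v = g w" "w \<in> separator u" using v unfolding u(1) separator_oact by (rule imageE)
      have "\<forall>s\<in>?T. \<forall>v\<in>separator s. \<exists>t\<in>?T - {s}. v \<in> separator t"
        using t unfolding top_star_def by (elim conjE)
      then obtain u' where u': "u' \<in> ?T - {u}" "w \<in> separator u'" using u(2) w(2) by metis
      then have "oact u' \<in> oact ` ?T - {s}" using u(1) by (auto simp: inj_oact)
      moreover have "v \<in> separator (oact u')" using w(1) u'(2) by (simp add: separator_oact)
      ultimately show ?thesis by (rule bexI[rotated])
    qed
  qed
qed

lemma relevant_oact: "relevant C a b c \<Longrightarrow> relevant C (oact a) (oact b) (oact c)"
proof -
  assume r: "relevant C a b c"
  define Z where "Z = separator a \<inter> separator b \<inter> separator c"
  have Z: "separator (oact a) \<inter> separator (oact b) \<inter> separator (oact c) = g ` Z"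
    by (simp add: Z_def separator_oact image_Int)
  show "relevant C (oact a) (oact b) (oact c)"
    unfolding relevant_def Let_def Z
  proof (intro conjI ballI)
    show "tight C (unorient (oact a))"
      using r by (simp add: relevant_def unorient_oact tight_act Let_def)
    fix x' s' assume x': "x' \<in> separator (oact b) \<inter> separator (oact c) - g ` Z" and "s' \<in> {oact b, oact c}"
    then obtain s where s: "s' = oact s" "s \<in> {b, c}" by blast
    from x' have "x' \<in> g ` (separator b \<inter> separator c - Z)"
      by (simp add: separator_oact image_Int image_Diff)
    then obtain x where x: "x' = g x" "x \<in> separator b \<inter> separator c - Z" by blast
    have sep: "separator (oact a) \<inter> separator (oact s) - g ` Z = g ` (separator a \<inter> separator s - Z)"
      by (simp add: separator_oact image_Int image_Diff)
    have sd: "fst (oact s) - snd (oact s) = g ` (fst s - snd s)"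
      by (simp add: image_Diff)
    have "(\<exists>y \<in> (separator a \<inter> separator s) - Z. (x, y) \<in> parcs C) \<or>
         (\<exists>K \<in> components_of C (fst s - snd s). \<exists>y \<in> ((separator a \<inter> separator s) - Z) \<union> Z.
            x \<in> nbhd C K \<and> y \<in> nbhd C K)"
      using r x(2) s(2) unfolding relevant_def Let_def Z_def by blast
    then show "(\<exists>y \<in> (separator (oact a) \<inter> separator s') - g ` Z. (x', y) \<in> parcs C) \<or>
         (\<exists>K \<in> components_of C (fst s' - snd s').
            \<exists>y \<in> ((separator (oact a) \<inter> separator s') - g ` Z) \<union> g ` Z. x' \<in> nbhd C K \<and> y \<in> nbhd C K)"
      unfolding s(1) sep sd x(1) image_Un[symmetric]
    proof (elim disjE bexE conjE)
      fix y assume "y \<in> separator a \<inter> separator s - Z" "(x, y) \<in> parcs C"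
      then show "(\<exists>y\<in>g ` (separator a \<inter> separator s - Z). (g x, y) \<in> parcs C) \<or>
          (\<exists>K\<in>components_of C (g ` (fst s - snd s)).
            \<exists>y\<in>g ` (separator a \<inter> separator s - Z \<union> Z). g x \<in> nbhd C K \<and> y \<in> nbhd C K)"
        using arcs by blast
    next
      fix K y assume "K \<in> components_of C (fst s - snd s)" "y \<in> separator a \<inter> separator s - Z \<union> Z"
        "x \<in> nbhd C K" "y \<in> nbhd C K"
      then have "g ` K \<in> components_of C (g ` (fst s - snd s))" "g y \<in> g ` (separator a \<inter> separator s - Z \<union> Z)"
        "g x \<in> nbhd C (g ` K)" "g y \<in> nbhd C (g ` K)"
        using components_of_image_subset by (auto simp: nbhd_image)
      then show "(\<exists>y\<in>g ` (separator a \<inter> separator s - Z). (g x, y) \<in> parcs C) \<or>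
          (\<exists>K\<in>components_of C (g ` (fst s - snd s)).
            \<exists>y\<in>g ` (separator a \<inter> separator s - Z \<union> Z). g x \<in> nbhd C K \<and> y \<in> nbhd C K)"
        by blast
    qed
  qed
qed

text \<open>A star with base in the image is pulled back by the inverse, where the bottleneck
  property of \<beta> applies.\<close>

lemma bottleneck_act: "bottleneck C k \<beta> \<Longrightarrow> bottleneck C k (act ` \<beta>)"
proof -
  interpret i: graph_automorphism C "inv_into UNIV g" by (rule inverse)
  assume b: "bottleneck C k \<beta>"
  have oinv: "oact (i.oact a) = a" for a by (cases a) (simp add: image_inverse)
  show "bottleneck C k (act ` \<beta>)"
    unfolding bottleneck_def
  proof (intro conjI allI impI ballI)
    show "act ` \<beta> \<noteq> {}" using b by (simp add: bottleneck_def)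
    show "tight C s" "sep_order s = enat k" if "s \<in> act ` \<beta>" for s
      using that b by (auto simp: bottleneck_def tight_act sep_order_act)
    fix a b' c
    assume t: "top_star C a b' c" and r: "relevant C a b' c"
      and o: "\<forall>s\<in>{a, b', c}. sep_order (unorient s) \<le> enat k" and a: "unorient a \<in> act ` \<beta>"
    obtain a\<^sub>0 where a0: "a\<^sub>0 \<in> \<beta>" "unorient a = act a\<^sub>0" using a by auto
    then have "unorient (i.oact a) = a\<^sub>0" by (simp add: i.unorient_oact act_inverse)
    then have "unorient (i.oact a) \<in> \<beta>" using a0 by simp
    moreover have "\<forall>s\<in>{i.oact a, i.oact b', i.oact c}. sep_order (unorient s) \<le> enat k"
      using o by (auto simp: i.unorient_oact i.sep_order_act)
    ultimately have "unorient (i.oact b') \<in> \<beta> \<or> unorient (i.oact c) \<in> \<beta>"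
      using b i.top_star_oact[OF t] i.relevant_oact[OF r] unfolding bottleneck_def by blast
    then have "act (unorient (i.oact b')) \<in> act ` \<beta> \<or> act (unorient (i.oact c)) \<in> act ` \<beta>" by blast
    then show "unorient b' \<in> act ` \<beta> \<or> unorient c \<in> act ` \<beta>"
      by (simp add: i.unorient_oact act_inverse)
  qed
qed

lemma bottleneck_seps_act: "t \<in> bottleneck_seps C k \<Longrightarrow> act t \<in> bottleneck_seps C k"
  using bottleneck_act unfolding bottleneck_seps_def by blast

lemma crossing_number_act: "crossing_number C k (act s) = crossing_number C k s"
proof -
  interpret i: graph_automorphism C "inv_into UNIV g" by (rule inverse)
  have "{t \<in> bottleneck_seps C k. crossing t (act s)} = act ` {t \<in> bottleneck_seps C k. crossing t s}"
  proof (intro Set.set_eqI iffI)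
    fix t assume t: "t \<in> {t \<in> bottleneck_seps C k. crossing t (act s)}"
    then have "i.act t \<in> {t \<in> bottleneck_seps C k. crossing t s}"
      using i.bottleneck_seps_act nested_act[of "i.act t" s] by (simp add: act_inverse)
    then have "act (i.act t) \<in> act ` {t \<in> bottleneck_seps C k. crossing t s}" by blast
    then show "t \<in> act ` {t \<in> bottleneck_seps C k. crossing t s}" by (simp add: act_inverse)
  qed (auto simp: bottleneck_seps_act nested_act)
  then show ?thesis
    using inj_on_subset[OF inj_act] by (simp add: crossing_number_def ecard_def card_image finite_image_iff)
qed

lemma select_nested_act:
  assumes M: "\<And>t. act t \<in> M \<longleftrightarrow> t \<in> M" and s: "s \<in> select_nested C k M \<beta>"
  shows "act s \<in> select_nested C k M (act ` \<beta>)"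
proof -
  have M': "(\<forall>t\<in>M. nested (act u) t) \<longleftrightarrow> (\<forall>t\<in>M. nested u t)" for u
  proof -
    have "M = act ` M"
    proof (rule Set.set_eqI, rule iffI)
      fix t assume "t \<in> M"
      then have "act (image (image (inv_into UNIV g)) t) \<in> M" by (simp add: act_inverse)
      then have "image (image (inv_into UNIV g)) t \<in> M" using M by blast
      then show "t \<in> act ` M" by (metis act_inverse(1) image_eqI)
    qed (use M in auto)
    then have "(\<forall>t\<in>M. nested (act u) t) \<longleftrightarrow> (\<forall>t\<in>act ` M. nested (act u) t)" by simp
    then show ?thesis by (simp add: nested_act)
  qed
  show ?thesis
    using s unfolding select_nested_def Let_def by (auto simp: M' crossing_number_act)
qed

text \<open>The hypothesis is an equivalence since the union of lower levels must be mapped onto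
  itself, so that nestedness with it is preserved both ways.\<close>

lemma N_level_act_imp: "s \<in> N_level C k \<Longrightarrow> act s \<in> N_level C k"
  if IH: "\<And>j t. j < k \<Longrightarrow> act t \<in> N_level C j \<longleftrightarrow> t \<in> N_level C j"
proof -
  assume "s \<in> N_level C k"
  then obtain \<beta> where b: "bottleneck C k \<beta>" "s \<in> select_nested C k (\<Union>j<k. N_level C j) \<beta>"
    by (rule N_levelE)
  have "act s \<in> select_nested C k (\<Union>j<k. N_level C j) (act ` \<beta>)"
    by (rule select_nested_act[OF _ b(2)]) (use IH in auto)
  then show ?thesis using bottleneck_act[OF b(1)] by (subst N_level_eq) blast
qed

end

lemma (in graph_automorphism) N_level_act: "act s \<in> N_level C k \<longleftrightarrow> s \<in> N_level C k"
proof (induct k arbitrary: s rule: less_induct)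
  case (less k)
  interpret i: graph_automorphism C "inv_into UNIV g" by (rule inverse)
  have "i.act t \<in> N_level C j \<longleftrightarrow> t \<in> N_level C j" if "j < k" for j t
    using less[OF that, of "i.act t"] by (simp add: act_inverse)
  note imp = i.N_level_act_imp[OF this, of k "act s"]
  show ?case
  proof
    assume "act s \<in> N_level C k"
    then show "s \<in> N_level C k" using imp by (simp add: act_inverse)
  qed (rule N_level_act_imp[OF less])
qed

section \<open>Accessibility\<close>

definition arc_count :: "('a \<times> 'a \<Rightarrow> bool) \<Rightarrow> 'a list \<Rightarrow> nat" where
  "arc_count \<phi> W = length (filter \<phi> (vwalk_arcs W))"

lemma arc_count_append:
  "V \<noteq> [] \<Longrightarrow> W \<noteq> [] \<Longrightarrow>
    arc_count \<phi> (V @ W) = arc_count \<phi> V + (if \<phi> (last V, hd W) then 1 else 0) + arc_count \<phi> W"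
  by (simp add: arc_count_def vwalk_arcs_append)

lemma arc_count_Cons2:
  "arc_count \<phi> (u # v # W) = (if \<phi> (u, v) then 1 else 0) + arc_count \<phi> (v # W)"
  by (simp add: arc_count_def)

lemma arc_count_simps [simp]: "arc_count \<phi> [] = 0" "arc_count \<phi> [u] = 0"
  by (simp_all add: arc_count_def)

lemma arc_count_join:
  assumes "V \<noteq> []" "W \<noteq> []" "last V = hd W"
  shows "arc_count \<phi> (vwalk_join V W) = arc_count \<phi> V + arc_count \<phi> W"
proof (cases "tl W")
  case Nil
  then show ?thesis using assms by (cases W) (auto simp: vwalk_join_def)
next
  case (Cons v W')
  then have W: "W = last V # v # W'" using assms by (cases W) auto
  show ?thesis unfolding W vwalk_join_def using assms(1)
    by (simp add: arc_count_append arc_count_Cons2)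
qed

lemma arc_count_rev:
  assumes "\<And>u v. \<phi> (u, v) = \<phi> (v, u)"
  shows "arc_count \<phi> (rev W) = arc_count \<phi> W"
proof (induct W rule: induct_list012)
  case (3 x y zs)
  then show ?case
    using arc_count_append[of "rev (y # zs)" "[x]" \<phi>] assms[of x y]
    by (simp add: arc_count_Cons2)
qed simp_all

text \<open>As \<phi> is symmetric, a spike contributes 0 or 2; parity is thus a homotopy
  invariant.\<close>

lemma arc_count_reduce_step:
  assumes "\<And>u v. \<phi> (u, v) = \<phi> (v, u)" "reduce_step W W'"
  shows "even (arc_count \<phi> W) \<longleftrightarrow> even (arc_count \<phi> W')"
proof -
  obtain xs u v ys where W: "W = xs @ [u, v, u] @ ys" "W' = xs @ [u] @ ys"
    using assms(2) by (auto simp: reduce_step_def)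
  have 1: "even (arc_count \<phi> ([u, v, u] @ ys)) \<longleftrightarrow> even (arc_count \<phi> ([u] @ ys))"
    using assms(1)[of u v] by (simp add: arc_count_Cons2)
  show ?thesis
  proof (cases "xs = []")
    case False
    then show ?thesis using 1 unfolding W by (simp add: arc_count_append)
  qed (use 1 W in simp)
qed

lemma arc_count_red:
  assumes "\<And>u v. \<phi> (u, v) = \<phi> (v, u)"
  shows "even (arc_count \<phi> (red W)) \<longleftrightarrow> even (arc_count \<phi> W)"
  using reduce_steps_red[of W]
  by (induct rule: rtranclp_induct) (auto dest: arc_count_reduce_step[of \<phi>, OF assms])

text \<open>Each counted arc switches between \<open>S\<close> and its complement.\<close>

lemma arc_count_boundary:
  "W \<noteq> [] \<Longrightarrow> even (arc_count (\<lambda>(u, v). (u \<in> S) \<noteq> (v \<in> S)) W) \<longleftrightarrow> (hd W \<in> S \<longleftrightarrow> last W \<in> S)"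
  by (induct W rule: induct_list012) (auto simp: arc_count_Cons2)

lemma arc_count_cong:
  "(\<And>u v. (u, v) \<in> set (vwalk_arcs W) \<Longrightarrow> \<phi> (u, v) = \<psi> (u, v)) \<Longrightarrow> arc_count \<phi> W = arc_count \<psi> W"
  unfolding arc_count_def by (metis (mono_tags, lifting) filter_cong surj_pair)

lemma vwalk_arcs_walk:
  assumes "walk G W" "(u, v) \<in> set (vwalk_arcs W)"
  shows "(u, v) \<in> parcs G" "u \<in> set W" "v \<in> set W"
proof -
  show "(u, v) \<in> parcs G" using assms by (auto simp: vwalk_def)
  have "u \<in> set W \<and> v \<in> set W" using assms(2) by (induct W rule: vwalk_arcs.induct) auto
  then show "u \<in> set W" "v \<in> set W" by auto
qed

lemma conn_walk:
  assumes "conn G S u v" "S \<subseteq> pverts G"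
  obtains W where "walk G W" "hd W = u" "last W = v" "set W \<subseteq> S"
proof -
  have "\<exists>W. walk G W \<and> hd W = u \<and> last W = v \<and> set W \<subseteq> S"
    using assms(1)
  proof (induct rule: rtrancl_on_induct)
    case base
    then show ?case using assms(2) by (intro exI[of _ "[u]"]) (auto simp: vwalk_with_proj_iff)
  next
    case (step v w)
    then obtain W where W: "walk G W" "hd W = u" "last W = v" "set W \<subseteq> S" by blast
    then show ?case
      using step assms(2)
      by (intro exI[of _ "W @ [w]"]) (auto simp: vwalk_with_proj_iff successively_append_iff)
  qed
  then show ?thesis using that by blast
qed

text \<open>\<open>Suc n\<close> bounds the number of vertices in the list, so \<open>n\<close>
  bounds the number of edges.\<close>

definition walk_ball :: "'a pair_pre_digraph \<Rightarrow> nat \<Rightarrow> 'a \<Rightarrow> 'a set" where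
  "walk_ball G n u = {v. \<exists>W. walk G W \<and> hd W = u \<and> last W = v \<and> length W \<le> Suc n}"

lemma walk_ballI:
  "walk G W \<Longrightarrow> hd W = u \<Longrightarrow> last W = v \<Longrightarrow> length W \<le> Suc n \<Longrightarrow> v \<in> walk_ball G n u"
  unfolding walk_ball_def by blast

lemma walk_ball_step:
  assumes "v \<in> walk_ball G n u" "(v, w) \<in> parcs G" "w \<in> pverts G"
  shows "w \<in> walk_ball G (Suc n) u"
proof -
  obtain W where "walk G W" "hd W = u" "last W = v" "length W \<le> Suc n"
    using assms(1) by (auto simp: walk_ball_def)
  then have "walk G (W @ [w]) \<and> hd (W @ [w]) = u \<and> last (W @ [w]) = w \<and> length (W @ [w]) \<le> Suc (Suc n)"
    using assms by (auto simp: vwalk_with_proj_iff successively_append_iff)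
  then show ?thesis unfolding walk_ball_def by blast
qed

lemma walk_ball_self: "u \<in> pverts G \<Longrightarrow> u \<in> walk_ball G n u"
  unfolding walk_ball_def by (auto simp: vwalk_with_proj_iff intro!: exI[of _ "[u]"])

lemma walk_ball_0: "walk_ball G 0 u \<subseteq> {u}"
proof
  fix v assume "v \<in> walk_ball G 0 u"
  then obtain W where "walk G W" "hd W = u" "last W = v" "length W \<le> 1"
    by (auto simp: walk_ball_def)
  then show "v \<in> {u}" by (cases W) (auto simp: vwalk_with_proj_iff)
qed

lemma walk_ball_Suc: "walk_ball G (Suc n) u \<subseteq> walk_ball G n u \<union> (\<Union>v\<in>walk_ball G n u. {w. (v, w) \<in> parcs G})"
proof
  fix w assume "w \<in> walk_ball G (Suc n) u"
  then obtain W where W: "walk G W" "hd W = u" "last W = w" "length W \<le> Suc (Suc n)"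
    by (auto simp: walk_ball_def)
  show "w \<in> walk_ball G n u \<union> (\<Union>v\<in>walk_ball G n u. {w. (v, w) \<in> parcs G})"
  proof (cases "length W \<le> Suc n")
    case False
    define V where "V = butlast W"
    have eq: "W = V @ [w]" using W(1,3) walk_nonempty unfolding V_def by (metis append_butlast_last_id)
    have ne: "V \<noteq> []" using False eq by auto
    have "walk G V" "(last V, w) \<in> parcs G"
      using W(1) ne unfolding eq vwalk_with_proj_iff successively_append_iff by auto
    moreover have "hd V = u" "length V \<le> Suc n" using W(2,4) ne unfolding eq by auto
    ultimately have "last V \<in> walk_ball G n u" "(last V, w) \<in> parcs G" by (auto intro: walk_ballI)
    then show ?thesis by blast
  next
    case True
    then have "w \<in> walk_ball G n u" by (rule walk_ballI[OF W(1-3)])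
    then show ?thesis by simp
  qed
qed

lemma (in locally_finite_connected) finite_walk_ball: "finite (walk_ball C n u)"
proof (induct n)
  case 0
  show ?case by (rule finite_subset[OF walk_ball_0]) simp
next
  case (Suc n)
  then have "finite (walk_ball C n u \<union> (\<Union>v\<in>walk_ball C n u. {w. (v, w) \<in> parcs C}))"
    using finite_neighbours by blast
  then show ?case by (rule finite_subset[OF walk_ball_Suc])
qed

lemma (in graph_automorphism) walk_image: "walk C W \<Longrightarrow> walk C (map g W)"
  by (auto simp: vwalk_with_proj_iff successively_map arcs mem_verts)

lemma (in graph_automorphism) walk_ball_image: "walk_ball C n (g u) = g ` walk_ball C n u"
proof -
  interpret i: graph_automorphism C "inv_into UNIV g" by (rule inverse)
  have sub: "f v \<in> walk_ball C n (f u)" if "graph_automorphism C f" and v: "v \<in> walk_ball C n u" for f u v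
  proof -
    interpret f: graph_automorphism C f by fact
    obtain W where W: "walk C W" "hd W = u" "last W = v" "length W \<le> Suc n"
      using v by (auto simp: walk_ball_def)
    then have "walk C (map f W) \<and> hd (map f W) = f u \<and> last (map f W) = f v \<and> length (map f W) \<le> Suc n"
      using f.walk_image walk_nonempty[OF W(1)] by (auto simp: hd_map last_map)
    then show ?thesis unfolding walk_ball_def by blast
  qed
  show ?thesis
  proof (rule equalityI; rule subsetI)
    fix v assume "v \<in> walk_ball C n (g u)"
    then have "inv_into UNIV g v \<in> walk_ball C n (inv_into UNIV g (g u))"
      by (rule sub[OF inverse])
    then have "inv_into UNIV g v \<in> walk_ball C n u" using inj by simp
    moreover have "v = g (inv_into UNIV g v)" using bij by (simp add: bij_is_surj surj_f_inv_f)
    ultimately show "v \<in> g ` walk_ball C n u" by blast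
  qed (use sub[OF graph_automorphism_axioms] in auto)
qed

section \<open>Separators in the local covering are connected by short steps\<close>

locale finite_local_cover = local_cover C G p r x y
  for C :: "'b pair_pre_digraph" and G :: "'a pair_pre_digraph" and p r x y +
  assumes finite_G: "finite (pverts G)"
begin

lemma C_finite_neighbours: "finite {v. (u, v) \<in> parcs C}"
proof (rule inj_on_finite)
  show "inj_on p {v. (u, v) \<in> parcs C}"
    using p_locally_inj by (auto intro: inj_onI)
  show "p ` {v. (u, v) \<in> parcs C} \<subseteq> pverts G"
    using arc_verts p_vert by blast
qed (rule finite_G)

lemma walk_conn:
  assumes "walk C W"
  shows "conn C (pverts C) (hd W) (last W)"
  using assms
proof (induct W rule: vwalk_induct)
  case (Cons u v es)
  have "u \<in> pverts C" using Cons arc_verts by simp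
  then show ?case using Cons converse_rtrancl_on_into_rtrancl_on by fastforce
qed simp

sublocale locally_finite_connected C
proof
  show "conn C (pverts C) u v" if "u \<in> pverts C" "v \<in> pverts C" for u v
    using C_connected[OF that] walk_conn by blast
qed (use arc_verts arc_sym C_finite_neighbours in auto)

text \<open>Parity is additive under joining walks, so it vanishes on all closed walks once it
  vanishes on short ones; in a generator the access walk is counted twice.\<close>

lemma even_arc_count_base:
  assumes \<phi>: "\<And>u v. \<phi> (u, v) = \<phi> (v, u)"
    and short: "\<And>z Q. closed_walk (with_proj C) z Q \<Longrightarrow> length Q \<le> Suc r \<Longrightarrow> even (arc_count \<phi> Q)"
    and W: "closed W"
  shows "even (arc_count \<phi> W)"
  using W
proof (rule closed_walk_induct)
  fix V W assume "closed V" "closed W" "even (arc_count \<phi> V)" "even (arc_count \<phi> W)"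
  then show "even (arc_count \<phi> (vwalk_join V W))"
    by (subst arc_count_join) (auto simp: closed_walk_with_proj dest: walk_nonempty)
next
  fix V W assume "red V = red W" "even (arc_count \<phi> V)"
  then show "even (arc_count \<phi> W)" using arc_count_red[of \<phi>, OF \<phi>] by metis
next
  fix W assume W: "closed W" "map p W \<in> generators"
  have "walk C W" "hd W = y" using W(1) by (auto simp: closed_walk_with_proj)
  then obtain L Q where L: "walk C L" "closed_walk (with_proj C) (last L) Q" "length Q \<le> Suc r"
    "W = vwalk_join (vwalk_join L Q) (rev L)"
    using generator_lift[OF W(2)] by metis
  have Q: "Q \<noteq> []" "hd Q = last L" "last Q = last L" "walk C Q"
    using L(2) walk_nonempty by (auto simp: closed_walk_with_proj)
  have ne: "L \<noteq> []" using L walk_nonempty by blast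
  have "arc_count \<phi> W = arc_count \<phi> (vwalk_join L Q) + arc_count \<phi> (rev L)"
    unfolding L(4) using ne Q walk_join(3)[OF L(1) Q(4)]
    by (intro arc_count_join) (auto simp: hd_rev)
  also have "\<dots> = arc_count \<phi> L + arc_count \<phi> Q + arc_count \<phi> L"
    using ne Q by (simp add: arc_count_join arc_count_rev[of \<phi>, OF \<phi>])
  finally show "even (arc_count \<phi> W)" using short[OF L(2,3)] by simp
qed (simp_all add: arc_count_rev[of \<phi>, OF \<phi>])

text \<open>Moves the base point: the connecting walk \<open>P\<close> is counted twice.\<close>

lemma even_arc_count:
  assumes \<phi>: "\<And>u v. \<phi> (u, v) = \<phi> (v, u)"
    and short: "\<And>z Q. closed_walk (with_proj C) z Q \<Longrightarrow> length Q \<le> Suc r \<Longrightarrow> even (arc_count \<phi> Q)"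
    and W: "walk C W" "hd W = last W"
  shows "even (arc_count \<phi> W)"
proof -
  obtain P where P: "walk C P" "hd P = y" "last P = hd W"
    using C_connected[OF y] walk_hd_last[OF W(1)] by blast
  note ne = walk_nonempty[OF P(1)] walk_nonempty[OF W(1)]
  have rP: "walk C (rev P)" "hd (rev P) = last W" "last (rev P) = y"
    using P W ne C.walk_rev by (auto simp: hd_rev last_rev)
  note j1 = walk_join[OF P(1) W(1) P(3)]
  have j2: "walk C (vwalk_join (vwalk_join P W) (rev P))" "hd (vwalk_join (vwalk_join P W) (rev P)) = y"
    "last (vwalk_join (vwalk_join P W) (rev P)) = y"
    using walk_join[OF j1(1) rP(1)] j1 rP P by auto
  have "even (arc_count \<phi> (vwalk_join (vwalk_join P W) (rev P)))"
    by (rule even_arc_count_base[of \<phi>, OF \<phi> short]) (use j2 in \<open>auto simp: closed_walk_with_proj\<close>)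
  also have "arc_count \<phi> (vwalk_join (vwalk_join P W) (rev P)) = arc_count \<phi> (vwalk_join P W) + arc_count \<phi> (rev P)"
    using ne j1 rP walk_nonempty[OF j1(1)] by (intro arc_count_join) auto
  also have "\<dots> = arc_count \<phi> P + arc_count \<phi> W + arc_count \<phi> P"
    using ne P by (simp add: arc_count_join arc_count_rev[of \<phi>, OF \<phi>])
  finally show ?thesis by presburger
qed

text \<open>The segment of \<open>Q\<close> between the two positions, possibly reversed, is short
  enough.\<close>

lemma short_closed_walk_ball:
  assumes "closed_walk (with_proj C) z Q" "length Q \<le> Suc r" "a \<in> set Q" "b \<in> set Q"
  shows "b \<in> walk_ball C r a"
proof -
  have Q: "walk C Q" using assms(1) by (simp add: closed_walk_with_proj)
  have seg: "\<exists>W. walk C W \<and> hd W = Q ! i \<and> last W = Q ! j \<and> length W \<le> Suc r" if ij: "i \<le> j" "j < length Q" for i j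
  proof (intro exI conjI)
    let ?W = "drop i (take (Suc j) Q)"
    have len: "length ?W = Suc j - i" "?W \<noteq> []" using ij by auto
    have "successively (\<lambda>u v. (u, v) \<in> parcs C) (take (Suc j) Q)"
      using Q append_take_drop_id[of "Suc j" Q] unfolding vwalk_with_proj_iff by (metis successively_append_iff)
    then have "successively (\<lambda>u v. (u, v) \<in> parcs C) ?W"
      using append_take_drop_id[of i "take (Suc j) Q"] by (metis successively_append_iff)
    moreover have "set ?W \<subseteq> pverts C"
      using Q set_drop_subset[of i "take (Suc j) Q"] set_take_subset[of "Suc j" Q] by (auto simp: vwalk_with_proj_iff)
    ultimately show "walk C ?W" using len by (simp add: vwalk_with_proj_iff)
    show "hd ?W = Q ! i" using ij by (simp add: hd_drop_conv_nth)
    show "last ?W = Q ! j" using ij len by (simp add: last_conv_nth)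
    show "length ?W \<le> Suc r" using assms(2) ij by simp
  qed
  obtain i j where ij: "i < length Q" "j < length Q" "a = Q ! i" "b = Q ! j"
    using assms(3,4) by (metis in_set_conv_nth)
  show ?thesis
  proof (cases "i \<le> j")
    case True
    then show ?thesis using seg[of i j] ij unfolding walk_ball_def by blast
  next
    case False
    then obtain W where W: "walk C W" "hd W = b" "last W = a" "length W \<le> Suc r"
      using seg[of j i] ij by auto
    then have "walk C (rev W) \<and> hd (rev W) = a \<and> last (rev W) = b \<and> length (rev W) \<le> Suc r"
      using C.walk_rev walk_nonempty[OF W(1)] by (simp add: hd_rev last_rev)
    then show ?thesis unfolding walk_ball_def by blast
  qed
qed

text \<open>If no short closed walk met both \<open>X\<^sub>1\<close> and its complement in the separator, then every short
  closed walk would use an even number of edges between \<open>X\<^sub>1\<close> and \<open>A - B\<close>; but a cycle through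
  both full components meeting the separator in one vertex of either part uses exactly one.\<close>

lemma separator_linked:
  assumes tight: "tight C {A, B}" and X1: "X\<^sub>1 \<subseteq> A \<inter> B" "X\<^sub>1 \<noteq> {}" "X\<^sub>1 \<noteq> A \<inter> B"
  obtains u v where "u \<in> X\<^sub>1" "v \<in> A \<inter> B - X\<^sub>1" "v \<in> walk_ball C r u"
proof -
  have False if far: "\<And>u v. u \<in> X\<^sub>1 \<Longrightarrow> v \<in> A \<inter> B - X\<^sub>1 \<Longrightarrow> v \<notin> walk_ball C r u"
  proof -
    have sep: "is_separation C A B" using tight by (simp add: tight_iff)
    obtain K L where K: "full_component C (A \<inter> B) K" "K \<subseteq> A - B" and L: "full_component C (A \<inter> B) L" "L \<subseteq> B - A"
      using tight by (auto simp: tight_iff)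
    obtain u v where u: "u \<in> X\<^sub>1" and v: "v \<in> A \<inter> B - X\<^sub>1" using X1 by blast
    have verts: "A \<subseteq> pverts C" "B \<subseteq> pverts C" using sep by (auto simp: is_separation_def)
    define \<phi> where "\<phi> = (\<lambda>(a, b). a \<in> X\<^sub>1 \<and> b \<in> A - B \<or> b \<in> X\<^sub>1 \<and> a \<in> A - B)"
    have \<phi>: "\<phi> (a, b) = \<phi> (b, a)" for a b by (auto simp: \<phi>_def)
    have short: "even (arc_count \<phi> Q)" if Q: "closed_walk (with_proj C) z Q" "length Q \<le> Suc r" for z Q
    proof (cases "set Q \<inter> X\<^sub>1 = {}")
      case True
      have wQ: "walk C Q" using Q(1) by (simp add: closed_walk_with_proj)
      have "arc_count \<phi> Q = arc_count (\<lambda>_. False) Q"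
      proof (rule arc_count_cong)
        fix a b assume ab: "(a, b) \<in> set (vwalk_arcs Q)"
        show "\<phi> (a, b) = False" using vwalk_arcs_walk(2,3)[OF wQ ab] True by (auto simp: \<phi>_def)
      qed
      then show ?thesis by (simp add: arc_count_def)
    next
      case False
      then obtain a where a: "a \<in> set Q" "a \<in> X\<^sub>1" by blast
      have none: "b \<notin> A \<inter> B - X\<^sub>1" if "b \<in> set Q" for b
        using far[OF a(2)] short_closed_walk_ball[OF Q a(1) that] by blast
      have wQ: "walk C Q" "hd Q = last Q" using Q(1) by (simp_all add: closed_walk_with_proj)
      \<comment> \<open>\<open>Q\<close> meets \<open>X\<^sub>1\<close> and so misses the rest of
        the separator. On \<open>Q\<close> the arcs satisfying \<phi> are then exactly those
        entering or leaving \<open>A - B\<close>.\<close>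
      have "arc_count \<phi> Q = arc_count (\<lambda>(a, b). (a \<in> A - B) \<noteq> (b \<in> A - B)) Q"
      proof (rule arc_count_cong)
        fix a b assume ab: "(a, b) \<in> set (vwalk_arcs Q)"
        note w = vwalk_arcs_walk[OF wQ(1) ab]
        have "a \<in> A - B \<Longrightarrow> b \<in> A" "b \<in> A - B \<Longrightarrow> a \<in> A"
          using sep w(1) arc_verts[OF w(1)] unfolding is_separation_def by blast+
        then show "\<phi> (a, b) = (case (a, b) of (a, b) \<Rightarrow> (a \<in> A - B) \<noteq> (b \<in> A - B))"
          using none[OF w(2)] none[OF w(3)] X1(1) by (auto simp: \<phi>_def)
      qed
      then show ?thesis using arc_count_boundary[OF walk_nonempty[OF wQ(1)], of "A - B"] wQ(2) by simp
    qed
    obtain k k' where k: "k \<in> K" "(k, u) \<in> parcs C" "k' \<in> K" "(k', v) \<in> parcs C"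
      using full_componentD(5)[OF K(1), of u] full_componentD(5)[OF K(1), of v] u v X1(1) by blast
    obtain U where U: "walk C U" "hd U = k" "last U = k'" "set U \<subseteq> K"
      using conn_walk[OF full_componentD(4)[OF K(1) k(1,3)] full_componentD(2)[OF K(1)]] by blast
    have uv: "u \<in> L \<union> A \<inter> B" "v \<in> L \<union> A \<inter> B" using u v X1 by auto
    have "conn C (L \<union> {u, v}) v u"
      by (rule conn_full_component[OF L(1) uv(2,1)]) auto
    then obtain T where T: "walk C T" "hd T = v" "last T = u" "set T \<subseteq> L \<union> {u, v}"
      by (rule conn_walk) (use full_componentD(2)[OF L(1)] verts u v X1 in auto)
    note neU = walk_nonempty[OF U(1)] and neT = walk_nonempty[OF T(1)]
    \<comment> \<open>The closed walk with odd count: from \<open>u\<close> through \<open>K\<close>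
      to \<open>v\<close>, then back through \<open>L\<close>. Only its first arc satisfies \<phi>,
      since \<open>v\<close> is not in \<open>X\<^sub>1\<close> and \<open>T\<close> avoids
      \<open>A - B\<close>.\<close>
    have wV: "walk C (u # U @ [v])"
      using U k neU u v X1 verts arc_sym by (auto simp: vwalk_with_proj_iff successively_append_iff successively_Cons)
    have cU: "arc_count \<phi> U = 0"
    proof -
      have "arc_count \<phi> U = arc_count (\<lambda>_. False) U"
      proof (rule arc_count_cong)
        fix a b assume ab: "(a, b) \<in> set (vwalk_arcs U)"
        have "a \<notin> X\<^sub>1" "b \<notin> X\<^sub>1" using vwalk_arcs_walk(2,3)[OF U(1) ab] U(4) K(2) X1(1) by blast+
        then show "\<phi> (a, b) = False" by (simp add: \<phi>_def)
      qed
      then show ?thesis by (simp add: arc_count_def)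
    qed
    have cT: "arc_count \<phi> T = 0"
    proof -
      have "arc_count \<phi> T = arc_count (\<lambda>_. False) T"
      proof (rule arc_count_cong)
        fix a b assume ab: "(a, b) \<in> set (vwalk_arcs T)"
        have "a \<notin> A - B" "b \<notin> A - B"
          using vwalk_arcs_walk(2,3)[OF T(1) ab] T(4) L(2) u v X1(1) by blast+
        then show "\<phi> (a, b) = False" by (simp add: \<phi>_def)
      qed
      then show ?thesis by (simp add: arc_count_def)
    qed
    have "k \<in> A - B" "k' \<in> A - B" using k K by auto
    then have "arc_count \<phi> ([u] @ U @ [v]) = 1"
      using u v X1(1) U(2,3) neU cU by (subst arc_count_append; simp add: arc_count_append \<phi>_def)
    then have "arc_count \<phi> (vwalk_join (u # U @ [v]) T) = 1"
      using neT T(2) cT by (subst arc_count_join) auto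
    moreover have "even (arc_count \<phi> (vwalk_join (u # U @ [v]) T))"
      using walk_join[OF wV T(1)] T by (intro even_arc_count[of \<phi>, OF \<phi> short]) auto
    ultimately show False by simp
  qed
  then show ?thesis using that by blast
qed

end

lemma finite_total_least:
  assumes "finite S" "S \<noteq> {}"
    and "\<And>a b. a \<in> S \<Longrightarrow> b \<in> S \<Longrightarrow> R a b \<or> R b a"
    and "\<And>a b c. R a b \<Longrightarrow> R b c \<Longrightarrow> R a c"
  shows "\<exists>m\<in>S. \<forall>s\<in>S. R m s"
  using assms(1-3)
proof (induct rule: finite_ne_induct)
  case (insert a F)
  then obtain m where m: "m \<in> F" "\<forall>s\<in>F. R m s" by blast
  then show ?case
    using insert(5)[of a m] insert(5)[of a a] assms(4) by blast
qed blast

section \<open>Outermost elements with a given local pattern, and boundedness of the orders\<close>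

context finite_local_cover
begin

text \<open>Finiteness of chains is available only below a fixed order, hence the cut-off
  \<open>k\<close>.\<close>

definition N_upto :: "nat \<Rightarrow> 'b sep set" where
  "N_upto k = (\<Union>j\<le>k. N_level C j)"

lemma N_upto_tight: "s \<in> N_upto k \<Longrightarrow> tight C s" and N_upto_order: "s \<in> N_upto k \<Longrightarrow> sep_order s \<le> enat k"
  and N_upto_nested: "s \<in> N_upto k \<Longrightarrow> t \<in> N_upto k \<Longrightarrow> nested s t"
  using N_level_tight N_level_order N_level_nested by (fastforce simp: N_upto_def)+

text \<open>The radius exceeds \<open>r\<close> by one so that the ball contains the neighbours of all vertices linked to its
  centre by a short closed walk.\<close>

definition ngh :: "'b \<Rightarrow> 'b set" where
  "ngh v = walk_ball C (Suc r) v"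

definition same_pattern :: "'b \<Rightarrow> 'b osep \<Rightarrow> 'b osep \<Rightarrow> bool" where
  "same_pattern v a b \<longleftrightarrow> fst a \<inter> ngh v = fst b \<inter> ngh v \<and> snd a \<inter> ngh v = snd b \<inter> ngh v"

text \<open>With \<open>osep_ge a b\<close> the first side grows, so these lie further out towards
  \<open>snd a\<close> while looking like \<open>a\<close> in the ball around
  \<open>v\<close>.\<close>

definition beyond :: "nat \<Rightarrow> 'b osep \<Rightarrow> 'b \<Rightarrow> 'b osep set" where
  "beyond k a v = {b. unorient b \<in> N_upto k \<and> osep_ge a b \<and> b \<noteq> a \<and> same_pattern v a b}"

definition witness :: "nat \<Rightarrow> 'b osep \<Rightarrow> 'b \<Rightarrow> bool" where
  "witness k a v \<longleftrightarrow> v \<in> separator a \<and> beyond k a v = {}"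

lemma same_pattern_mono:
  "osep_ge a b \<Longrightarrow> osep_ge b c \<Longrightarrow> same_pattern v a c \<Longrightarrow> same_pattern v a b"
  unfolding osep_ge_def same_pattern_def by blast

text \<open>Neighbours of \<open>v\<close> in the two full components. They belong to the ball
  around every \<open>w\<close> within distance \<open>r\<close> of \<open>v\<close>, so the pattern
  at \<open>w\<close> determines their sides.\<close>

lemma tight_osep_neighbours:
  assumes "tight C (unorient a)" "v \<in> separator a"
  obtains u z where "u \<in> fst a - snd a" "z \<in> snd a - fst a"
    "\<And>w. v \<in> walk_ball C r w \<Longrightarrow> u \<in> ngh w \<and> z \<in> ngh w"
proof -
  obtain K L where K: "full_component C (separator a) K" "K \<subseteq> fst a - snd a"
    and L: "full_component C (separator a) L" "L \<subseteq> snd a - fst a"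
    using assms(1) unfolding unorient_def tight_iff separator_def by blast
  obtain u z where uz: "u \<in> K" "(u, v) \<in> parcs C" "z \<in> L" "(z, v) \<in> parcs C"
    using full_componentD(5)[OF K(1) assms(2)] full_componentD(5)[OF L(1) assms(2)] by blast
  have "u \<in> ngh w \<and> z \<in> ngh w" if "v \<in> walk_ball C r w" for w
    unfolding ngh_def using uz arc_sym arc_verts by (auto intro!: walk_ball_step[OF that])
  then show ?thesis using that uz K L by blast
qed

text \<open>The vertices \<open>u\<close> and \<open>z\<close>, strictly on the same respective
  sides of both, rule out the two nested positions that involve a reversal.\<close>

lemma comparable:
  assumes "nested (unorient a) (unorient b)" "u \<in> fst a - snd a" "z \<in> snd a - fst a"
    "u \<in> fst b - snd b" "z \<in> snd b - fst b"
  shows "osep_ge a b \<or> osep_ge b a"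
  using assms unfolding unorient_def nested_iff osep_ge_def by blast

lemma same_pattern_sides:
  assumes "same_pattern v a b" "u \<in> ngh v"
  shows "u \<in> fst a - snd a \<longleftrightarrow> u \<in> fst b - snd b" "u \<in> snd a - fst a \<longleftrightarrow> u \<in> snd b - fst b"
  using assms unfolding same_pattern_def by blast+

lemma separator_verts:
  assumes "tight C (unorient a)" "v \<in> separator a"
  shows "v \<in> pverts C"
  using assms by (auto simp: unorient_def separator_def tight_iff is_separation_def)

text \<open>All members separate the same two vertices \<open>u\<close> and \<open>z\<close> near
  \<open>v\<close>, so they are finitely many and form a chain; \<open>m\<close> is the one nearest
  to \<open>a\<close>.\<close>

lemma beyond_least:
  assumes a: "unorient a \<in> N_upto k" "v \<in> separator a" and ne: "beyond k a v \<noteq> {}"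
  obtains m where "m \<in> beyond k a v" "\<And>b. b \<in> beyond k a v \<Longrightarrow> osep_ge m b"
proof -
  note t = N_upto_tight[OF a(1)]
  obtain u z where uz: "u \<in> fst a - snd a" "z \<in> snd a - fst a" "u \<in> ngh v" "z \<in> ngh v"
    by (rule tight_osep_neighbours[OF t a(2)]) (use walk_ball_self[OF separator_verts[OF t a(2)]] in auto)
  have sides: "u \<in> fst b - snd b" "z \<in> snd b - fst b" if "b \<in> beyond k a v" for b
    using same_pattern_sides[of v a b] that uz unfolding beyond_def by blast+
  have "beyond k a v \<subseteq> {(D, E). tight C {D, E} \<and> sep_order {D, E} \<le> enat k \<and> u \<in> D - E \<and> z \<in> E - D}"
    using sides N_upto_tight N_upto_order by (auto simp: beyond_def unorient_def)
  moreover have "u \<in> pverts C" "z \<in> pverts C"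
    using uz t by (auto simp: unorient_def tight_iff is_separation_def)
  ultimately have fin: "finite (beyond k a v)"
    using finite_tight_separating finite_subset by blast
  have total: "osep_ge b c \<or> osep_ge c b" if "b \<in> beyond k a v" "c \<in> beyond k a v" for b c
    using comparable[OF _ sides[OF that(1)] sides[OF that(2)]] that N_upto_nested unfolding beyond_def by blast
  have "\<exists>m\<in>beyond k a v. \<forall>b\<in>beyond k a v. osep_ge m b"
    by (rule finite_total_least[OF fin ne total osep_ge_trans])
  then show ?thesis using that by (elim bexE) (rule that, assumption, erule bspec)
qed

text \<open>Otherwise the nearest elements beyond \<open>a\<close> with the same pattern at the vertices of its separator
  all coincide, as the separator is linked. But no \<open>b \<noteq> a\<close> beyond \<open>a\<close> has the same pattern as \<open>a\<close>
  around its whole separator.\<close>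

lemma witness_exists:
  assumes a: "unorient a \<in> N_upto k"
  obtains v where "witness k a v"
proof -
  have False if none: "\<And>v. v \<in> separator a \<Longrightarrow> beyond k a v \<noteq> {}"
  proof -
    obtain A B where AB: "a = (A, B)" by (cases a)
    note t = N_upto_tight[OF a]
    have tAB: "tight C {A, B}" using t by (simp add: AB unorient_def)
    have sepAB: "is_separation C A B" using tAB by (simp add: tight_iff)
    have vAB: "A \<union> B = pverts C" using sepAB by (simp add: is_separation_def)
    have X: "separator a = A \<inter> B" by (simp add: AB separator_def)
    have "\<forall>v\<in>separator a. \<exists>m. m \<in> beyond k a v \<and> (\<forall>b\<in>beyond k a v. osep_ge m b)"
      using beyond_least[OF a _ none] by metis
    then obtain m where m: "\<And>v. v \<in> separator a \<Longrightarrow> m v \<in> beyond k a v"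
      and least: "\<And>v b. v \<in> separator a \<Longrightarrow> b \<in> beyond k a v \<Longrightarrow> osep_ge (m v) b" by metis
    \<comment> \<open>\<open>m v\<close> lies between \<open>a\<close> and \<open>m w\<close>, so it
      also has the pattern of \<open>a\<close> at \<open>w\<close>, and \<open>m w\<close> is the
      nearest such element.\<close>
    have closer: "m v = m w" if v: "v \<in> separator a" and w: "w \<in> separator a" and ge: "osep_ge (m v) (m w)" for v w
    proof -
      have "m v \<in> beyond k a w"
        using m[OF v] m[OF w] same_pattern_mono[OF _ ge, of a w] unfolding beyond_def by blast
      then show ?thesis using least[OF w] ge osep_ge_antisym by blast
    qed
    \<comment> \<open>Neighbours of \<open>w\<close> on both sides of \<open>a\<close> lie in both
      balls, so \<open>m v\<close> and \<open>m w\<close> separate them alike and are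
      comparable.\<close>
    have eq: "m v = m w" if v: "v \<in> separator a" and w: "w \<in> separator a" and vw: "w \<in> walk_ball C r v" for v w
    proof -
      obtain u z where uz: "u \<in> fst a - snd a" "z \<in> snd a - fst a"
        and n: "u \<in> ngh v" "z \<in> ngh v" "u \<in> ngh w" "z \<in> ngh w"
        by (rule tight_osep_neighbours[OF t w]) (use vw walk_ball_self[OF separator_verts[OF t w]] in auto)
      have sp: "same_pattern v a (m v)" "same_pattern w a (m w)"
        using m[OF v] m[OF w] by (simp_all add: beyond_def)
      have "u \<in> fst (m v) - snd (m v)" "z \<in> snd (m v) - fst (m v)"
        "u \<in> fst (m w) - snd (m w)" "z \<in> snd (m w) - fst (m w)"
        using same_pattern_sides(1)[OF sp(1) n(1)] same_pattern_sides(2)[OF sp(1) n(2)]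
          same_pattern_sides(1)[OF sp(2) n(3)] same_pattern_sides(2)[OF sp(2) n(4)] uz by simp_all
      moreover have "nested (unorient (m v)) (unorient (m w))"
        using m[OF v] m[OF w] N_upto_nested unfolding beyond_def by blast
      ultimately have "osep_ge (m v) (m w) \<or> osep_ge (m w) (m v)"
        by (metis comparable)
      then show ?thesis using closer[OF v w] closer[OF w v] by metis
    qed
    obtain v0 where v0: "v0 \<in> A \<inter> B" using tight_separator_nonempty[OF tAB] by blast
    have all: "m v = m v0" if "v \<in> A \<inter> B" for v
    proof (rule ccontr)
      assume "m v \<noteq> m v0"
      then have "{w \<in> A \<inter> B. m w = m v0} \<noteq> A \<inter> B" "{w \<in> A \<inter> B. m w = m v0} \<noteq> {}"
        using \<open>v \<in> A \<inter> B\<close> v0 by blast+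
      then obtain u w where "u \<in> {w \<in> A \<inter> B. m w = m v0}" "w \<in> A \<inter> B - {w \<in> A \<inter> B. m w = m v0}"
        "w \<in> walk_ball C r u"
        using separator_linked[OF tAB, of "{w \<in> A \<inter> B. m w = m v0}"] by blast
      then show False using eq[of u w] X by auto
    qed
    obtain D E where DE: "m v0 = (D, E)" by (cases "m v0")
    have b: "{D, E} \<in> N_upto k" "A \<subseteq> D" "E \<subseteq> B" "(D, E) \<noteq> (A, B)"
      using m[of v0] v0 X unfolding DE beyond_def AB unorient_def osep_ge_def by auto
    have pat: "A \<inter> ngh v = D \<inter> ngh v" "B \<inter> ngh v = E \<inter> ngh v" if "v \<in> A \<inter> B" for v
      using m[of v] X that all[OF that] unfolding DE beyond_def AB same_pattern_def by auto
    have self: "v \<in> ngh v" if "v \<in> A \<inter> B" for v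
      using that vAB unfolding ngh_def by (intro walk_ball_self) auto
    have nb: "u \<in> ngh v" if "v \<in> A \<inter> B" "(v, u) \<in> parcs C" for u v
      unfolding ngh_def using that vAB arc_verts[OF that(2)]
      by (intro walk_ball_step[of v] walk_ball_self) auto
    have XY: "A \<inter> B \<subseteq> D \<inter> E" using pat self by blast
    have tDE: "tight C {D, E}" using N_upto_tight b(1) by blast
    have sepDE: "is_separation C D E" using tDE by (simp add: tight_iff)
    have vDE: "D \<union> E = pverts C" using sepDE by (simp add: is_separation_def)
    obtain K where K: "full_component C (D \<inter> E) K" "K \<subseteq> D - E"
      using tDE by (auto simp: tight_iff)
    \<comment> \<open>\<open>K\<close> is connected and avoids \<open>D \<inter> E\<close>, which
      contains \<open>A \<inter> B\<close>. If \<open>K\<close> lies in \<open>B - A\<close>, a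
      neighbour of \<open>v0\<close> in \<open>K\<close> contradicts the common pattern at
      \<open>v0\<close>.\<close>
    have "K \<subseteq> A - B \<or> K \<subseteq> B - A"
    proof (rule ccontr)
      assume "\<not> (K \<subseteq> A - B \<or> K \<subseteq> B - A)"
      then obtain f g where "f \<in> K" "g \<in> K" "f \<in> A - B" "g \<in> B - A"
        using XY K(2) vAB full_componentD(2)[OF K(1)] by blast
      then have "K \<inter> (A \<inter> B) \<noteq> {}"
        using full_componentD(4)[OF K(1)] separation_blocks[OF sepAB] by blast
      then show False using XY K(2) by blast
    qed
    then show False
    proof
      assume KB: "K \<subseteq> B - A"
      obtain j where j: "j \<in> K" "(j, v0) \<in> parcs C"
        using full_componentD(5)[OF K(1), of v0] v0 XY by blast
      then have "j \<in> D \<inter> ngh v0" using K(2) nb[OF v0] arc_sym by blast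
      then show False using pat(1)[OF v0] j KB by blast
    next
      assume KA: "K \<subseteq> A - B"
      have "z \<in> A" if z: "z \<in> D \<inter> E" for z
      proof -
        obtain j where j: "j \<in> K" "(j, z) \<in> parcs C"
          using full_componentD(5)[OF K(1) z] by blast
        then show ?thesis
          using KA sepAB arc_verts[OF j(2)] unfolding is_separation_def by blast
      qed
      \<comment> \<open>Every vertex of \<open>D \<inter> E\<close> has a neighbour in
        \<open>A - B\<close>, hence lies in \<open>A\<close>; it lies in \<open>B\<close> because
        \<open>E\<close> does.\<close>
      then have eqX: "D \<inter> E = A \<inter> B" using XY b(3) by blast
      have "A \<noteq> D"
      proof
        assume "A = D"
        then have "B \<subseteq> E" using vDE vAB eqX by blast
        then show False using b \<open>A = D\<close> by simp
      qed
      \<comment> \<open>With equal separators, the component of \<open>v\<close> in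
        \<open>B - A\<close> lies in \<open>D - E\<close>. It contains a neighbour \<open>j\<close>
        of the separator, visible in the pattern but in \<open>D\<close> and not in
        \<open>A\<close>.\<close>
      then obtain v where v: "v \<in> B - A" "v \<in> D - E" using b eqX vAB vDE by blast
      have "is_separation C B A" using sepAB is_separation_sym by blast
      then obtain j x where j: "x \<in> B \<inter> A" "(x, j) \<in> parcs C" "j \<in> B - A" "conn C (B - A) v j"
        by (rule component_adjacent[OF _ v(1)]) (use v0 in auto)
      have "j \<in> D"
      proof (rule ccontr)
        assume "j \<notin> D"
        then have "j \<in> E - D" using j(3) vAB vDE by blast
        then have "(B - A) \<inter> (D \<inter> E) \<noteq> {}" using separation_blocks[OF sepDE j(4) v(2)] by blast
        then show False using eqX by blast
      qed
      moreover have "x \<in> A \<inter> B" using j(1) by blast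
      ultimately show False using pat(1)[of x] nb[of x j] j by blast
    qed
  qed
  then show ?thesis using that unfolding witness_def by blast
qed

text \<open>Equal patterns make \<open>a\<close> and \<open>b\<close> comparable, so if distinct one
  would be beyond the other.\<close>

lemma witness_unique:
  assumes "unorient a \<in> N_upto k" "unorient b \<in> N_upto k" "witness k a v" "witness k b v" "same_pattern v a b"
  shows "a = b"
proof (rule ccontr)
  assume ne: "a \<noteq> b"
  have va: "v \<in> separator a" using assms by (simp add: witness_def)
  note t = N_upto_tight[OF assms(1)]
  obtain u z where uz: "u \<in> fst a - snd a" "z \<in> snd a - fst a" "u \<in> ngh v" "z \<in> ngh v"
    by (rule tight_osep_neighbours[OF t va]) (use walk_ball_self[OF separator_verts[OF t va]] in auto)
  then have "osep_ge a b \<or> osep_ge b a"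
    using comparable[OF N_upto_nested[OF assms(1,2)]] same_pattern_sides[OF assms(5)] by blast
  moreover have "same_pattern v b a" using assms(5) by (simp add: same_pattern_def)
  ultimately have "b \<in> beyond k a v \<or> a \<in> beyond k b v"
    using assms ne unfolding beyond_def by blast
  then show False using assms by (auto simp: witness_def)
qed

lemma witness_act:
  assumes "graph_automorphism C g" "witness k a v"
  shows "witness k (map_prod (image g) (image g) a) (g v)"
proof -
  interpret g: graph_automorphism C g by fact
  interpret i: graph_automorphism C "inv_into UNIV g" by (rule g.inverse)
  have oinv: "g.oact (i.oact b) = b" for b by (cases b) (simp add: g.image_inverse)
  have nghg: "ngh (g v) = g ` ngh v" by (simp add: ngh_def g.walk_ball_image)
  have "i.oact b \<in> beyond k a v" if b: "b \<in> beyond k (g.oact a) (g v)" for b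
  proof -
    define b' where "b' = i.oact b"
    have bb: "b = g.oact b'" by (simp add: b'_def oinv)
    have "g.act (unorient b') \<in> N_upto k"
      using b unfolding bb beyond_def by (simp add: g.unorient_oact)
    then have "unorient b' \<in> N_upto k"
      unfolding N_upto_def UN_iff g.N_level_act .
    moreover have "osep_ge a b'"
      using b unfolding bb beyond_def osep_ge_def by (auto simp: g.image_subset_iff)
    moreover have "b' \<noteq> a" using b unfolding bb beyond_def by auto
    moreover have "same_pattern v a b'"
      using b unfolding bb beyond_def same_pattern_def nghg mem_Collect_eq fst_map_prod snd_map_prod
      by (simp flip: g.image_Int add: g.image_eq_iff)
    ultimately show ?thesis unfolding b'_def[symmetric] beyond_def by blast
  qed
  then have "beyond k (g.oact a) (g v) = {}" using assms(2) unfolding witness_def by blast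
  then show ?thesis using assms(2) by (simp add: witness_def g.separator_oact)
qed

text \<open>Pigeonhole: each non-empty level supplies an outermost element, moved by a deck
  transformation so that its witness is a chosen representative of the fibre. Representative and
  pattern determine the element.\<close>

lemma finite_N_levels: "finite {k. N_level C k \<noteq> {}}"
proof -
  define rep where "rep c = (SOME v. v \<in> pverts C \<and> p v = c)" for c
  have rep: "rep (p v) \<in> pverts C" "p (rep (p v)) = p v" if "v \<in> pverts C" for v
    using someI[of "\<lambda>w. w \<in> pverts C \<and> p w = p v" v] that unfolding rep_def by auto
  \<comment> \<open>All possible representatives with their patterns; this set is fixed before
    \<open>F\<close> and \<open>k\<close> are chosen.\<close>
  define T where "T = (SIGMA v:rep ` pverts G. Pow (ngh v) \<times> Pow (ngh v))"
  have finT: "finite T"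
    unfolding T_def ngh_def using finite_G finite_walk_ball by (intro finite_SigmaI) auto
  have bound: "card F \<le> card T" if F: "finite F" "F \<subseteq> {k. N_level C k \<noteq> {}}" for F
  proof -
    define k where "k = Max F"
    have ex: "\<exists>a v. unorient a \<in> N_level C j \<and> witness k a v \<and> v \<in> rep ` pverts G" if j: "j \<in> F" for j
    proof -
      obtain s where s: "s \<in> N_level C j" using j F by blast
      obtain A B where AB: "s = {A, B}" using tight_sepE[OF N_level_tight[OF s]] by metis
      have jk: "j \<le> k" unfolding k_def using j F by simp
      have a: "unorient (A, B) \<in> N_level C j" using s AB by (simp add: unorient_def)
      then have a': "unorient (A, B) \<in> N_upto k" using jk by (auto simp: N_upto_def)
      obtain v where v: "witness k (A, B) v" using witness_exists[OF a'] by blast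
      have vC: "v \<in> pverts C"
        using separator_verts[OF N_upto_tight[OF a']] v by (simp add: witness_def)
      obtain g where g: "bij g" "g ` pverts C = pverts C" "\<And>a b. (g a, g b) \<in> parcs C \<longleftrightarrow> (a, b) \<in> parcs C"
        "g v = rep (p v)"
        using deck_transformation[OF vC rep(1)[OF vC]] rep(2)[OF vC] by metis
      interpret g: graph_automorphism C g using g by unfold_locales
      have "unorient (g.oact (A, B)) \<in> N_level C j"
        unfolding g.unorient_oact g.N_level_act by (rule a)
      moreover have "witness k (g.oact (A, B)) (g v)"
        by (rule witness_act[OF g.graph_automorphism_axioms v])
      ultimately show ?thesis using g(4) p_vert[OF vC] by blast
    qed
    then obtain a v where av: "\<And>j. j \<in> F \<Longrightarrow> unorient (a j) \<in> N_level C j \<and> witness k (a j) (v j) \<and> v j \<in> rep ` pverts G"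
      by metis
    define f where "f j = (v j, fst (a j) \<inter> ngh (v j), snd (a j) \<inter> ngh (v j))" for j
    \<comment> \<open>Equal patterns give the same element, whose order is its level.\<close>
    have "inj_on f F"
    proof (rule inj_onI)
      fix i j assume ij: "i \<in> F" "j \<in> F" "f i = f j"
      have up: "unorient (a j) \<in> N_upto k" if j: "j \<in> F" for j
        using av[OF j] F(1) j unfolding N_upto_def k_def by (meson Max_ge UN_I atMost_iff)
      have "v i = v j" "same_pattern (v j) (a i) (a j)"
        using ij(3) by (auto simp: f_def same_pattern_def)
      then have "a i = a j"
        using witness_unique[OF up[OF ij(1)] up[OF ij(2)]] av[OF ij(1)] av[OF ij(2)] by metis
      then show "i = j"
        using av[OF ij(1)] av[OF ij(2)] N_level_order by (metis enat.inject)
    qed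
    moreover have "f ` F \<subseteq> T" using av by (auto simp: f_def T_def)
    ultimately show ?thesis using finT by (metis card_image card_mono)
  qed
  show ?thesis
  proof (rule ccontr)
    assume "infinite {k. N_level C k \<noteq> {}}"
    then obtain F where "finite F" "card F = Suc (card T)" "F \<subseteq> {k. N_level C k \<noteq> {}}"
      using infinite_arbitrarily_large by metis
    then show False using bound[of F] by simp
  qed
qed

lemma N_set_bounded:
  obtains K where "\<And>s. s \<in> N_set C \<Longrightarrow> tight C s \<and> sep_order s \<le> enat K"
proof -
  obtain K where K: "\<And>k. N_level C k \<noteq> {} \<Longrightarrow> k \<le> K"
    using finite_N_levels unfolding finite_nat_set_iff_bounded_le by blast
  have "tight C s \<and> sep_order s \<le> enat K" if "s \<in> N_set C" for s
  proof -
    obtain k where "s \<in> N_level C k" using \<open>s \<in> N_set C\<close> by (auto simp: N_set_def)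
    then show ?thesis using K[of k] N_level_tight N_level_order by fastforce
  qed
  then show ?thesis using that by blast
qed

end

section \<open>The decomposition tree\<close>

text \<open>\<open>m\<close> is maximal for \<open>osep_ge\<close>, that is, minimal in its first
  side: it is chosen with the fewest elements of \<open>S\<close> above it.\<close>

lemma obtain_minimal_in_interval:
  assumes "c \<in> S" "finite {d \<in> S. osep_ge d c}"
  obtains m where "m \<in> S" "osep_ge m c" "\<And>d. d \<in> S \<Longrightarrow> osep_ge d m \<Longrightarrow> d = m"
proof -
  have "\<exists>m. (m \<in> S \<and> osep_ge m c) \<and>
      (\<forall>m'. m' \<in> S \<and> osep_ge m' c \<longrightarrow> card {d \<in> S. osep_ge d m} \<le> card {d \<in> S. osep_ge d m'})"
    by (rule ex_has_least_nat[of _ c]) (simp add: assms(1) osep_ge_refl)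
  then obtain m where m: "m \<in> S" "osep_ge m c"
    and least: "\<And>m'. m' \<in> S \<Longrightarrow> osep_ge m' c \<Longrightarrow> card {d \<in> S. osep_ge d m} \<le> card {d \<in> S. osep_ge d m'}"
    by blast
  have fin: "finite {d \<in> S. osep_ge d m}"
    by (rule finite_subset[OF _ assms(2)]) (use osep_ge_trans[OF _ m(2)] in blast)
  have "d = m" if d: "d \<in> S" "osep_ge d m" for d
  proof (rule ccontr)
    assume "d \<noteq> m"
    then have "m \<notin> {e \<in> S. osep_ge e d}" using osep_ge_antisym[OF d(2)] by blast
    moreover have "{e \<in> S. osep_ge e d} \<subseteq> {e \<in> S. osep_ge e m}" using osep_ge_trans[OF _ d(2)] by blast
    ultimately have "{e \<in> S. osep_ge e d} \<subset> {e \<in> S. osep_ge e m}" using m(1) osep_ge_refl by blast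
    then have "card {e \<in> S. osep_ge e d} < card {e \<in> S. osep_ge e m}" by (rule psubset_card_mono[OF fin])
    then show False using least[OF d(1)] osep_ge_trans[OF d(2) m(2)] by simp
  qed
  then show ?thesis using that m by blast
qed

text \<open>The abstract input for the tree: nestedness, no separation with one side inside the
  other, and discreteness.\<close>

locale tree_set =
  fixes N :: "'a sep set"
  assumes N_nested: "s \<in> N \<Longrightarrow> t \<in> N \<Longrightarrow> nested s t"
    and proper: "a \<in> orientations N \<Longrightarrow> \<not> fst a \<subseteq> snd a"
    and finite_interval: "a \<in> orientations N \<Longrightarrow> b \<in> orientations N \<Longrightarrow>
      finite {c \<in> orientations N. osep_ge a c \<and> osep_ge c b}"
begin

lemma cases_nested:
  assumes "a \<in> orientations N" "b \<in> orientations N"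
  shows "osep_ge a b \<or> osep_ge b a \<or> osep_ge a (prod.swap b) \<or> osep_ge (prod.swap b) a"
  using N_nested assms unfolding orientations_def nested_unorient_iff[symmetric] by blast

lemma not_ge_swap: "a \<in> orientations N \<Longrightarrow> \<not> osep_ge a (prod.swap a)"
  using proper by (auto simp: osep_ge_def)

lemma not_ge_both: "c \<in> orientations N \<Longrightarrow> osep_ge c a \<Longrightarrow> \<not> osep_ge c (prod.swap a)"
  using not_ge_swap osep_ge_trans osep_ge_swap_right by metis

text \<open>The orientation of \<open>N\<close> induced by the node at which \<open>a\<close> starts.\<close>

definition down :: "'a osep \<Rightarrow> 'a osep set" where
  "down a = {c \<in> orientations N. osep_ge c a \<or> osep_ge c (prod.swap a) \<and> c \<noteq> prod.swap a}"

text \<open>The lowest elements, with respect to \<open>osep_ge\<close>, of the orientation induced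
  by the node.\<close>

definition star_at :: "'a osep \<Rightarrow> 'a osep set" where
  "star_at a = {c \<in> down a. \<forall>d\<in>down a. osep_ge c d \<longrightarrow> d = c}"

lemma down_consistent:
  assumes a: "a \<in> orientations N" and b: "b \<in> down a" and c: "c \<in> down a"
  shows "\<not> osep_ge (prod.swap b) c"
proof
  assume bc: "osep_ge (prod.swap b) c"
  have sa: "prod.swap a \<in> orientations N" using a by (simp add: orientations_swap)
  consider (1) "osep_ge b a" "osep_ge c a"
    | (2) "osep_ge b a" "osep_ge c (prod.swap a)" "c \<noteq> prod.swap a"
    | (3) "osep_ge b (prod.swap a)" "b \<noteq> prod.swap a" "osep_ge c a"
    | (4) "osep_ge b (prod.swap a)" "osep_ge c (prod.swap a)"
    using b c by (auto simp: down_def)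
  then show False
  proof cases
    case 1
    then have "osep_ge (prod.swap a) a"
      using bc osep_ge_trans osep_ge_swap by metis
    then show False using not_ge_swap[OF sa] by simp
  next
    case 2
    then have "osep_ge (prod.swap a) c" using bc osep_ge_trans osep_ge_swap by metis
    then show False using 2 osep_ge_antisym by blast
  next
    case 3
    have "osep_ge a (prod.swap b)" using 3(1) by (simp add: osep_ge_swap_right)
    then have "a = prod.swap b" using osep_ge_antisym osep_ge_trans[OF bc 3(3)] by blast
    then show False using 3(2) by simp
  next
    case 4
    have "osep_ge a (prod.swap b)" using 4(1) by (simp add: osep_ge_swap_right)
    then have "osep_ge a (prod.swap a)" using bc 4(2) osep_ge_trans by metis
    then show False using not_ge_swap[OF a] by simp
  qed
qed

lemma down_total:
  assumes "a \<in> orientations N" "c \<in> orientations N"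
  shows "c \<in> down a \<or> prod.swap c \<in> down a"
  using cases_nested[OF assms(2,1)] assms orientations_swap[of c] osep_ge_refl osep_ge_swap osep_ge_swap_left
  unfolding down_def by (metis (mono_tags, lifting) mem_Collect_eq swap_swap)

lemma self_in_star_at: "a \<in> orientations N \<Longrightarrow> a \<in> star_at a"
proof -
  assume a: "a \<in> orientations N"
  then have d: "a \<in> down a" by (simp add: down_def osep_ge_refl)
  have "d = a" if "d \<in> down a" "osep_ge a d" for d
    using that osep_ge_antisym not_ge_swap[OF a] osep_ge_trans unfolding down_def by blast
  then show ?thesis using d by (simp add: star_at_def)
qed

text \<open>If \<open>c\<close> is not above \<open>a\<close>, it is above the reverse of
  \<open>a\<close>, and the finite interval between them contains a lowest element of the
  orientation.\<close>

lemma down_below_star_at: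
  assumes a: "a \<in> orientations N" and c: "c \<in> down a"
  obtains m where "m \<in> star_at a" "osep_ge c m"
proof (cases "osep_ge c a")
  case True
  then show ?thesis using that self_in_star_at[OF a] by blast
next
  case False
  \<comment> \<open>Reversed elements, because \<open>obtain_minimal_in_interval\<close> finds
    highest elements and a lowest one is wanted.\<close>
  define S where "S = prod.swap ` {d \<in> orientations N. osep_ge d (prod.swap a) \<and> d \<noteq> prod.swap a}"
  have cS: "prod.swap c \<in> S" using c False by (auto simp: S_def down_def)
  have "finite {d \<in> orientations N. osep_ge c d \<and> osep_ge d (prod.swap a)}"
    using c a by (intro finite_interval) (auto simp: down_def orientations_swap)
  moreover have "{d \<in> S. osep_ge d (prod.swap c)} \<subseteq> prod.swap ` {d \<in> orientations N. osep_ge c d \<and> osep_ge d (prod.swap a)}"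
    unfolding S_def using osep_ge_swap by blast
  ultimately have "finite {d \<in> S. osep_ge d (prod.swap c)}"
    using finite_surj by blast
  then obtain m' where m': "m' \<in> S" "osep_ge m' (prod.swap c)" "\<And>d. d \<in> S \<Longrightarrow> osep_ge d m' \<Longrightarrow> d = m'"
    using obtain_minimal_in_interval[OF cS] by blast
  define m where "m = prod.swap m'"
  obtain d where "m' = prod.swap d" "d \<in> orientations N" "osep_ge d (prod.swap a)" "d \<noteq> prod.swap a"
    using m'(1) by (auto simp only: S_def)
  moreover from this have "osep_ge c d" using m'(2) by (simp add: osep_ge_swap)
  ultimately have m: "m \<in> orientations N" "osep_ge m (prod.swap a)" "m \<noteq> prod.swap a" "osep_ge c m"
    by (simp_all add: m_def)
  then have md: "m \<in> down a" by (simp add: down_def)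
  have "d = m" if d: "d \<in> down a" "osep_ge m d" for d
  proof -
    have "\<not> osep_ge d a" using not_ge_both[OF m(1)] m(2) d(2) osep_ge_trans by blast
    then have "prod.swap d \<in> S" using d(1) by (auto simp: down_def S_def)
    moreover have "osep_ge (prod.swap d) m'" using d(2) by (simp add: m_def osep_ge_swap_left)
    ultimately have "prod.swap d = m'" using m'(3) by blast
    then show ?thesis by (auto simp: m_def)
  qed
  then have "m \<in> star_at a" using md by (simp add: star_at_def)
  then show ?thesis using that m by blast
qed

lemma splitting_starsD:
  assumes "\<sigma> \<in> splitting_stars N"
  shows "\<sigma> \<subseteq> orientations N" "\<And>a b. a \<in> \<sigma> \<Longrightarrow> b \<in> \<sigma> \<Longrightarrow> a \<noteq> b \<Longrightarrow> osep_ge a (prod.swap b)"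
    "\<And>a. a \<in> \<sigma> \<Longrightarrow> prod.swap a \<notin> \<sigma>"
    "\<And>c. c \<in> orientations N \<Longrightarrow> \<exists>b\<in>\<sigma>. osep_ge c b \<or> osep_ge (prod.swap c) b"
proof -
  have s: "\<sigma> \<subseteq> orientations N" "star \<sigma>" "\<nexists>A B. (A, B) \<in> \<sigma> \<and> (B, A) \<in> \<sigma>"
    "\<forall>s\<in>N. \<exists>a. unorient a = s \<and> (\<exists>b\<in>\<sigma>. osep_ge a b)"
    using assms by (auto simp: splitting_stars_def)
  show "\<sigma> \<subseteq> orientations N" by (rule s)
  show "osep_ge a (prod.swap b)" if "a \<in> \<sigma>" "b \<in> \<sigma>" "a \<noteq> b" for a b
    using s(2) that by (auto simp: star_def)
  show "prod.swap a \<notin> \<sigma>" if "a \<in> \<sigma>" for a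
    using s(3) that by (cases a) auto
  show "\<exists>b\<in>\<sigma>. osep_ge c b \<or> osep_ge (prod.swap c) b" if "c \<in> orientations N" for c
    using s(4) that unorient_eq_iff unfolding orientations_def by (metis (mono_tags, lifting) mem_Collect_eq)
qed

lemma star_at_splitting:
  assumes a: "a \<in> orientations N"
  shows "star_at a \<in> splitting_stars N"
  unfolding splitting_stars_def
proof (rule CollectI, intro conjI ballI)
  have sub: "star_at a \<subseteq> down a" by (auto simp: star_at_def)
  show "star_at a \<subseteq> orientations N" using sub by (auto simp: down_def)
  show "star (star_at a)"
    unfolding star_def
  proof (intro ballI impI)
    fix b c assume bc: "b \<in> star_at a" "c \<in> star_at a" "b \<noteq> c"
    then have "\<not> osep_ge (prod.swap c) b" using down_consistent[OF a] sub by blast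
    moreover have "\<not> osep_ge b c" "\<not> osep_ge c b" using bc unfolding star_at_def by auto
    ultimately show "osep_ge b (prod.swap c)"
      using cases_nested[of b c] bc sub by (auto simp: down_def)
  qed
  show "\<nexists>A B. (A, B) \<in> star_at a \<and> (B, A) \<in> star_at a"
  proof
    assume "\<exists>A B. (A, B) \<in> star_at a \<and> (B, A) \<in> star_at a"
    then obtain A B where AB: "(A, B) \<in> down a" "(B, A) \<in> down a" using sub by blast
    show False using down_consistent[OF a AB] by (simp add: osep_ge_refl)
  qed
  fix s assume s: "s \<in> N"
  then obtain c where c: "unorient c = s" using N_nested[OF s s] by (auto simp: nested_def)
  then have "c \<in> orientations N" using s by (simp add: orientations_def)
  then obtain c' where c': "c' \<in> down a" "unorient c' = s"
    using down_total[OF a] c unorient_swap by metis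
  obtain m where "m \<in> star_at a" "osep_ge c' m" using down_below_star_at[OF a c'(1)] by blast
  then show "\<exists>c. unorient c = s \<and> (\<exists>b\<in>star_at a. osep_ge c b)" using c'(2) by blast
qed

text \<open>A splitting star through \<open>a\<close> consists of lowest elements of an orientation
  of \<open>N\<close>, and \<open>a\<close> already determines this orientation as
  \<open>down a\<close>.\<close>

lemma splitting_star_unique:
  assumes \<sigma>: "\<sigma> \<in> splitting_stars N" and a: "a \<in> \<sigma>"
  shows "\<sigma> = star_at a"
proof -
  have aN: "a \<in> orientations N" using splitting_starsD(1)[OF \<sigma>] a by blast
  have sub: "\<sigma> \<subseteq> down a"
  proof
    fix b assume b: "b \<in> \<sigma>"
    show "b \<in> down a"
    proof (cases "b = a")
      case False
      then have "osep_ge b (prod.swap a)" by (rule splitting_starsD(2)[OF \<sigma> b a])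
      moreover have "b \<noteq> prod.swap a" using splitting_starsD(3)[OF \<sigma> a] b by blast
      ultimately show ?thesis using splitting_starsD(1)[OF \<sigma>] b by (auto simp: down_def)
    qed (use aN in \<open>simp add: down_def osep_ge_refl\<close>)
  qed
  have below: "\<exists>d\<in>\<sigma>. osep_ge c d" if c: "c \<in> down a" for c
  proof -
    have cN: "c \<in> orientations N" using c by (simp add: down_def)
    obtain d where d: "d \<in> \<sigma>" "osep_ge c d \<or> osep_ge (prod.swap c) d"
      using splitting_starsD(4)[OF \<sigma> cN] by blast
    moreover have "\<not> osep_ge (prod.swap c) d" using down_consistent[OF aN c] sub d(1) by blast
    ultimately show ?thesis by blast
  qed
  show ?thesis
  proof
    show "\<sigma> \<subseteq> star_at a"
    proof
      fix b assume b: "b \<in> \<sigma>"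
      have "c = b" if c: "c \<in> down a" "osep_ge b c" for c
      proof -
        obtain d where d: "d \<in> \<sigma>" "osep_ge c d" using below[OF c(1)] by blast
        have bN: "b \<in> orientations N" using splitting_starsD(1)[OF \<sigma>] b by blast
        have bd: "osep_ge b d" using c(2) d(2) osep_ge_trans by blast
        have "d = b"
          using splitting_starsD(2)[OF \<sigma> b d(1)] not_ge_both[OF bN bd] by blast
        then show ?thesis using d(2) c(2) osep_ge_antisym by blast
      qed
      then show "b \<in> star_at a" using sub b by (auto simp: star_at_def)
    qed
    show "star_at a \<subseteq> \<sigma>"
    proof
      fix m assume m: "m \<in> star_at a"
      then obtain d where d: "d \<in> \<sigma>" "osep_ge m d" using below unfolding star_at_def by blast
      then have "d = m" using m sub by (auto simp: star_at_def)
      then show "m \<in> \<sigma>" using d by simp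
    qed
  qed
qed

section \<open>The decomposition tree is a tree\<close>

lemma well_defined: "decomp_tree_well_defined N"
  unfolding decomp_tree_well_defined_def
proof (intro conjI ballI)
  show "\<exists>!\<sigma>. \<sigma> \<in> splitting_stars N \<and> a \<in> \<sigma>" if a: "a \<in> orientations N" for a
    using star_at_splitting[OF a] self_in_star_at[OF a] splitting_star_unique by blast
qed (rule N_nested)

lemma star_containing_eq: "a \<in> orientations N \<Longrightarrow> star_containing N a = star_at a"
  unfolding star_containing_def
  using star_at_splitting self_in_star_at splitting_star_unique by (intro the_equality) blast+

abbreviation T where "T \<equiv> decomp_tree N"

lemma T_simps [simp]:
  "verts T = splitting_stars N" "arcs T = orientations N"
  "a \<in> orientations N \<Longrightarrow> tail T a = star_at a"
  "a \<in> orientations N \<Longrightarrow> head T a = star_at (prod.swap a)"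
  by (simp_all add: decomp_tree_def star_containing_eq orientations_swap)

lemma swap_in_star_at: "a \<in> orientations N \<Longrightarrow> prod.swap a \<in> star_at (prod.swap a)"
  by (simp add: self_in_star_at orientations_swap)

lemma arcs_ends_T:
  "(\<sigma>, \<tau>) \<in> arcs_ends T \<longleftrightarrow> (\<exists>a\<in>orientations N. \<sigma> = star_at a \<and> \<tau> = star_at (prod.swap a))"
  unfolding arcs_ends_conv by auto

lemma star_at_ne_swap: "a \<in> orientations N \<Longrightarrow> star_at a \<noteq> star_at (prod.swap a)"
  using splitting_starsD(3)[OF star_at_splitting self_in_star_at] swap_in_star_at by metis

lemma star_at_eqI: "a \<in> orientations N \<Longrightarrow> b \<in> star_at a \<Longrightarrow> star_at b = star_at a"
  using splitting_star_unique[OF star_at_splitting] by metis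

text \<open>If both pairs of ends agree, the star property at the two nodes gives inequalities in
  both directions, hence \<open>a = prod.swap b\<close>, and one star would contain both
  orientations.\<close>

lemma edge_unique:
  assumes "a \<in> orientations N" "b \<in> orientations N" "star_at a = star_at b"
    "star_at (prod.swap a) = star_at (prod.swap b)"
  shows "a = b"
proof (rule ccontr)
  assume ne: "a \<noteq> b"
  have sa: "prod.swap a \<in> orientations N" "prod.swap b \<in> orientations N" using assms by (simp_all add: orientations_swap)
  have "osep_ge a (prod.swap b)"
    using splitting_starsD(2)[OF star_at_splitting[OF assms(1)] self_in_star_at[OF assms(1)] _ ne]
      self_in_star_at[OF assms(2)] assms(3) by simp
  moreover have "osep_ge (prod.swap a) (prod.swap (prod.swap b))"
    using splitting_starsD(2)[OF star_at_splitting[OF sa(1)] self_in_star_at[OF sa(1)], of "prod.swap b"]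
      self_in_star_at[OF sa(2)] assms(4) ne swap_swap by metis
  then have "osep_ge (prod.swap b) a" by (simp add: osep_ge_swap_left)
  ultimately have "a = prod.swap b" by (rule osep_ge_antisym)
  then show False
    using splitting_starsD(3)[OF star_at_splitting[OF assms(2)] self_in_star_at[OF assms(2)]]
      self_in_star_at[OF assms(1)] assms(3) by simp
qed

lemma wf_T: "wf_digraph T"
  by unfold_locales (simp_all add: star_at_splitting orientations_swap)

lemma sym_T: "sym_digraph T"
proof -
  interpret wf_digraph T by (rule wf_T)
  show ?thesis
  proof
    show "symmetric T"
      unfolding symmetric_def
    proof (rule symI)
      fix \<sigma> \<tau> assume "(\<sigma>, \<tau>) \<in> arcs_ends T"
      then obtain a where "a \<in> orientations N" "\<sigma> = star_at a" "\<tau> = star_at (prod.swap a)"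
        by (auto simp: arcs_ends_T)
      then show "(\<tau>, \<sigma>) \<in> arcs_ends T"
        unfolding arcs_ends_T by (intro bexI[of _ "prod.swap a"]) (simp_all add: orientations_swap)
    qed
  qed
qed

lemma loopfree_T: "loopfree_digraph T"
proof -
  interpret wf_digraph T by (rule wf_T)
  show ?thesis by unfold_locales (simp add: star_at_ne_swap)
qed

lemma nomulti_T: "nomulti_digraph T"
proof -
  interpret wf_digraph T by (rule wf_T)
  show ?thesis
  proof
    fix a b assume "a \<in> arcs T" "b \<in> arcs T" "arc_to_ends T a = arc_to_ends T b"
    then show "a = b" by (intro edge_unique) (simp_all add: arc_to_ends_def)
  qed
qed

lemma reachable_swap: "a \<in> orientations N \<Longrightarrow> star_at a \<rightarrow>\<^sup>*\<^bsub>T\<^esub> star_at (prod.swap a)"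
proof -
  interpret wf_digraph T by (rule wf_T)
  assume "a \<in> orientations N"
  then show ?thesis by (intro adj_in_verts reachable_adjI) (auto simp: arcs_ends_T)
qed

text \<open>Induction on the size of the interval: the next element \<open>c\<close> below
  \<open>a\<close> is an edge leaving the node \<open>star_at a\<close>.\<close>

lemma reachable_le:
  assumes "a \<in> orientations N" "b \<in> orientations N" "osep_ge a b"
  shows "star_at a \<rightarrow>\<^sup>*\<^bsub>T\<^esub> star_at b"
  using assms
proof (induct "card {c \<in> orientations N. osep_ge a c \<and> osep_ge c b}" arbitrary: a rule: less_induct)
  case less
  interpret wf_digraph T by (rule wf_T)
  note a = less.prems(1) and b = less.prems(2) and ab = less.prems(3)
  note fin = finite_interval[OF a b]
  show ?case
  proof (cases "a = b")
    case True
    then show ?thesis using a by (simp add: star_at_splitting)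
  next
    case False
    define S where "S = {c \<in> orientations N. osep_ge a c \<and> c \<noteq> a}"
    have "b \<in> S" using b ab False by (auto simp: S_def)
    moreover have "finite {d \<in> S. osep_ge d b}"
      by (rule finite_subset[OF _ fin]) (auto simp: S_def)
    ultimately obtain c where c: "c \<in> S" "osep_ge c b" and min: "\<And>d. d \<in> S \<Longrightarrow> osep_ge d c \<Longrightarrow> d = c"
      by (rule obtain_minimal_in_interval) blast
    have cN: "c \<in> orientations N" "osep_ge a c" "c \<noteq> a" using c(1) by (auto simp: S_def)
    have scN: "prod.swap c \<in> orientations N" using cN by (simp add: orientations_swap)
    have le: "osep_ge (prod.swap c) (prod.swap a)" using cN(2) by (simp add: osep_ge_swap)
    have "prod.swap c \<noteq> prod.swap a" using cN(3) by (metis swap_swap)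
    then have "prod.swap c \<in> down a" using le scN by (simp add: down_def)
    moreover have "d = prod.swap c" if d: "d \<in> down a" "osep_ge (prod.swap c) d" for d
    proof -
      have "\<not> osep_ge d a" using not_ge_both[OF scN] le d(2) osep_ge_trans by blast
      then have "d \<in> orientations N" "osep_ge d (prod.swap a)" "d \<noteq> prod.swap a"
        using d(1) by (auto simp: down_def)
      then have "prod.swap d \<in> S"
        using osep_ge_swap_right[of d a] by (auto simp: S_def orientations_swap)
      moreover have "osep_ge (prod.swap d) c" using d(2) by (simp add: osep_ge_swap_left)
      ultimately have "prod.swap d = c" by (rule min)
      then show ?thesis by auto
    qed
    \<comment> \<open>Nothing lies strictly between \<open>a\<close> and \<open>c\<close>, so the
      reverse of \<open>c\<close> is lowest in \<open>down a\<close>.\<close>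
    ultimately have "prod.swap c \<in> star_at a" by (simp add: star_at_def)
    then have eq: "star_at (prod.swap c) = star_at a" by (rule star_at_eqI[OF a])
    have "star_at a \<rightarrow>\<^sup>*\<^bsub>T\<^esub> star_at c"
      using reachable_swap[OF scN] eq by simp
    moreover have "star_at c \<rightarrow>\<^sup>*\<^bsub>T\<^esub> star_at b"
    proof (rule less.hyps[OF _ cN(1) b c(2)])
      have "a \<notin> {d \<in> orientations N. osep_ge c d \<and> osep_ge d b}"
        using osep_ge_antisym[OF cN(2)] cN(3) by blast
      moreover have "a \<in> {d \<in> orientations N. osep_ge a d \<and> osep_ge d b}"
        using a ab osep_ge_refl by blast
      moreover have "{d \<in> orientations N. osep_ge c d \<and> osep_ge d b} \<subseteq> {d \<in> orientations N. osep_ge a d \<and> osep_ge d b}"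
        using osep_ge_trans[OF cN(2)] by blast
      ultimately show "card {d \<in> orientations N. osep_ge c d \<and> osep_ge d b} < card {d \<in> orientations N. osep_ge a d \<and> osep_ge d b}"
        by (intro psubset_card_mono[OF fin]) blast
    qed
    ultimately show ?thesis by (rule reachable_trans)
  qed
qed

lemma reachable_T:
  assumes "\<sigma> \<in> splitting_stars N" "\<tau> \<in> splitting_stars N"
  shows "\<sigma> \<rightarrow>\<^sup>*\<^bsub>T\<^esub> \<tau>"
proof -
  interpret sym_digraph T by (rule sym_T)
  have symr: "\<tau> \<rightarrow>\<^sup>*\<^bsub>T\<^esub> \<sigma>" if "\<sigma> \<rightarrow>\<^sup>*\<^bsub>T\<^esub> \<tau>" for \<sigma> \<tau>
    using that symmetric_reachable[OF sym_arcs] by blast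
  show ?thesis
  proof (cases "\<sigma> = {} \<or> \<tau> = {}")
    case True
    then have "orientations N = {}"
      using splitting_starsD(4)[OF assms(1)] splitting_starsD(4)[OF assms(2)] by blast
    then have "\<sigma> = \<tau>" using splitting_starsD(1)[OF assms(1)] splitting_starsD(1)[OF assms(2)] by blast
    then show ?thesis using assms by simp
  next
    case False
    then obtain a b where ab: "a \<in> \<sigma>" "b \<in> \<tau>" by blast
    have N: "a \<in> orientations N" "b \<in> orientations N" "prod.swap b \<in> orientations N"
      using splitting_starsD(1)[OF assms(1)] splitting_starsD(1)[OF assms(2)] ab by (auto simp: orientations_swap)
    have eq: "\<sigma> = star_at a" "\<tau> = star_at b"
      using splitting_star_unique assms ab by auto
    have sw: "star_at (prod.swap b) \<rightarrow>\<^sup>*\<^bsub>T\<^esub> star_at b" using reachable_swap[OF N(3)] by simp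
    show ?thesis
      using cases_nested[OF N(1,2)] reachable_le N symr sw reachable_trans unfolding eq by metis
  qed
qed

lemma connected_T: "connected T"
proof -
  interpret wf_digraph T by (rule wf_T)
  have "splitting_stars N \<noteq> {}"
  proof (cases "orientations N = {}")
    case True
    then have "N = {}" using N_nested unfolding nested_def orientations_def by fast
    then show ?thesis by (auto simp: splitting_stars_def star_def)
  qed (use star_at_splitting in blast)
  then show ?thesis
    by (intro connectedI) (auto intro!: reachable_mk_symmetricI reachable_T)
qed

text \<open>Consecutive edges at a node are elements of one star, so as long as the walk does not
  turn back, their orientations along the walk are monotone.\<close>

lemma walk_arcs_T:
  assumes "vwalk P T"
  obtains e where "\<And>i. Suc i < length P \<Longrightarrow> e i \<in> orientations N \<and> P ! i = star_at (e i) \<and> P ! Suc i = star_at (prod.swap (e i))"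
    "\<And>i. Suc (Suc i) < length P \<Longrightarrow> P ! i \<noteq> P ! Suc (Suc i) \<Longrightarrow> osep_ge (e (Suc i)) (e i)"
proof -
  have "(P ! i, P ! Suc i) \<in> arcs_ends T" if i: "Suc i < length P" for i
  proof -
    have "successively (\<lambda>u v. (u, v) \<in> arcs_ends T) Q" if "set (vwalk_arcs Q) \<subseteq> arcs_ends T" for Q
      using that by (induct Q rule: vwalk_arcs.induct) auto
    then have "successively (\<lambda>u v. (u, v) \<in> arcs_ends T) P" using assms by (simp add: vwalk_def)
    then show ?thesis using i by (simp add: successively_conv_nth)
  qed
  then have "\<exists>a. Suc i < length P \<longrightarrow> a \<in> orientations N \<and> P ! i = star_at a \<and> P ! Suc i = star_at (prod.swap a)" for i
    unfolding arcs_ends_T by blast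
  then obtain e where e: "\<And>i. Suc i < length P \<Longrightarrow> e i \<in> orientations N \<and> P ! i = star_at (e i) \<and> P ! Suc i = star_at (prod.swap (e i))"
    by metis
  have "osep_ge (e (Suc i)) (e i)" if i: "Suc (Suc i) < length P" "P ! i \<noteq> P ! Suc (Suc i)" for i
  proof -
    have e1: "e i \<in> orientations N" "P ! i = star_at (e i)" "P ! Suc i = star_at (prod.swap (e i))"
      and e2: "e (Suc i) \<in> orientations N" "P ! Suc i = star_at (e (Suc i))" "P ! Suc (Suc i) = star_at (prod.swap (e (Suc i)))"
      using e[of i] e[of "Suc i"] i(1) by auto
    have "e (Suc i) \<noteq> prod.swap (e i)" using e1 e2 i(2) by auto
    moreover have "prod.swap (e i) \<in> star_at (e (Suc i))" using swap_in_star_at[OF e1(1)] e1(3) e2(2) by simp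
    ultimately have "osep_ge (e (Suc i)) (prod.swap (prod.swap (e i)))"
      by (intro splitting_starsD(2)[OF star_at_splitting[OF e2(1)] self_in_star_at[OF e2(1)]]) auto
    then show ?thesis by simp
  qed
  then show ?thesis using that e by blast
qed

lemma antimono_chain:
  assumes "\<And>i. i < n \<Longrightarrow> osep_ge (e (Suc i)) (e i)" "i \<le> j" "j \<le> n"
  shows "osep_ge (e j) (e i)"
  using assms(2,3)
proof (induct j rule: dec_induct)
  case (step j)
  then show ?case using assms(1)[of j] osep_ge_trans by (meson Suc_leD Suc_le_lessD)
qed (rule osep_ge_refl)

text \<open>Orientations grow along the cycle, and the comparison at the closing node shows that the
  last edge is at most the first. So they are equal, and two distinct nodes of the cycle
  coincide.\<close>

lemma acyclic_T: "\<nexists>Z. graph_cycle T Z"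
proof
  assume "\<exists>Z. graph_cycle T Z"
  then obtain vs where vs: "3 \<le> length vs" "distinct vs" "vwalk (vs @ [hd vs]) T"
    by (auto simp: graph_cycle_def)
  define P where "P = vs @ [hd vs]"
  define n where "n = length vs"
  have len: "length P = Suc n" "3 \<le> n" using vs by (auto simp: P_def n_def)
  have P: "P ! i = vs ! i" if "i < n" for i using that by (simp add: P_def n_def nth_append)
  have Pn: "P ! n = vs ! 0" using vs(1) by (cases vs) (auto simp: P_def n_def nth_append)
  have d: "vs ! i \<noteq> vs ! j" if "i < n" "j < n" "i \<noteq> j" for i j
    using that vs(2) by (simp add: n_def nth_eq_iff_index_eq)
  obtain e where e: "\<And>i. Suc i < length P \<Longrightarrow> e i \<in> orientations N \<and> P ! i = star_at (e i) \<and> P ! Suc i = star_at (prod.swap (e i))"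
    and dec: "\<And>i. Suc (Suc i) < length P \<Longrightarrow> P ! i \<noteq> P ! Suc (Suc i) \<Longrightarrow> osep_ge (e (Suc i)) (e i)"
    using walk_arcs_T[OF vs(3)[folded P_def]] by blast
  have step: "osep_ge (e (Suc i)) (e i)" if "i < n - 1" for i
  proof (rule dec)
    show "Suc (Suc i) < length P" using that len by simp
    show "P ! i \<noteq> P ! Suc (Suc i)"
    proof (cases "Suc (Suc i) < n")
      case False
      then have "Suc (Suc i) = n" using that by linarith
      then show ?thesis using P[of i] Pn d[of i 0] len(2) by auto
    qed (use P d that in auto)
  qed
  have down: "osep_ge (e (n - 1)) (e 0)"
    using antimono_chain[of "n - 1" e 0 "n - 1"] step by simp
  have e0: "e 0 \<in> orientations N" "vs ! 0 = star_at (e 0)" "vs ! 1 = star_at (prod.swap (e 0))"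
    using e[of 0] P[of 0] P[of 1] len by auto
  have el: "e (n - 1) \<in> orientations N" "vs ! (n - 1) = star_at (e (n - 1))" "vs ! 0 = star_at (prod.swap (e (n - 1)))"
    using e[of "n - 1"] P[of "n - 1"] Pn len by auto
  have "e 0 \<noteq> prod.swap (e (n - 1))"
  proof
    assume "e 0 = prod.swap (e (n - 1))"
    then have "vs ! 1 = vs ! (n - 1)" using e0(3) el(2) by simp
    moreover have "1 < n" "n - 1 < n" "1 \<noteq> n - 1" using len(2) by linarith+
    ultimately show False using d by blast
  qed
  moreover have "prod.swap (e (n - 1)) \<in> star_at (e 0)"
    using swap_in_star_at[OF el(1)] el(3) e0(2) by simp
  ultimately have "osep_ge (e 0) (prod.swap (prod.swap (e (n - 1))))"
    by (intro splitting_starsD(2)[OF star_at_splitting[OF e0(1)] self_in_star_at[OF e0(1)]]) auto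
  then have "e 0 = e (n - 1)" using down osep_ge_antisym by simp
  then show False using e0(2) el(2) d[of 0 "n - 1"] len(2) by simp
qed

lemma graph_tree_T: "graph_tree T"
  unfolding graph_tree_def using sym_T loopfree_T nomulti_T connected_T acyclic_T by blast

text \<open>By monotonicity along the path, a vertex in both end parts lies on both sides of the
  edge leaving \<open>t\<close>, hence in its separator, which is contained in the part at
  \<open>t\<close>.\<close>

lemma part_path:
  assumes P: "vpath P T" and t: "t \<in> set P"
  shows "part G (hd P) \<inter> part G (last P) \<subseteq> part G t"
proof
  fix v assume v: "v \<in> part G (hd P) \<inter> part G (last P)"
  have w: "vwalk P T" "distinct P" "P \<noteq> []" using P by (auto simp: vpath_def vwalk_def)
  define m where "m = length P - 1"
  have len: "length P = Suc m" using w(3) by (cases P) (auto simp: m_def)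
  have hl: "hd P = P ! 0" "last P = P ! m"
    using w(3) by (simp_all add: hd_conv_nth last_conv_nth m_def)
  obtain i where i: "i \<le> m" "t = P ! i" using t len by (metis in_set_conv_nth less_Suc_eq_le)
  show "v \<in> part G t"
  proof (cases "i = 0 \<or> i = m")
    case True
    then show ?thesis using v hl i by auto
  next
    case False
    then have im: "0 < i" "i < m" using i by auto
    obtain e where e: "\<And>i. Suc i < length P \<Longrightarrow> e i \<in> orientations N \<and> P ! i = star_at (e i) \<and> P ! Suc i = star_at (prod.swap (e i))"
      and dec: "\<And>i. Suc (Suc i) < length P \<Longrightarrow> P ! i \<noteq> P ! Suc (Suc i) \<Longrightarrow> osep_ge (e (Suc i)) (e i)"
      using walk_arcs_T[OF w(1)] by blast
    have step: "osep_ge (e (Suc i)) (e i)" if "i < m - 1" for i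
      by (rule dec) (use that len w(2) in \<open>auto simp: nth_eq_iff_index_eq\<close>)
    have e0: "e 0 \<in> orientations N" "P ! 0 = star_at (e 0)" using e[of 0] len im by auto
    have el: "e (m - 1) \<in> orientations N" "P ! m = star_at (prod.swap (e (m - 1)))"
      using e[of "m - 1"] len im by auto
    have ei: "e i \<in> orientations N" "t = star_at (e i)" using e[of i] len im i by auto
    have "v \<in> snd (e 0)" "v \<in> pverts G"
      using v self_in_star_at[OF e0(1)] e0(2) hl by (auto simp: part_def)
    moreover have "osep_ge (e i) (e 0)" using antimono_chain[of "m - 1" e 0 i] step im by simp
    ultimately have vs: "v \<in> snd (e i)" by (auto simp: osep_ge_def)
    have "v \<in> snd (prod.swap (e (m - 1)))"
      using v swap_in_star_at[OF el(1)] el(2) hl unfolding part_def by auto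
    moreover have "osep_ge (e (m - 1)) (e i)" using antimono_chain[of "m - 1" e i "m - 1"] step im by simp
    ultimately have vf: "v \<in> fst (e i)" by (auto simp: osep_ge_def)
    have "v \<in> snd d" if d: "d \<in> t" for d
    proof (cases "d = e i")
      case False
      then have "osep_ge d (prod.swap (e i))"
        using splitting_starsD(2)[OF star_at_splitting[OF ei(1)] _ self_in_star_at[OF ei(1)]] d ei(2) by blast
      then show ?thesis using vf by (auto simp: osep_ge_def)
    qed (use vs in simp)
    then show ?thesis using \<open>v \<in> pverts G\<close> by (simp add: part_def)
  qed
qed

lemma delete_edge_swap: "a \<in> orientations N \<Longrightarrow> delete_edge T (prod.swap a) = delete_edge T a"
  unfolding delete_edge_def by (simp add: orientations_swap insert_commute)

lemma delete_edge_arc: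
  assumes "a \<in> orientations N" "(\<sigma>, \<tau>) \<in> arcs_ends (delete_edge T a)"
  obtains f where "f \<in> orientations N" "\<sigma> = star_at f" "\<tau> = star_at (prod.swap f)" "f \<noteq> a" "f \<noteq> prod.swap a"
proof -
  obtain f where f: "f \<in> arcs (delete_edge T a)" "\<sigma> = tail (delete_edge T a) f" "\<tau> = head (delete_edge T a) f"
    using assms(2) by (auto simp: arcs_ends_conv)
  have "tail (delete_edge T a) = tail T" "head (delete_edge T a) = head T"
    "arcs (delete_edge T a) = {f \<in> arcs T. {tail T f, head T f} \<noteq> {tail T a, head T a}}"
    unfolding delete_edge_def by simp_all
  then have "f \<in> orientations N" "{tail T f, head T f} \<noteq> {tail T a, head T a}"
    "\<sigma> = tail T f" "\<tau> = head T f"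
    using f by (auto simp only: mem_Collect_eq T_simps(2))
  moreover from this have "f \<noteq> a" "f \<noteq> prod.swap a"
    using assms(1) by (auto simp: orientations_swap insert_commute)
  ultimately show ?thesis using that by simp
qed

text \<open>The invariant along walks avoiding the edge \<open>a\<close>: the current star has an
  element below \<open>a\<close>. It confines the part at that star to \<open>snd a\<close>.\<close>

lemma delete_edge_side:
  assumes a: "a \<in> orientations N" and u: "star_at a \<rightarrow>\<^sup>*\<^bsub>delete_edge T a\<^esub> u"
  shows "\<exists>d\<in>u. osep_ge a d"
  using u unfolding reachable_def
proof (induct rule: rtrancl_on_induct)
  case base
  then show ?case using self_in_star_at[OF a] osep_ge_refl by blast
next
  case (step \<sigma> \<tau>)
  obtain f where f: "f \<in> orientations N" "\<sigma> = star_at f" "\<tau> = star_at (prod.swap f)" "f \<noteq> a" "f \<noteq> prod.swap a"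
    using delete_edge_arc[OF a step(2)] by blast
  have sf: "prod.swap f \<in> orientations N" using f by (simp add: orientations_swap)
  obtain d where d: "d \<in> \<sigma>" "osep_ge a d" using step by blast
  note tau = star_at_splitting[OF sf, folded f(3)]
  show ?case
  proof (cases "d = f")
    case False
    then have "osep_ge d (prod.swap f)"
      using splitting_starsD(2)[OF star_at_splitting[OF f(1)] _ self_in_star_at[OF f(1)]] d f(2) by blast
    then show ?thesis using osep_ge_trans[OF d(2)] self_in_star_at[OF sf] f(3) by blast
  next
    case True
    then have af: "osep_ge a f" using d by simp
    obtain b where b: "b \<in> \<tau>" "osep_ge a b \<or> osep_ge (prod.swap a) b"
      using splitting_starsD(4)[OF tau a] by blast
    \<comment> \<open>Either \<open>b\<close> is the reverse of \<open>f\<close>, and then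
      \<open>f = a\<close>, or \<open>b\<close> is above \<open>f\<close>, and then the reverse of
      \<open>f\<close> is above \<open>f\<close>, contradicting \<open>proper\<close>.\<close>
    have "\<not> osep_ge (prod.swap a) b"
    proof
      assume sab: "osep_ge (prod.swap a) b"
      show False
      proof (cases "b = prod.swap f")
        case True
        then have "osep_ge f a" using sab by (simp add: osep_ge_swap)
        then show False using osep_ge_antisym[OF af] f(4) by simp
      next
        case False
        have "prod.swap f \<in> \<tau>" using self_in_star_at[OF sf] f(3) by simp
        from splitting_starsD(2)[OF tau b(1) this False] have "osep_ge b f" by simp
        then have "osep_ge (prod.swap a) f" using sab osep_ge_trans by blast
        then have "osep_ge (prod.swap f) a" by (simp add: osep_ge_swap_left)
        then have "osep_ge (prod.swap f) f" using af osep_ge_trans by blast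
        then show False using not_ge_swap[OF sf] by simp
      qed
    qed
    then show ?thesis using b by blast
  qed
qed

lemma delete_edge_reachable:
  assumes a: "a \<in> orientations N" and u: "u \<in> splitting_stars N"
  shows "star_at a \<rightarrow>\<^sup>*\<^bsub>delete_edge T a\<^esub> u \<or> star_at (prod.swap a) \<rightarrow>\<^sup>*\<^bsub>delete_edge T a\<^esub> u"
proof -
  have verts: "verts (delete_edge T a) = splitting_stars N" by (simp add: delete_edge_def)
  have sa: "prod.swap a \<in> orientations N" using a by (simp add: orientations_swap)
  have "star_at a \<rightarrow>\<^sup>*\<^bsub>T\<^esub> u" using reachable_T star_at_splitting[OF a] u by blast
  then show ?thesis
    unfolding reachable_def
  proof (induct rule: rtrancl_on_induct)
    case base
    then show ?case by (simp add: verts)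
  next
    case (step \<sigma> \<tau>)
    obtain f where f: "f \<in> orientations N" "\<sigma> = star_at f" "\<tau> = star_at (prod.swap f)"
      using step(2) by (auto simp: arcs_ends_T)
    show ?case
    proof (cases "{tail T f, head T f} = {tail T a, head T a}")
      case True
      then have "\<tau> = star_at a \<or> \<tau> = star_at (prod.swap a)" using f a by (auto simp: doubleton_eq_iff)
      then show ?thesis using star_at_splitting[OF a] star_at_splitting[OF sa] by (auto simp: verts)
    next
      case False
      then have "f \<in> arcs (delete_edge T a)" using f(1) by (simp add: delete_edge_def)
      moreover have "tail (delete_edge T a) f = \<sigma>" "head (delete_edge T a) f = \<tau>"
        using f by (simp_all add: delete_edge_def)
      ultimately have "(\<sigma>, \<tau>) \<in> arcs_ends (delete_edge T a)" unfolding arcs_ends_conv by force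
      moreover have "\<tau> \<in> verts (delete_edge T a)" using step by (simp add: verts)
      ultimately show ?thesis using step(5) by (auto intro: rtrancl_on_into_rtrancl_on)
    qed
  qed
qed

text \<open>A vertex of \<open>snd a\<close> in a part on the far side is also in
  \<open>fst a\<close>. It is thus in the separator, and hence in the part at
  \<open>star_at a\<close> itself.\<close>

lemma tree_side_eq:
  assumes a: "a \<in> orientations N" and sub: "snd a \<subseteq> pverts G"
    and cover: "pverts G \<subseteq> (\<Union>u\<in>splitting_stars N. part G u)"
  shows "tree_side T (part G) a (star_at a) = snd a"
proof
  have sa: "prod.swap a \<in> orientations N" using a by (simp add: orientations_swap)
  have side: "part G u \<subseteq> snd a" if "star_at a \<rightarrow>\<^sup>*\<^bsub>delete_edge T a\<^esub> u" for u
    using delete_edge_side[OF a that] by (auto simp: part_def osep_ge_def)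
  have side': "part G u \<subseteq> fst a" if "star_at (prod.swap a) \<rightarrow>\<^sup>*\<^bsub>delete_edge T a\<^esub> u" for u
    using delete_edge_side[OF sa] that delete_edge_swap[OF a] by (fastforce simp: part_def osep_ge_def)
  show "tree_side T (part G) a (star_at a) \<subseteq> snd a"
    using side by (auto simp: tree_side_def)
  show "snd a \<subseteq> tree_side T (part G) a (star_at a)"
  proof
    fix v assume v: "v \<in> snd a"
    then obtain u where u: "u \<in> splitting_stars N" "v \<in> part G u" using sub cover by blast
    have self: "star_at a \<rightarrow>\<^sup>*\<^bsub>delete_edge T a\<^esub> star_at a"
      using star_at_splitting[OF a] by (simp add: reachable_def delete_edge_def)
    from delete_edge_reachable[OF a u(1)]
    show "v \<in> tree_side T (part G) a (star_at a)"
    proof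
      assume "star_at a \<rightarrow>\<^sup>*\<^bsub>delete_edge T a\<^esub> u"
      then show ?thesis using u by (auto simp: tree_side_def)
    next
      assume "star_at (prod.swap a) \<rightarrow>\<^sup>*\<^bsub>delete_edge T a\<^esub> u"
      then have vf: "v \<in> fst a" using side' u by blast
      have "v \<in> snd d" if d: "d \<in> star_at a" for d
      proof (cases "d = a")
        case False
        then have "osep_ge d (prod.swap a)"
          using splitting_starsD(2)[OF star_at_splitting[OF a] d self_in_star_at[OF a]] by blast
        then show ?thesis using vf by (auto simp: osep_ge_def)
      qed (use v in simp)
      then have "v \<in> part G (star_at a)" using v sub by (auto simp: part_def)
      then show ?thesis using self by (auto simp: tree_side_def)
    qed
  qed
qed

lemma induced_separation_eq:
  assumes a: "a \<in> orientations N" and sub: "fst a \<subseteq> pverts G" "snd a \<subseteq> pverts G"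
    and cover: "pverts G \<subseteq> (\<Union>u\<in>splitting_stars N. part G u)"
  shows "induced_separation T (part G) a = unorient a"
proof -
  have sa: "prod.swap a \<in> orientations N" using a by (simp add: orientations_swap)
  have "tree_side T (part G) a (star_at (prod.swap a)) = tree_side T (part G) (prod.swap a) (star_at (prod.swap a))"
    by (simp add: tree_side_def delete_edge_swap[OF a])
  also have "\<dots> = fst a" using tree_side_eq[OF sa _ cover] sub by simp
  finally show ?thesis
    using tree_side_eq[OF a sub(2) cover] a by (auto simp: induced_separation_def unorient_def)
qed

end

section \<open>The tree-decomposition given by a nested set of bounded order\<close>

locale bounded_tree_set = locally_finite_connected C for C :: "'b pair_pre_digraph" +
  fixes N :: "'b sep set" and K :: nat
  assumes tight: "s \<in> N \<Longrightarrow> tight C s" and bounded: "s \<in> N \<Longrightarrow> sep_order s \<le> enat K"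
    and nested_N: "s \<in> N \<Longrightarrow> t \<in> N \<Longrightarrow> nested s t"
begin

lemma orientationsD:
  assumes "a \<in> orientations N"
  shows "tight C {fst a, snd a}" "sep_order {fst a, snd a} \<le> enat K" "is_separation C (fst a) (snd a)"
    "\<exists>u. u \<in> fst a - snd a" "\<exists>u. u \<in> snd a - fst a"
proof -
  have s: "{fst a, snd a} \<in> N" using assms by (simp add: orientations_def unorient_def)
  show t: "tight C {fst a, snd a}" "sep_order {fst a, snd a} \<le> enat K" using tight[OF s] bounded[OF s] .
  show "is_separation C (fst a) (snd a)" using t by (simp add: tight_iff)
  show "\<exists>u. u \<in> fst a - snd a" "\<exists>u. u \<in> snd a - fst a"
    using t(1) full_componentD(1) unfolding tight_iff by blast+
qed

sublocale tree_set N
proof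
  show "\<not> fst a \<subseteq> snd a" if "a \<in> orientations N" for a
    using orientationsD(4)[OF that] by blast
  show "finite {c \<in> orientations N. osep_ge a c \<and> osep_ge c b}"
    if ab: "a \<in> orientations N" "b \<in> orientations N" for a b
  proof -
    obtain u w where uw: "u \<in> fst a - snd a" "w \<in> snd b - fst b"
      using orientationsD(4)[OF ab(1)] orientationsD(5)[OF ab(2)] by blast
    have "{c \<in> orientations N. osep_ge a c \<and> osep_ge c b} \<subseteq>
        {(A, B). tight C {A, B} \<and> sep_order {A, B} \<le> enat K \<and> u \<in> A - B \<and> w \<in> B - A}"
      using uw orientationsD(1,2) by (fastforce simp: osep_ge_def)
    moreover have "u \<in> pverts C" "w \<in> pverts C"
      using uw orientationsD(3)[OF ab(1)] orientationsD(3)[OF ab(2)] by (auto simp: is_separation_def)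
    ultimately show ?thesis using finite_tight_separating finite_subset by blast
  qed
qed (rule nested_N)

text \<open>Among the orientations with \<open>U\<close> inside the first side but not the second,
  take a highest \<open>c\<close>; it exists since those above a given one all separate a vertex of
  \<open>U\<close> from a fixed \<open>w\<close>. The star at the reverse of \<open>c\<close> has
  \<open>U\<close> in its part, because its other elements are above \<open>c\<close>. If there are
  no such orientations, any star will do.\<close>

lemma part_covers:
  assumes U: "U \<subseteq> pverts C" "finite U" and small: "\<And>a. a \<in> orientations N \<Longrightarrow> U \<subseteq> fst a \<or> U \<subseteq> snd a"
  obtains \<sigma> where "\<sigma> \<in> splitting_stars N" "U \<subseteq> part C \<sigma>"
proof -
  define P where "P = {c \<in> orientations N. U \<subseteq> fst c \<and> \<not> U \<subseteq> snd c}"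
  have "\<exists>\<sigma>\<in>splitting_stars N. U \<subseteq> part C \<sigma>"
  proof (cases "P = {}")
    case True
    obtain \<sigma> where \<sigma>: "\<sigma> \<in> splitting_stars N"
      using connected_T unfolding connected_def strongly_connected_def mk_symmetric_def by auto
    have "U \<subseteq> snd a" if "a \<in> \<sigma>" for a
      using splitting_starsD(1)[OF \<sigma>] that True small unfolding P_def by blast
    then have "U \<subseteq> part C \<sigma>" using U(1) unfolding part_def by blast
    then show ?thesis using \<sigma> by blast
  next
    case False
    then obtain a where a: "a \<in> P" by blast
    then have aN: "a \<in> orientations N" by (simp add: P_def)
    obtain w where w: "w \<in> snd a - fst a" using orientationsD(5)[OF aN] by blast
    have wC: "w \<in> pverts C" using w orientationsD(3)[OF aN] by (auto simp: is_separation_def)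
    have "{c \<in> P. osep_ge c a} \<subseteq>
        (\<Union>u\<in>U. {(A, B). tight C {A, B} \<and> sep_order {A, B} \<le> enat K \<and> u \<in> A - B \<and> w \<in> B - A})"
    proof
      fix c assume c: "c \<in> {c \<in> P. osep_ge c a}"
      then obtain u where u: "u \<in> U" "u \<in> fst c - snd c" by (auto simp: P_def)
      moreover have "w \<in> snd c - fst c" using w c by (auto simp: osep_ge_def)
      moreover have "tight C {fst c, snd c}" "sep_order {fst c, snd c} \<le> enat K"
        using c orientationsD by (auto simp: P_def)
      ultimately show "c \<in> (\<Union>u\<in>U. {(A, B). tight C {A, B} \<and> sep_order {A, B} \<le> enat K \<and> u \<in> A - B \<and> w \<in> B - A})"
        by (cases c) auto
    qed
    moreover have "finite (\<Union>u\<in>U. {(A, B). tight C {A, B} \<and> sep_order {A, B} \<le> enat K \<and> u \<in> A - B \<and> w \<in> B - A})"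
      using U wC finite_tight_separating by blast
    ultimately have "finite {c \<in> P. osep_ge c a}" by (rule finite_subset)
    then obtain c where c: "c \<in> P" "osep_ge c a" and min: "\<And>d. d \<in> P \<Longrightarrow> osep_ge d c \<Longrightarrow> d = c"
      using obtain_minimal_in_interval[OF a] by blast
    have cN: "c \<in> orientations N" "prod.swap c \<in> orientations N" using c by (auto simp: P_def orientations_swap)
    note \<sigma> = star_at_splitting[OF cN(2)]
    have "U \<subseteq> snd d" if d: "d \<in> star_at (prod.swap c)" for d
    proof (cases "d = prod.swap c")
      case True
      then show ?thesis using c(1) by (simp add: P_def)
    next
      case False
      have dc: "osep_ge d c"
        using splitting_starsD(2)[OF \<sigma> d self_in_star_at[OF cN(2)] False] by simp
      have dN: "d \<in> orientations N" using splitting_starsD(1)[OF \<sigma>] d by blast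
      have "d \<noteq> c" using splitting_starsD(3)[OF \<sigma> d] self_in_star_at[OF cN(2)] by auto
      then have "d \<notin> P" using min dc by blast
      then show ?thesis using small[OF dN] dN by (auto simp: P_def)
    qed
    then have "U \<subseteq> part C (star_at (prod.swap c))" using U by (auto simp: part_def)
    then show ?thesis using \<sigma> by blast
  qed
  then show ?thesis using that by blast
qed

lemma part_covers_vertex:
  "pverts C \<subseteq> (\<Union>u\<in>splitting_stars N. part C u)"
proof
  fix v assume v: "v \<in> pverts C"
  obtain \<sigma> where "\<sigma> \<in> splitting_stars N" "{v} \<subseteq> part C \<sigma>"
    by (rule part_covers[of "{v}"]) (use v orientationsD(3) in \<open>auto simp: is_separation_def\<close>)
  then show "v \<in> (\<Union>u\<in>splitting_stars N. part C u)" by blast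
qed

lemma tree_decomposition_T: "tree_decomposition C T (part C)"
  unfolding tree_decomposition_def
proof (intro conjI allI impI ballI)
  show "graph_tree T" by (rule graph_tree_T)
  show "(\<Union>t\<in>verts T. part C t) = pverts C"
    using part_covers_vertex by (auto simp: part_def)
  fix e assume e: "e \<in> parcs C"
  obtain u v where uv: "e = (u, v)" by (cases e)
  have "{u, v} \<subseteq> fst a \<or> {u, v} \<subseteq> snd a" if "a \<in> orientations N" for a
    using orientationsD(3)[OF that] e arc_verts[of u v] unfolding uv is_separation_def by blast
  then obtain \<sigma> where "\<sigma> \<in> splitting_stars N" "{u, v} \<subseteq> part C \<sigma>"
    using part_covers[of "{u, v}"] e arc_verts[of u v] unfolding uv by blast
  then show "case e of (u, v) \<Rightarrow> \<exists>t\<in>verts T. u \<in> part C t \<and> v \<in> part C t"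
    unfolding uv by auto
qed (rule part_path)

lemma induced_separation_T:
  assumes "s \<in> N"
  obtains e where "e \<in> arcs T" "induced_separation T (part C) e = s"
proof -
  obtain a where a: "unorient a = s" using nested_N[OF assms assms] by (auto simp: nested_def)
  then have aN: "a \<in> orientations N" using assms by (simp add: orientations_def)
  have "induced_separation T (part C) a = s"
    unfolding a[symmetric]
    by (rule induced_separation_eq[OF aN _ _ part_covers_vertex])
      (use orientationsD(3)[OF aN] in \<open>auto simp: is_separation_def\<close>)
  then show ?thesis using that aN by simp
qed

end

section \<open>Tangles\<close>

lemma tangleD:
  assumes "tangle G l \<tau>"
  shows "(A, B) \<in> \<tau> \<Longrightarrow> is_separation G A B" "(A, B) \<in> \<tau> \<Longrightarrow> sep_order {A, B} < enat l"
    and "is_separation G A B \<Longrightarrow> sep_order {A, B} < enat l \<Longrightarrow> (A, B) \<in> \<tau> \<or> (B, A) \<in> \<tau>"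
  using assms unfolding tangle_def by auto

lemma tangle_not_covered:
  assumes "tangle G l \<tau>" "(A, B) \<in> \<tau>" "(D, E) \<in> \<tau>" "(P, Q) \<in> \<tau>" "pverts G \<subseteq> A \<union> D \<union> P"
    and "\<And>u v. (u, v) \<in> parcs G \<Longrightarrow> u \<in> A \<and> v \<in> A \<or> u \<in> D \<and> v \<in> D \<or> u \<in> P \<and> v \<in> P"
  shows False
proof -
  have "A \<subseteq> pverts G" "D \<subseteq> pverts G" "P \<subseteq> pverts G"
    using tangleD(1)[OF assms(1)] assms(2-4) unfolding is_separation_def by blast+
  then have "A \<union> D \<union> P = pverts G" using assms(5) by blast
  have "\<forall>a\<in>\<tau>. \<forall>b\<in>\<tau>. \<forall>c\<in>\<tau>. \<not> (fst a \<union> fst b \<union> fst c = pverts G \<and>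
      (\<forall>(u, v)\<in>parcs G. \<exists>s\<in>{a, b, c}. u \<in> fst s \<and> v \<in> fst s))"
    using assms(1) by (simp add: tangle_def)
  from bspec[OF bspec[OF bspec[OF this assms(2)] assms(3)] assms(4)]
  show False
    using \<open>A \<union> D \<union> P = pverts G\<close> assms(6) by auto
qed

lemma distinguishes_sym: "distinguishes s \<tau> \<tau>' \<Longrightarrow> distinguishes s \<tau>' \<tau>"
  by (auto simp: distinguishes_def insert_commute)

lemma sep_order_lt: "sep_order {A, B} < enat l \<longleftrightarrow> finite (A \<inter> B) \<and> card (A \<inter> B) < l"
  by (auto simp: sep_order_def ecard_def)

section \<open>Separations of minimum order distinguishing two tangles\<close>

context locally_finite_connected
begin

text \<open>If no component of \<open>B - A\<close> had neighbourhood \<open>A \<inter> B\<close>, the components with a given smaller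
  neighbourhood could be moved to the small side \<open>A\<close> one group after the other.\<close>

lemma distinguisher_full_component:
  assumes \<tau>: "tangle C l \<tau>" and \<tau>': "tangle C l' \<tau>'" and AB: "(A, B) \<in> \<tau>" "(B, A) \<in> \<tau>'"
    and min: "\<And>s'. distinguishes s' \<tau> \<tau>' \<Longrightarrow> sep_order {A, B} \<le> sep_order s'"
  shows "\<exists>K. full_component C (A \<inter> B) K \<and> K \<subseteq> B - A"
proof (rule ccontr)
  assume none: "\<not> ?thesis"
  have sep: "is_separation C A B" using tangleD(1)[OF \<tau> AB(1)] .
  have V: "A \<union> B = pverts C" using sep by (simp add: is_separation_def)
  define X where "X = A \<inter> B"
  have X: "finite X" "card X < l" "card X < l'"
    using tangleD(2)[OF \<tau> AB(1)] tangleD(2)[OF \<tau>' AB(2)] by (auto simp: sep_order_lt X_def Int_commute)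
  \<comment> \<open>\<open>nb v\<close> is the neighbourhood of the component of \<open>v\<close> in
    \<open>B - A\<close>; \<open>U S\<close> below collects the components with neighbourhood
    \<open>S\<close>.\<close>
  define nb where "nb v = {x \<in> X. \<exists>w. conn C (B - A) v w \<and> (w, x) \<in> parcs C}" for v
  define U where "U S = {v \<in> B - A. nb v = S}" for S
  have nb_arc: "w \<in> U S \<or> w \<in> S" if "v \<in> U S" "(v, w) \<in> parcs C" for v w S
  proof (cases "w \<in> A")
    case True
    then have "w \<in> X"
      using sep that arc_verts[OF that(2)] unfolding is_separation_def X_def U_def by blast
    moreover have "conn C (B - A) v v" using that(1) by (simp add: U_def)
    ultimately have "w \<in> nb v" using that(2) unfolding nb_def by blast
    then show ?thesis using that(1) by (simp add: U_def)
  next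
    case False
    then have wB: "w \<in> B - A" using arc_verts[OF that(2)] V by blast
    have vw: "conn C (B - A) v w"
      by (rule rtrancl_on_into_rtrancl_on[of v v]) (use that wB in \<open>auto simp: U_def\<close>)
    then have "conn C (B - A) v z \<longleftrightarrow> conn C (B - A) w z" for z
      using rtrancl_on_trans[OF vw] rtrancl_on_trans[OF conn_symD[OF vw]] by blast
    then have "nb v = nb w" by (simp add: nb_def)
    then show ?thesis using that(1) wB by (simp add: U_def)
  qed
  have psub: "nb v \<subset> X" if v: "v \<in> B - A" for v
  proof -
    define K where "K = {w. conn C (B - A) v w}"
    have KBA: "K \<subseteq> B - A" unfolding K_def using in_rtrancl_on_in_F(2) by fast
    have "full_component C X K" if "nb v = X"
      unfolding full_component_def
    proof (intro conjI ballI allI impI)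
      show "K \<noteq> {}" using v by (auto simp: K_def)
      show "K \<subseteq> pverts C - X" using KBA V by (auto simp: X_def)
      show "\<exists>k\<in>K. (k, x) \<in> parcs C" if "x \<in> X" for x
        using \<open>nb v = X\<close> that unfolding nb_def K_def by blast
      show closed: "z \<in> K \<union> X" if k: "k \<in> K" and kz: "(k, z) \<in> parcs C" for k z
      proof (cases "z \<in> A")
        case True
        then show ?thesis
          using sep k kz KBA arc_verts[OF kz] unfolding is_separation_def X_def by blast
      next
        case False
        then have "z \<in> B - A" using arc_verts[OF kz] V by blast
        then show ?thesis using k kz by (auto simp: K_def intro: rtrancl_on_into_rtrancl_on)
      qed
      have c: "conn C K v w" if w: "w \<in> K" for w
      proof -
        have "conn C ((B - A) \<inter> K) v w"
        proof (rule conn_stays)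
          show "conn C (B - A) v w" using w by (simp add: K_def)
          show "v \<in> K" using v by (simp add: K_def)
          show "z \<in> K" if "k \<in> B - A" "z \<in> B - A" "k \<in> K" "(k, z) \<in> parcs C" for k z
            using that by (auto simp: K_def intro: rtrancl_on_into_rtrancl_on)
        qed
        then show ?thesis by (rule conn_mono) auto
      qed
      show "conn C K a b" if "a \<in> K" "b \<in> K" for a b
        using c[OF that(1)] c[OF that(2)] conn_symD rtrancl_on_trans by meson
    qed
    then show ?thesis using none KBA unfolding X_def nb_def by blast
  qed
  \<comment> \<open>This separation has order below that of \<open>{A, B}\<close>, so by minimality
    the tangles agree on it. \<tau>' cannot contain the reverse, since that and
    \<open>(B, A)\<close> would cover the graph.\<close>
  have small: "(U S \<union> S, pverts C - U S) \<in> \<tau>" if S: "S \<subset> X" for S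
  proof -
    have US: "U S \<subseteq> B - A" by (auto simp: U_def)
    have sepU: "is_separation C (U S \<union> S) (pverts C - U S)"
      unfolding is_separation_def
    proof (intro conjI ballI)
      show "U S \<union> S \<union> (pverts C - U S) = pverts C" using US V S by (auto simp: X_def)
      fix u v assume uv: "u \<in> U S \<union> S - (pverts C - U S)" "v \<in> pverts C - U S - (U S \<union> S)"
      then have "u \<in> U S" using S V by (auto simp: X_def)
      then show "(u, v) \<notin> parcs C" "(v, u) \<notin> parcs C" using nb_arc[of u S v] uv arc_sym by blast+
    qed
    have int: "(U S \<union> S) \<inter> (pverts C - U S) = S" using US S V by (auto simp: X_def)
    have cS: "finite S" "card S < card X"
      using S X(1) by (auto intro: finite_subset psubset_card_mono)
    have o: "sep_order {U S \<union> S, pverts C - U S} = enat (card S)"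
      using int cS by (simp add: sep_order_eq_pair)
    have nd: "\<not> distinguishes {U S \<union> S, pverts C - U S} \<tau> \<tau>'"
    proof
      assume "distinguishes {U S \<union> S, pverts C - U S} \<tau> \<tau>'"
      then have "sep_order {A, B} \<le> enat (card S)" using min o by metis
      then show False using cS(2) X(1) by (simp add: sep_order_def ecard_def X_def)
    qed
    have "(pverts C - U S, U S \<union> S) \<notin> \<tau>'"
    proof
      assume "(pverts C - U S, U S \<union> S) \<in> \<tau>'"
      then show False
      proof (rule tangle_not_covered[OF \<tau>' AB(2) AB(2)])
        show "pverts C \<subseteq> B \<union> B \<union> (pverts C - U S)" using US by blast
        fix u v assume uv: "(u, v) \<in> parcs C"
        have "S \<subseteq> B" using S by (auto simp: X_def)
        then have "u \<in> U S \<Longrightarrow> v \<in> B" "v \<in> U S \<Longrightarrow> u \<in> B"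
          using nb_arc[OF _ uv, of S] nb_arc[OF _ arc_sym[OF uv], of S] US by blast+
        then show "u \<in> B \<and> v \<in> B \<or> u \<in> B \<and> v \<in> B \<or> u \<in> pverts C - U S \<and> v \<in> pverts C - U S"
          using US arc_verts[OF uv] by blast
      qed
    qed
    then have "(U S \<union> S, pverts C - U S) \<in> \<tau>'"
      using tangleD(3)[OF \<tau>' sepU] o cS X by auto
    then show ?thesis
      using tangleD(3)[OF \<tau> sepU] o cS X nd unfolding distinguishes_def by (auto simp: insert_commute)
  qed
  \<comment> \<open>Moving components keeps the separator \<open>X\<close>. Otherwise the new
    reversed separation, the previous one and the one from \<open>small\<close> would cover the
    graph.\<close>
  have moved: "(A \<union> \<Union>(U ` F), B - \<Union>(U ` F)) \<in> \<tau>" if "finite F" "F \<subseteq> {S. S \<subset> X}" for F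
    using that
  proof (induct F rule: finite_induct)
    case empty
    then show ?case using AB by simp
  next
    case (insert S F)
    define W where "W = \<Union>(U ` F)"
    have IH: "(A \<union> W, B - W) \<in> \<tau>" using insert by (simp add: W_def)
    have S: "S \<subset> X" using insert by simp
    have WU: "W \<subseteq> B - A" "U S \<subseteq> B - A" by (auto simp: W_def U_def)
    have closed: "w \<in> U S \<union> W \<or> w \<in> A" if v: "v \<in> U S \<union> W" and vw: "(v, w) \<in> parcs C" for v w
    proof -
      obtain S' where S': "S' \<in> insert S F" "v \<in> U S'" using v by (auto simp: W_def)
      then have "w \<in> U S' \<or> w \<in> S'" "S' \<subseteq> X" using nb_arc[OF S'(2) vw] insert(4) by blast+
      then show ?thesis using S'(1) by (auto simp: W_def X_def)
    qed
    have sepW: "is_separation C (A \<union> (U S \<union> W)) (B - (U S \<union> W))"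
      unfolding is_separation_def
    proof (intro conjI ballI)
      show "A \<union> (U S \<union> W) \<union> (B - (U S \<union> W)) = pverts C" using WU V by blast
      fix u v assume uv: "u \<in> A \<union> (U S \<union> W) - (B - (U S \<union> W))" "v \<in> B - (U S \<union> W) - (A \<union> (U S \<union> W))"
      then have "u \<in> A - B \<and> v \<in> B - A \<or> u \<in> U S \<union> W \<and> v \<notin> A \<union> (U S \<union> W)" by blast
      then show "(u, v) \<notin> parcs C" "(v, u) \<notin> parcs C"
        using sep closed arc_sym unfolding is_separation_def by blast+
    qed
    have int: "(A \<union> (U S \<union> W)) \<inter> (B - (U S \<union> W)) = X" using WU by (auto simp: X_def)
    have o: "sep_order {A \<union> (U S \<union> W), B - (U S \<union> W)} < enat l"
      using int X by (simp add: sep_order_lt)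
    have "(B - (U S \<union> W), A \<union> (U S \<union> W)) \<notin> \<tau>"
    proof
      assume r: "(B - (U S \<union> W), A \<union> (U S \<union> W)) \<in> \<tau>"
      show False
      proof (rule tangle_not_covered[OF \<tau> IH r small[OF S]])
        show "pverts C \<subseteq> A \<union> W \<union> (B - (U S \<union> W)) \<union> (U S \<union> S)" using V by blast
        fix u v assume uv: "(u, v) \<in> parcs C"
        have "u \<in> U S \<Longrightarrow> v \<in> U S \<union> S" "v \<in> U S \<Longrightarrow> u \<in> U S \<union> S"
          using nb_arc uv arc_sym by blast+
        moreover have "u \<in> A \<union> W \<and> v \<in> A \<union> W \<or> u \<in> B - W \<and> v \<in> B - W"
          using tangleD(1)[OF \<tau> IH] arc_verts[OF uv] uv unfolding is_separation_def by blast
        ultimately show "u \<in> A \<union> W \<and> v \<in> A \<union> W \<or>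
            u \<in> B - (U S \<union> W) \<and> v \<in> B - (U S \<union> W) \<or> u \<in> U S \<union> S \<and> v \<in> U S \<union> S"
          by blast
      qed
    qed
    then have "(A \<union> (U S \<union> W), B - (U S \<union> W)) \<in> \<tau>" using tangleD(3)[OF \<tau> sepW o] by blast
    then show ?case by (simp add: W_def)
  qed
  have "B - A \<subseteq> \<Union>(U ` {S. S \<subset> X})" using psub by (auto simp: U_def)
  moreover have "finite {S. S \<subset> X}" by (rule finite_subset[of _ "Pow X"]) (use X in auto)
  ultimately obtain F where F: "(A \<union> F, B - F) \<in> \<tau>" "B - A \<subseteq> F"
    using moved[of "{S. S \<subset> X}"] by blast
  \<comment> \<open>With all components moved, a single first side is the whole vertex set.\<close>
  show False
    by (rule tangle_not_covered[OF \<tau> F(1) F(1) F(1)]) (use F(2) V arc_verts in blast)+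
qed

text \<open>Neither of the other constituents distinguishes the tangles, and \<tau>' forces their
  orientation. So all three constituents lie in \<tau>, yet their first sides cover the
  graph.\<close>

lemma top_star_tangle:
  assumes star: "top_star C a b c" and \<tau>: "tangle C l \<tau>" and \<tau>': "tangle C l' \<tau>'"
    and a: "a \<in> \<tau>" "prod.swap a \<in> \<tau>'"
    and ord: "\<And>s. s \<in> {b, c} \<Longrightarrow> sep_order (unorient s) < enat l \<and> sep_order (unorient s) < enat l'"
    and nd: "\<And>s. s \<in> {b, c} \<Longrightarrow> \<not> distinguishes (unorient s) \<tau> \<tau>'"
  shows False
proof -
  obtain A1 B1 A2 B2 A3 B3 where abc: "a = (A1, B1)" "b = (A2, B2)" "c = (A3, B3)"
    by (cases a; cases b; cases c)
  have d: "a \<noteq> b" "a \<noteq> c" "b \<noteq> c" using star by (auto simp: top_star_def)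
  have sep: "is_separation C A1 B1" "is_separation C A2 B2" "is_separation C A3 B3"
    using star by (auto simp: top_star_def abc)
  have V: "A1 \<union> B1 = pverts C" "A2 \<union> B2 = pverts C" "A3 \<union> B3 = pverts C"
    using sep by (simp_all add: is_separation_def)
  have disj: "(A1 - B1) \<inter> (A2 - B2) = {}" "(A1 - B1) \<inter> (A3 - B3) = {}" "(A2 - B2) \<inter> (A3 - B3) = {}"
  proof -
    have "\<forall>s\<in>{a, b, c}. \<forall>t\<in>{a, b, c}. s \<noteq> t \<longrightarrow> (fst s - snd s) \<inter> (fst t - snd t) = {}"
      using star unfolding top_star_def by (elim conjE)
    then show "(A1 - B1) \<inter> (A2 - B2) = {}" "(A1 - B1) \<inter> (A3 - B3) = {}" "(A2 - B2) \<inter> (A3 - B3) = {}"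
      using d unfolding abc by (metis fst_conv snd_conv insertCI)+
  qed
  have part: "(A1 - B1) \<union> (A2 - B2) \<union> (A3 - B3) = pverts C - (A1 \<inter> B1 \<union> A2 \<inter> B2 \<union> A3 \<inter> B3)"
  proof -
    have "(\<Union>s\<in>{a, b, c}. fst s - snd s) = pverts C - (\<Union>s\<in>{a, b, c}. separator s)"
      using star unfolding top_star_def by (elim conjE)
    then show ?thesis by (simp add: abc separator_def Un_assoc)
  qed
  have twice: "A1 \<inter> B1 \<subseteq> A2 \<inter> B2 \<union> A3 \<inter> B3" "A2 \<inter> B2 \<subseteq> A1 \<inter> B1 \<union> A3 \<inter> B3" "A3 \<inter> B3 \<subseteq> A1 \<inter> B1 \<union> A2 \<inter> B2"
  proof -
    have *: "\<forall>s\<in>{a, b, c}. \<forall>v\<in>separator s. \<exists>t\<in>{a, b, c} - {s}. v \<in> separator t"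
      using star unfolding top_star_def by (elim conjE)
    have "separator a \<subseteq> separator b \<union> separator c" "separator b \<subseteq> separator a \<union> separator c"
      "separator c \<subseteq> separator a \<union> separator b"
      using bspec[OF *, of a] bspec[OF *, of b] bspec[OF *, of c] by blast+
    then show "A1 \<inter> B1 \<subseteq> A2 \<inter> B2 \<union> A3 \<inter> B3" "A2 \<inter> B2 \<subseteq> A1 \<inter> B1 \<union> A3 \<inter> B3" "A3 \<inter> B3 \<subseteq> A1 \<inter> B1 \<union> A2 \<inter> B2"
      by (simp_all add: separator_def abc)
  qed
  have side: "u \<in> A \<and> v \<in> A" if "(u, v) \<in> parcs C" "u \<in> A - B \<or> v \<in> A - B" "is_separation C A B" for u v A B
    using that arc_verts[OF that(1)] unfolding is_separation_def by blast
  have A1: "(A1, B1) \<in> \<tau>" and B1: "(B1, A1) \<in> \<tau>'" using a by (simp_all add: abc)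
  have in\<tau>: "(A, B) \<in> \<tau>" if "(A, B) \<in> {b, c}" for A B
  proof -
    have sAB: "is_separation C A B" and disjAB: "(A1 - B1) \<inter> (A - B) = {}"
      and sub: "A \<inter> B \<subseteq> A1 \<inter> B1 \<union> A2 \<inter> B2 \<union> A3 \<inter> B3" and partAB: "A - B \<subseteq> pverts C - A1 \<inter> B1"
      using that sep disj part by (auto simp: abc)
    have "(B, A) \<notin> \<tau>'"
    proof
      assume BA: "(B, A) \<in> \<tau>'"
      show False
      proof (rule tangle_not_covered[OF \<tau>' B1 B1 BA])
        show "pverts C \<subseteq> B1 \<union> B1 \<union> B" using V disjAB sAB unfolding is_separation_def by blast
        fix u v assume uv: "(u, v) \<in> parcs C"
        have "u \<in> B1 \<and> v \<in> B1 \<or> u \<in> B \<and> v \<in> B"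
        \<comment> \<open>An edge outside both sides would join \<open>A1 - B1\<close> to
          \<open>A - B\<close>; its end in \<open>A - B\<close> would then lie in the separator of
          \<open>a\<close>, which \<open>A - B\<close> avoids.\<close>
        proof (rule ccontr)
          assume n: "\<not> ?thesis"
          have verts: "u \<in> pverts C" "v \<in> pverts C" using arc_verts[OF uv] by auto
          have VAB: "A \<union> B = pverts C" using sAB by (simp add: is_separation_def)
          have "u \<in> A1 - B1 \<or> v \<in> A1 - B1" "u \<in> A - B \<or> v \<in> A - B" using n verts V VAB by blast+
          then have "u \<in> A1 - B1 \<and> v \<in> A - B \<or> v \<in> A1 - B1 \<and> u \<in> A - B" using disjAB by blast
          moreover have "u \<in> A1" "v \<in> A1" using side[OF uv _ sep(1)] calculation by blast+
          ultimately show False using partAB disjAB by blast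
        qed
        then show "u \<in> B1 \<and> v \<in> B1 \<or> u \<in> B1 \<and> v \<in> B1 \<or> u \<in> B \<and> v \<in> B" by blast
      qed
    qed
    moreover have o: "sep_order {A, B} < enat l" "sep_order {A, B} < enat l'"
      using ord[OF that] by (simp_all add: unorient_def)
    ultimately have AB': "(A, B) \<in> \<tau>'" using tangleD(3)[OF \<tau>' sAB] by blast
    have "(B, A) \<notin> \<tau>"
    proof
      assume "(B, A) \<in> \<tau>"
      then have "distinguishes {A, B} \<tau> \<tau>'" using AB' unfolding distinguishes_def by (metis insert_commute)
      then show False using nd[OF that] by (simp add: unorient_def)
    qed
    then show ?thesis using tangleD(3)[OF \<tau> sAB o(1)] by blast
  qed
  have A2: "(A2, B2) \<in> \<tau>" and A3: "(A3, B3) \<in> \<tau>" using in\<tau> by (simp_all add: abc)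
  have cov: "pverts C \<subseteq> A1 \<union> A2 \<union> A3" using part by blast
  show False
  proof (rule tangle_not_covered[OF \<tau> A1 A2 A3 cov])
    fix u v assume uv: "(u, v) \<in> parcs C"
    note s = side[OF uv _ sep(1)] side[OF uv _ sep(2)] side[OF uv _ sep(3)]
    show "u \<in> A1 \<and> v \<in> A1 \<or> u \<in> A2 \<and> v \<in> A2 \<or> u \<in> A3 \<and> v \<in> A3"
    proof (cases "u \<in> A1 \<inter> B1 \<union> A2 \<inter> B2 \<union> A3 \<inter> B3 \<and> v \<in> A1 \<inter> B1 \<union> A2 \<inter> B2 \<union> A3 \<inter> B3")
      case False
      have "w \<in> A1 - B1 \<or> w \<in> A2 - B2 \<or> w \<in> A3 - B3"
        if "w \<in> pverts C" "w \<notin> A1 \<inter> B1 \<union> A2 \<inter> B2 \<union> A3 \<inter> B3" for w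
        using that part by blast
      then have "u \<in> A1 - B1 \<or> u \<in> A2 - B2 \<or> u \<in> A3 - B3 \<or> v \<in> A1 - B1 \<or> v \<in> A2 - B2 \<or> v \<in> A3 - B3"
        using False arc_verts[OF uv] by meson
      then show ?thesis using s by meson
    next
      case True
      \<comment> \<open>Each separator vertex lies in two of the three first sides, so any two such
        vertices share one.\<close>
      have two: "w \<in> A1 \<and> w \<in> A2 \<or> w \<in> A1 \<and> w \<in> A3 \<or> w \<in> A2 \<and> w \<in> A3"
        if "w \<in> A1 \<inter> B1 \<union> A2 \<inter> B2 \<union> A3 \<inter> B3" for w
        using that twice by blast
      show ?thesis using two[of u] two[of v] True by blast
    qed
  qed
qed

text \<open>Tightness is \<open>distinguisher_full_component\<close> applied with both orders of the
  tangles. A star with no further constituent distinguishing them is excluded by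
  \<open>top_star_tangle\<close>.\<close>

lemma distinguishers_bottleneck:
  assumes \<tau>: "tangle C l \<tau>" and \<tau>': "tangle C l' \<tau>'"
    and s: "distinguishes s\<^sub>0 \<tau> \<tau>'" "sep_order s\<^sub>0 = enat k"
    and min: "\<And>s'. distinguishes s' \<tau> \<tau>' \<Longrightarrow> enat k \<le> sep_order s'"
  shows "bottleneck C k {s. distinguishes s \<tau> \<tau>' \<and> sep_order s = enat k}" (is "bottleneck C k ?\<beta>")
  unfolding bottleneck_def
proof (intro conjI ballI allI impI)
  show "?\<beta> \<noteq> {}" using s by blast
  show "sep_order s = enat k" if "s \<in> ?\<beta>" for s using that by simp
  show "tight C s" if mem: "s \<in> ?\<beta>" for s
  proof -
    obtain A B where AB: "s = {A, B}" "(A, B) \<in> \<tau>" "(B, A) \<in> \<tau>'"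
      using mem by (auto simp: distinguishes_def)
    have o: "sep_order {A, B} = enat k" "sep_order {B, A} = enat k"
      using mem AB by (simp_all add: insert_commute)
    have "\<exists>K. full_component C (A \<inter> B) K \<and> K \<subseteq> B - A"
      by (rule distinguisher_full_component[OF \<tau> \<tau>' AB(2,3)]) (use min o in simp)
    moreover have "\<exists>K. full_component C (B \<inter> A) K \<and> K \<subseteq> A - B"
      by (rule distinguisher_full_component[OF \<tau>' \<tau> AB(3,2)]) (use min[OF distinguishes_sym] o in simp)
    ultimately show ?thesis
      unfolding AB(1) tight_iff using tangleD(1)[OF \<tau> AB(2)] by (simp add: Int_commute)
  qed
  fix a b c
  assume star: "top_star C a b c" and ord: "\<forall>s\<in>{a, b, c}. sep_order (unorient s) \<le> enat k"
    and a: "unorient a \<in> ?\<beta>"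
  obtain A B where AB: "unorient a = {A, B}" "(A, B) \<in> \<tau>" "(B, A) \<in> \<tau>'"
    using a by (auto simp: distinguishes_def)
  have "sep_order {A, B} = enat k" using a AB by simp
  then have kl: "enat k < enat l" "enat k < enat l'"
    using tangleD(2)[OF \<tau> AB(2)] tangleD(2)[OF \<tau>' AB(3)] by (simp_all add: insert_commute)
  show "unorient b \<in> ?\<beta> \<or> unorient c \<in> ?\<beta>"
  proof (rule ccontr)
    assume n: "\<not> ?thesis"
    have nd: "\<not> distinguishes (unorient s) \<tau> \<tau>'" if "s \<in> {b, c}" for s
    proof
      assume d: "distinguishes (unorient s) \<tau> \<tau>'"
      have "sep_order (unorient s) \<le> enat k" using ord that by auto
      then have "sep_order (unorient s) = enat k" using min[OF d] by (rule order.antisym)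
      then show False using d n that by auto
    qed
    have o: "sep_order (unorient s) < enat l \<and> sep_order (unorient s) < enat l'" if "s \<in> {b, c}" for s
      using ord that kl by (meson insertCI le_less_trans)
    have "a = (A, B) \<or> a = (B, A)" using AB(1) by (cases a) (auto simp: unorient_def doubleton_eq_iff)
    then show False
    proof
      assume "a = (A, B)"
      then show False using top_star_tangle[OF star \<tau> \<tau>' _ _ o nd] AB by simp
    next
      \<comment> \<open>The two tangles exchange roles.\<close>
      assume a: "a = (B, A)"
      have "\<not> distinguishes (unorient s) \<tau>' \<tau>" if "s \<in> {b, c}" for s
        using nd[OF that] distinguishes_sym by blast
      then show False using top_star_tangle[OF star \<tau>' \<tau>, of ] a o AB by simp
    qed
  qed
qed

lemma N_set_distinguishes_efficiently:
  assumes \<tau>: "tangle C l \<tau>" and \<tau>': "tangle C l' \<tau>'" and d: "distinguishes s\<^sub>1 \<tau> \<tau>'"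
  obtains s where "s \<in> N_set C" "efficiently_distinguishes C s \<tau> \<tau>'"
proof -
  obtain s\<^sub>0 where s0: "distinguishes s\<^sub>0 \<tau> \<tau>'" and min: "\<And>s'. distinguishes s' \<tau> \<tau>' \<Longrightarrow> sep_order s\<^sub>0 \<le> sep_order s'"
    using d wellorder_Least_lemma[of "\<lambda>n. \<exists>s. distinguishes s \<tau> \<tau>' \<and> sep_order s = n"]
    by (metis (no_types, lifting))
  obtain A B where AB: "s\<^sub>0 = {A, B}" "(A, B) \<in> \<tau>" using s0 by (auto simp: distinguishes_def)
  then have "sep_order s\<^sub>0 < enat l" using tangleD(2)[OF \<tau>] by simp
  then obtain k where k: "sep_order s\<^sub>0 = enat k" by (cases "sep_order s\<^sub>0") auto
  have "bottleneck C k {s. distinguishes s \<tau> \<tau>' \<and> sep_order s = enat k}"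
    by (rule distinguishers_bottleneck[OF \<tau> \<tau>' s0 k]) (use min k in simp)
  then obtain s where s: "distinguishes s \<tau> \<tau>'" "sep_order s = enat k" "s \<in> N_set C"
    using bottleneck_meets_N_set by blast
  have "s \<in> separations C"
    using s(1) tangleD(1)[OF \<tau>] unfolding distinguishes_def separations_def by blast
  then have "efficiently_distinguishes C s \<tau> \<tau>'"
    unfolding efficiently_distinguishes_def using s min k by simp
  then show ?thesis using that s(3) by blast
qed

end

text \<open>Connectedness is stated for the symmetric closure, which adds no arcs to the already
  symmetric covering graph.\<close>

lemma finite_local_coverI:
  fixes G :: "'a pair_pre_digraph" and C :: "'b pair_pre_digraph"
  assumes "pair_graph G" "local_covering r C G p y x"
  shows "finite_local_cover C G p r x y"
proof -
  interpret G: pair_graph G by fact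
  have cov: "covering C G p" and con: "connected (with_proj C)" and y: "y \<in> pverts C" and py: "p y = x"
    and iso: "induced_map (with_proj G) x p \<in> iso (fundamental_group (with_proj C) y)
             ((fundamental_group (with_proj G) x)\<lparr>carrier := local_subgroup r (with_proj G) x\<rparr>)"
    using assms(2) by (simp_all add: local_covering_def)
  interpret graph_covering C G p
    using cov G.arcs_symmetric by unfold_locales auto
  have "\<exists>W. walk C W \<and> hd W = u \<and> last W = v" if uv: "u \<in> pverts C" "v \<in> pverts C" for u v
  proof -
    have "u \<rightarrow>\<^sup>*\<^bsub>with_proj (mk_symmetric (with_proj C))\<^esub> v"
      using con uv by (auto simp: connected_def strongly_connected_def mk_symmetric_def)
    moreover have "parcs (mk_symmetric (with_proj C)) = parcs C"
      using arc_sym by (auto simp: mk_symmetric_def)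
    ultimately have "conn C (pverts C) u v"
      by (simp add: reachable_def mk_symmetric_def)
    then show ?thesis by (rule conn_walk) auto
  qed
  then show ?thesis
    using y py iso G.pair_finite_verts by unfold_locales auto
qed

theorem theorem3p13:
  fixes G :: "'a pair_pre_digraph" and C :: "'b pair_pre_digraph"
    and p :: "'b \<Rightarrow> 'a" and x :: 'a and y :: 'b and r :: nat
  assumes "pair_graph G" and "connected (with_proj G)"
    and "local_covering r C G p y x"
  shows "decomp_tree_well_defined (N_set C) \<and>
         tree_of_tangles_infinite C (decomp_tree (N_set C)) (part C)"
proof -
  interpret finite_local_cover C G p r x y
    using assms(1,3) by (rule finite_local_coverI)
  obtain K where K: "\<And>s. s \<in> N_set C \<Longrightarrow> tight C s \<and> sep_order s \<le> enat K"
    using N_set_bounded by blast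
  interpret bounded_tree_set C "N_set C" K
    using K N_level_nested by unfold_locales (auto simp: N_set_def)
  \<comment> \<open>The distinguisher found in \<open>N_set C\<close> is efficient whatever
    \<open>k\<close> is, so one tree serves every resolution.\<close>
  have "tree_of_tangles C k (decomp_tree (N_set C)) (part C)" for k
    unfolding tree_of_tangles_def
  proof (intro conjI allI impI)
    fix l l' \<tau> \<tau>'
    assume "tangle C l \<tau>" "tangle C l' \<tau>'"
      and "\<exists>s\<in>separations C. sep_order s \<le> enat k \<and> distinguishes s \<tau> \<tau>'"
    then obtain s where s: "s \<in> N_set C" "efficiently_distinguishes C s \<tau> \<tau>'"
      using N_set_distinguishes_efficiently by metis
    obtain e where "e \<in> arcs (decomp_tree (N_set C))"
      "induced_separation (decomp_tree (N_set C)) (part C) e = s"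
      using s(1) by (rule induced_separation_T)
    then show "\<exists>e\<in>arcs (decomp_tree (N_set C)).
        efficiently_distinguishes C (induced_separation (decomp_tree (N_set C)) (part C) e) \<tau> \<tau>'"
      using s(2) by blast
  qed (rule tree_decomposition_T)
  then show ?thesis
    using well_defined by (simp add: tree_of_tangles_infinite_def)
qed

end
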